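(* Let $n,d,t\ge1$ and let $I\subset S=K[x_1,\dots,x_n]$ be an incompletely $t$-spread lexsegment ideal generated in degree $d$. Then $I$ has linear quotients if and only if $I$ has a linear resolution.
   Context: $K$ is a field and $S=K[x_1,\dots,x_n]$ is the standard graded polynomial ring. A monomial $x_{i_1}\cdots x_{i_d}$ with $i_1\le\dots\le i_d$ is $t$-spread if $i_{j+1}-i_j\ge t$ for all $j=1,\dots,d-1$. $M_{n,d,t}$ is the set of all $t$-spread monomials of degree $d$ in $S$; it is assumed throughout that $n\ge 1+(d-1)t$. The squarefree lexicographic order on $M_{n,d,t}$ ($t\ge1$): for $x_{i_1}\cdots x_{i_d}$ and $x_{j_1}\cdots x_{j_d}$ with increasing indices, $x_{i_1}\cdots x_{i_d}>_{\mathrm{slex}}x_{j_1}\cdots x_{j_d}$ if for some $1\le s\le d$ one has $i_1=j_1,\dots,i_{s-1}=j_{s-1}$ and $i_s<j_s$. For $u,v\in M_{n,d,t}$ with $u\ge_{\mathrm{slex}}v$, set $\mathcal{L}_t(u,v)=\{w\in M_{n,d,t}:u\ge_{\mathrm{slex}}w\ge_{\mathrm{slex}}v\}$, $\mathcal{L}_t^i(v)=\{w\in M_{n,d,t}: w\ge_{\mathrm{slex}}v\}$, $\mathcal{L}_t^f(u)=\{w\in M_{n,d,t}:w\le_{\mathrm{slex}}u\}$. A $t$-spread lexsegment ideal is an ideal $I=(\mathcal{L}_t(u,v))$ of $S$ generated by such a set $\mathcal{L}_t(u,v)$. It is completely $t$-spread lexsegment if $I=(\mathcal{L}_t^i(v))\cap(\mathcal{L}_t^f(u))$,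 and incompletely $t$-spread lexsegment otherwise. A graded ideal $I$ generated in degree $d$ has a ($d$-)linear resolution if $\beta_{i,i+j}(I)=0$ for all $i$ and all $j\ne d$, where $\beta_{i,j}(I)=\dim_K\mathrm{Tor}_i^S(I,K)_j$. A monomial ideal $I$ with minimal set of monomial generators $G(I)$ has linear quotients if there is an ordering $u_1,u_2,\dots,u_m$ of $G(I)$ such that for all $k=2,\dots,m$ the colon ideal $(u_1,\dots,u_{k-1}):u_k$ is generated by a subset of $\{x_1,\dots,x_n\}$. *)

theory Defs
  imports Complex_Main
    "HOL-Algebra.Ideal"
    "HOL-Library.Poly_Mapping"
    "HOL-Library.Function_Algebras"
begin

section \<open>The polynomial ring\<close>

text \<open>A monomial is identified with its exponent vector, a polynomial with its finitely supported
  coefficient function. The ring \<open>K[x\<^sub>1,\<dots>,x\<^sub>n]\<close> consists of those polynomials in which only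
  the variables with index in \<open>{1..n}\<close> occur.\<close>

type_synonym mon = "nat \<Rightarrow>\<^sub>0 nat"
type_synonym 'k mpoly = "mon \<Rightarrow>\<^sub>0 'k"

definition monomials :: "nat \<Rightarrow> mon set" where
  "monomials n = {m. Poly_Mapping.keys m \<subseteq> {1..n}}"

definition mon_deg :: "mon \<Rightarrow> nat" where
  "mon_deg m = (\<Sum>i\<in>Poly_Mapping.keys m. Poly_Mapping.lookup m i)"

definition mono_poly :: "mon \<Rightarrow> 'k::field mpoly" where
  "mono_poly m = Poly_Mapping.single m 1"

definition var :: "nat \<Rightarrow> 'k::field mpoly" where
  "var i = mono_poly (Poly_Mapping.single i 1)"

definition polyring :: "nat \<Rightarrow> 'k::field mpoly ring" where
  "polyring n = \<lparr>carrier = {p. Poly_Mapping.keys p \<subseteq> monomials n},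
                 mult = (*), one = 1, zero = 0, add = (+)\<rparr>"

lemma cring_polyring: "cring (polyring n :: 'k::field mpoly ring)"
proof -
  have add: "Poly_Mapping.keys (p + q) \<subseteq> monomials n"
    if "Poly_Mapping.keys p \<subseteq> monomials n" "Poly_Mapping.keys q \<subseteq> monomials n"
    for p q :: "'k mpoly"
    using that Poly_Mapping.keys_add[of p q] by blast
  have mon_add: "a + b \<in> monomials n" if "a \<in> monomials n" "b \<in> monomials n" for a b
    using that Poly_Mapping.keys_add[of a b] unfolding monomials_def by blast
  have mult: "Poly_Mapping.keys (p * q) \<subseteq> monomials n"
    if "Poly_Mapping.keys p \<subseteq> monomials n" "Poly_Mapping.keys q \<subseteq> monomials n"
    for p q :: "'k mpoly"
    using that keys_mult[of p q] mon_add by blast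
  have one: "Poly_Mapping.keys (1 :: 'k mpoly) \<subseteq> monomials n"
    by (simp add: monomials_def)
  have neg: "\<exists>q\<in>{p. Poly_Mapping.keys p \<subseteq> monomials n}. q + p = 0"
    if "Poly_Mapping.keys p \<subseteq> monomials n" for p :: "'k mpoly"
    using that by (intro bexI[of _ "- p"]) (auto simp: Poly_Mapping.keys_eq_empty in_keys_iff subset_iff)
  show ?thesis
    by (intro cringI abelian_groupI comm_monoidI)
       (use add mult one neg in \<open>auto simp: polyring_def algebra_simps\<close>)
qed

definition colon :: "nat \<Rightarrow> 'k::field mpoly set \<Rightarrow> 'k mpoly \<Rightarrow> 'k mpoly set" where
  "colon n J f = {g \<in> carrier (polyring n). g * f \<in> J}"

definition monomial_ideal :: "nat \<Rightarrow> mon set \<Rightarrow> 'k::field mpoly set" where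
  "monomial_ideal n U = genideal (polyring n) (mono_poly ` U)"

definition minimal_monomial_generators :: "nat \<Rightarrow> mon set \<Rightarrow> 'k::field mpoly set \<Rightarrow> bool" where
  "minimal_monomial_generators n G I \<longleftrightarrow>
     G \<subseteq> monomials n \<and> monomial_ideal n G = I \<and> (\<forall>G'. G' \<subset> G \<longrightarrow> monomial_ideal n G' \<noteq> I)"

text \<open>The list \<open>us\<close> is \<open>u\<^sub>1,\<dots>,u\<^sub>m\<close>; list positions start at \<open>0\<close>, so \<open>us ! k\<close> is \<open>u\<^bsub>k+1\<^esub>\<close> and
  \<open>take k us\<close> is \<open>u\<^sub>1,\<dots>,u\<^sub>k\<close>.\<close>

definition linear_quotients :: "nat \<Rightarrow> 'k::field mpoly set \<Rightarrow> bool" where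
  "linear_quotients n I \<longleftrightarrow>
     (\<exists>us. distinct us \<and> minimal_monomial_generators n (set us) I \<and>
        (\<forall>k. 1 \<le> k \<and> k < length us \<longrightarrow>
           (\<exists>V\<subseteq>{1..n}. colon n (monomial_ideal n (set (take k us)) :: 'k mpoly set) (mono_poly (us ! k))
                        = genideal (polyring n) (var ` V))))"


section \<open>Spread lexsegment ideals\<close>

definition mon_of :: "nat list \<Rightarrow> mon" where
  "mon_of is = (\<Sum>i\<leftarrow>is. Poly_Mapping.single i 1)"

definition tspread_monomials :: "nat \<Rightarrow> nat \<Rightarrow> nat \<Rightarrow> mon set" where
  "tspread_monomials n d t =
     {mon_of is | is. length is = d \<and> set is \<subseteq> {1..n} \<and> sorted is \<and>
                      (\<forall>j. Suc j < d \<longrightarrow> is ! Suc j - is ! j \<ge> t)}"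

definition slex_gt :: "mon \<Rightarrow> mon \<Rightarrow> bool" where
  "slex_gt u v \<longleftrightarrow>
     (\<exists>is js. sorted_wrt (<) is \<and> sorted_wrt (<) js \<and> length is = length js \<and>
        u = mon_of is \<and> v = mon_of js \<and>
        (\<exists>s<length is. (\<forall>r<s. is ! r = js ! r) \<and> is ! s < js ! s))"

definition slex_ge :: "mon \<Rightarrow> mon \<Rightarrow> bool" where
  "slex_ge u v \<longleftrightarrow> u = v \<or> slex_gt u v"

definition lexseg :: "nat \<Rightarrow> nat \<Rightarrow> nat \<Rightarrow> mon \<Rightarrow> mon \<Rightarrow> mon set" where
  "lexseg n d t u v = {w \<in> tspread_monomials n d t. slex_ge u w \<and> slex_ge w v}"

definition initial_lexseg :: "nat \<Rightarrow> nat \<Rightarrow> nat \<Rightarrow> mon \<Rightarrow> mon set" where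
  "initial_lexseg n d t v = {w \<in> tspread_monomials n d t. slex_ge w v}"

definition final_lexseg :: "nat \<Rightarrow> nat \<Rightarrow> nat \<Rightarrow> mon \<Rightarrow> mon set" where
  "final_lexseg n d t u = {w \<in> tspread_monomials n d t. slex_ge u w}"

definition tspread_lexsegment_ideal :: "nat \<Rightarrow> nat \<Rightarrow> nat \<Rightarrow> 'k::field mpoly set \<Rightarrow> bool" where
  "tspread_lexsegment_ideal n d t I \<longleftrightarrow>
     (\<exists>u\<in>tspread_monomials n d t. \<exists>v\<in>tspread_monomials n d t.
        slex_ge u v \<and> I = monomial_ideal n (lexseg n d t u v))"

definition completely_tspread_lexsegment :: "nat \<Rightarrow> nat \<Rightarrow> nat \<Rightarrow> 'k::field mpoly set \<Rightarrow> bool" where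
  "completely_tspread_lexsegment n d t I \<longleftrightarrow>
     (\<exists>u\<in>tspread_monomials n d t. \<exists>v\<in>tspread_monomials n d t.
        slex_ge u v \<and> I = monomial_ideal n (lexseg n d t u v) \<and>
        I = monomial_ideal n (initial_lexseg n d t v) \<inter> monomial_ideal n (final_lexseg n d t u))"

definition incompletely_tspread_lexsegment :: "nat \<Rightarrow> nat \<Rightarrow> nat \<Rightarrow> 'k::field mpoly set \<Rightarrow> bool" where
  "incompletely_tspread_lexsegment n d t I \<longleftrightarrow>
     tspread_lexsegment_ideal n d t I \<and> \<not> completely_tspread_lexsegment n d t I"


section \<open>Graded free resolutions, Tor and graded Betti numbers\<close>

text \<open>A complex of finitely generated graded free modules \<open>\<dots> \<rightarrow> F\<^sub>1 \<rightarrow> F\<^sub>0\<close> with an augmentation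
  \<open>F\<^sub>0 \<rightarrow> S\<close> is given in bases: \<open>F\<^sub>i\<close> has basis elements \<open>e\<^sub>b\<close> for \<open>b < frank F i\<close>, with \<open>e\<^sub>b\<close> of degree
  \<open>fdeg F i b\<close>; \<open>fmat F i\<close> is the matrix (row, column) of the map \<open>F\<^bsub>i+1\<^esub> \<rightarrow> F\<^sub>i\<close>; the augmentation
  sends \<open>e\<^sub>b\<close> to \<open>faug F b\<close>.\<close>

record (overloaded) 'k free_complex =
  frank :: "nat \<Rightarrow> nat"
  fdeg :: "nat \<Rightarrow> nat \<Rightarrow> int"
  fmat :: "nat \<Rightarrow> nat \<Rightarrow> nat \<Rightarrow> 'k mpoly"
  faug :: "nat \<Rightarrow> 'k mpoly"

definition homogeneous :: "int \<Rightarrow> 'k::field mpoly \<Rightarrow> bool" where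
  "homogeneous e p \<longleftrightarrow> (\<forall>m\<in>Poly_Mapping.keys p. int (mon_deg m) = e)"

text \<open>Tuples of length \<open>r\<close> are functions on \<open>nat\<close> that vanish outside \<open>{..<r}\<close>.\<close>

definition free_module :: "nat \<Rightarrow> nat \<Rightarrow> (nat \<Rightarrow> 'k::field mpoly) set" where
  "free_module n r = {f. (\<forall>b<r. f b \<in> carrier (polyring n)) \<and> (\<forall>b\<ge>r. f b = 0)}"

definition mat_app :: "nat \<Rightarrow> nat \<Rightarrow> (nat \<Rightarrow> nat \<Rightarrow> 'a::comm_ring_1) \<Rightarrow> (nat \<Rightarrow> 'a) \<Rightarrow> (nat \<Rightarrow> 'a)" where
  "mat_app s r A f = (\<lambda>a. if a < s then (\<Sum>b<r. A a b * f b) else 0)"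

definition fdiff :: "'k::field free_complex \<Rightarrow> nat \<Rightarrow> (nat \<Rightarrow> 'k mpoly) \<Rightarrow> (nat \<Rightarrow> 'k mpoly)" where
  "fdiff F i = mat_app (frank F i) (frank F (Suc i)) (fmat F i)"

definition faugment :: "'k::field free_complex \<Rightarrow> (nat \<Rightarrow> 'k mpoly) \<Rightarrow> 'k mpoly" where
  "faugment F f = (\<Sum>b<frank F 0. faug F b * f b)"

definition graded_free_resolution :: "nat \<Rightarrow> 'k::field free_complex \<Rightarrow> 'k mpoly set \<Rightarrow> bool" where
  "graded_free_resolution n F I \<longleftrightarrow>
     (\<forall>b<frank F 0. faug F b \<in> carrier (polyring n) \<and> homogeneous (fdeg F 0 b) (faug F b)) \<and>
     (\<forall>i. \<forall>a<frank F i. \<forall>b<frank F (Suc i).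
        fmat F i a b \<in> carrier (polyring n) \<and>
        homogeneous (fdeg F (Suc i) b - fdeg F i a) (fmat F i a b)) \<and>
     faugment F ` free_module n (frank F 0) = I \<and>
     {f \<in> free_module n (frank F 0). faugment F f = 0}
       = fdiff F 0 ` free_module n (frank F (Suc 0)) \<and>
     (\<forall>i. {f \<in> free_module n (frank F (Suc i)). fdiff F i f = 0}
            = fdiff F (Suc i) ` free_module n (frank F (Suc (Suc i))))"

text \<open>The complex \<open>F \<otimes>\<^sub>S K\<close>, where \<open>K = S/(x\<^sub>1,\<dots>,x\<^sub>n)\<close>: since \<open>S(-a) \<otimes>\<^sub>S K = K(-a)\<close>, the component of
  \<open>F\<^sub>i \<otimes>\<^sub>S K\<close> in degree \<open>j\<close> has as \<open>K\<close>-basis the basis elements of \<open>F\<^sub>i\<close> of degree \<open>j\<close>, and the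
  differentials are given by the constant terms of the matrix entries.\<close>

definition tensor_part :: "'k::field free_complex \<Rightarrow> nat \<Rightarrow> int \<Rightarrow> (nat \<Rightarrow> 'k) set" where
  "tensor_part F i j = {v. \<forall>b. v b \<noteq> 0 \<longrightarrow> b < frank F i \<and> fdeg F i b = j}"

definition tensor_diff :: "'k::field free_complex \<Rightarrow> nat \<Rightarrow> (nat \<Rightarrow> 'k) \<Rightarrow> (nat \<Rightarrow> 'k)" where
  "tensor_diff F i =
     mat_app (frank F i) (frank F (Suc i)) (\<lambda>a b. Poly_Mapping.lookup (fmat F i a b) 0)"

definition tensor_cycles :: "'k::field free_complex \<Rightarrow> nat \<Rightarrow> int \<Rightarrow> (nat \<Rightarrow> 'k) set" where
  "tensor_cycles F i j =
     {v \<in> tensor_part F i j. case i of 0 \<Rightarrow> True | Suc i' \<Rightarrow> tensor_diff F i' v = 0}"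

definition tensor_boundaries :: "'k::field free_complex \<Rightarrow> nat \<Rightarrow> int \<Rightarrow> (nat \<Rightarrow> 'k) set" where
  "tensor_boundaries F i j = tensor_diff F i ` tensor_part F (Suc i) j"

abbreviation fun_scale :: "'k::field \<Rightarrow> (nat \<Rightarrow> 'k) \<Rightarrow> (nat \<Rightarrow> 'k)" where
  "fun_scale c v \<equiv> (\<lambda>b. c * v b)"

lemma vector_space_fun_scale: "vector_space (fun_scale :: 'k::field \<Rightarrow> _)"
  by unfold_locales (auto simp: fun_eq_iff algebra_simps)

text \<open>The dimension of the degree \<open>j\<close> component of \<open>H\<^sub>i(F \<otimes>\<^sub>S K)\<close>, the quotient of the cycles by the
  boundaries; all spaces are finite-dimensional.\<close>

definition tensor_homology_dim :: "'k::field free_complex \<Rightarrow> nat \<Rightarrow> int \<Rightarrow> nat" where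
  "tensor_homology_dim F i j =
     vector_space.dim fun_scale (tensor_cycles F i j)
     - vector_space.dim fun_scale (tensor_boundaries F i j)"

text \<open>\<open>Tor\<^sub>i\<^sup>S(I,K)\<close> is the homology of \<open>F \<otimes>\<^sub>S K\<close> for a graded free resolution \<open>F\<close> of \<open>I\<close>. Such a resolution
  by modules of finite rank exists for every graded ideal, and the result does not depend on it.\<close>

definition betti :: "nat \<Rightarrow> 'k::field mpoly set \<Rightarrow> nat \<Rightarrow> int \<Rightarrow> nat" where
  "betti n I i j = tensor_homology_dim (SOME F. graded_free_resolution n F I) i j"

definition has_linear_resolution :: "nat \<Rightarrow> nat \<Rightarrow> 'k::field mpoly set \<Rightarrow> bool" where
  "has_linear_resolution n d I \<longleftrightarrow> (\<forall>i. \<forall>j::int. j \<noteq> int d \<longrightarrow> betti n I i (int i + j) = 0)"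

end

theory Submission
  imports Defs "HOL-Library.List_Lexorder"
begin

text \<open>A \<open>t\<close>-spread monomial is coded by the increasing list of its indices. Then \<open>>\<^sub>s\<^sub>l\<^sub>e\<^sub>x\<close> is the opposite of
  the lexicographic order of lists, and \<open>\<L>\<^sub>t(u,v)\<close> becomes the set of spread lists \<open>l\<close> with \<open>u \<le> l \<le> v\<close>. After
  the common initial part of \<open>u\<close> and \<open>v\<close> is cancelled they read \<open>e # u'\<close> and \<open>c # v'\<close> with \<open>e < c\<close>. Both
  properties of the ideal turn out to be equivalent to one combinatorial condition: for every spread list
  \<open>c # w\<close> with \<open>v' < w\<close>, the list \<open>u'\<close> is at most the list that arises from \<open>c # w\<close> by dropping the last entry
  and adding \<open>t\<close> to all others (\<open>linearity_cond\<close>). There are three implications.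

  Linear quotients give a linear resolution (\<open>linear_resolution_if_linear_quotients\<close>). The Betti numbers are
  first moved to the Koszul complex. The complex on ordered tuples of generators is a graded free resolution
  (\<open>taylor_resolution\<close>), so the choice made in the definition of the Betti numbers is a resolution. The double
  complex that a resolution forms with the Koszul complex of \<open>x\<^sub>1,\<dots>,x\<^sub>n\<close> has exact rows and columns, and a
  diagram chase in it (\<open>zigzag\<close>, \<open>tor_balanced\<close>) shows that \<open>Tor\<^sub>i(I,K)\<^sub>j\<close> vanishes if and only if the Koszul
  complex with coefficients in \<open>I\<close> is exact at that place. For a monomial ideal the latter splits into
  multidegrees \<open>M\<close>, and there it consists of scalar functions on the sets \<open>F\<close> with \<open>M/x\<^sub>F \<in> I\<close>, with the
  signed boundary of simplices. When a generator \<open>g\<close> whose colon ideal is generated by variables is added, the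
  sets \<open>F\<close> that are new form a cone, unless \<open>M\<close> has degree \<open>deg g + |F|\<close>, that is, lies on the linear strand
  (\<open>mexact_insert\<close>).

  A linear resolution forces the condition (\<open>obstruction_if_not_linearity_cond\<close>). If the condition fails,
  there is a cycle off the linear strand in a squarefree multidegree \<open>W\<close>, and an explicit cochain shows that
  it is not a boundary. If \<open>v' < u'\<close>, the members of the segment inside \<open>W\<close> fall into those with and without
  \<open>e\<close>, and the cycle is a difference of two points. Otherwise let \<open>w\<close> be the least list beyond \<open>v'\<close> and let
  \<open>E\<close> consist of the entries shifted by \<open>t\<close> that do not occur in \<open>c # w\<close>. The cycle is the boundary of the
  simplex with vertices \<open>e\<close> and \<open>E\<close>; the cochain is the indicator function of the sets that interleave with
  \<open>E\<close>.

  The condition gives linear quotients (\<open>lq_set_seg\<close>), by explicit orders of the generators and induction on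
  the degree. The generators that need the condition are the \<open>e # a\<close> with \<open>v' < a\<close>: there an entry of \<open>a\<close> has
  to be lowered, and the condition keeps the result at or above \<open>u'\<close>, hence inside the segment.\<close>

section \<open>Monomials and multigraded components\<close>

abbreviation "lk \<equiv> Poly_Mapping.lookup"

definition mdvd :: "mon \<Rightarrow> mon \<Rightarrow> bool" where
  "mdvd a b \<longleftrightarrow> (\<forall>i. lk a i \<le> lk b i)"

lemma mdvd_refl [simp]: "mdvd a a" by (simp add: mdvd_def)
lemma mdvd_zero [simp]: "mdvd 0 a" by (simp add: mdvd_def)
lemma mdvd_trans: "mdvd a b \<Longrightarrow> mdvd b c \<Longrightarrow> mdvd a c"
  unfolding mdvd_def by (meson order_trans)
lemma mdvd_antisym: "mdvd a b \<Longrightarrow> mdvd b a \<Longrightarrow> a = b"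
  unfolding mdvd_def by (intro poly_mapping_eqI) (simp add: order_antisym)
lemma mdvd_add [simp]: "mdvd a (a + b)" "mdvd a (b + a)"
  by (simp_all add: mdvd_def lookup_add)
lemma mdvd_add_minus: "mdvd a b \<Longrightarrow> a + (b - a) = b"
  by (intro poly_mapping_eqI) (simp add: mdvd_def lookup_add lookup_minus)
lemma mdvd_minus_add: "mdvd a b \<Longrightarrow> (b - a) + a = b"
  by (simp add: mdvd_add_minus add.commute)

lemma keys_mdvd: "mdvd a b \<Longrightarrow> Poly_Mapping.keys a \<subseteq> Poly_Mapping.keys b"
  unfolding mdvd_def by (metis in_keys_iff le_zero_eq subsetI)

lemma mon_deg_alt:
  assumes "finite S" "Poly_Mapping.keys m \<subseteq> S"
  shows "mon_deg m = (\<Sum>i\<in>S. lk m i)"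
  unfolding mon_deg_def by (rule sum.mono_neutral_left) (use assms in \<open>auto simp: in_keys_iff\<close>)

lemma mon_deg_add [simp]: "mon_deg (a + b) = mon_deg a + mon_deg b"
proof -
  let ?S = "Poly_Mapping.keys a \<union> Poly_Mapping.keys b"
  have "mon_deg (a + b) = (\<Sum>i\<in>?S. lk (a + b) i)"
    by (rule mon_deg_alt[OF _ Poly_Mapping.keys_add]) simp
  also have "\<dots> = (\<Sum>i\<in>?S. lk a i) + (\<Sum>i\<in>?S. lk b i)"
    by (simp add: lookup_add sum.distrib)
  also have "\<dots> = mon_deg a + mon_deg b"
    using mon_deg_alt[of ?S a] mon_deg_alt[of ?S b] by simp
  finally show ?thesis .
qed

lemma mon_deg_zero [simp]: "mon_deg 0 = 0" by (simp add: mon_deg_def)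

lemma mon_deg_zero_iff: "mon_deg m = 0 \<longleftrightarrow> m = 0"
  unfolding mon_deg_def by (auto simp: in_keys_iff intro!: poly_mapping_eqI)

lemma mon_deg_minus: "mdvd a b \<Longrightarrow> mon_deg b = mon_deg a + mon_deg (b - a)"
  by (metis mdvd_add_minus mon_deg_add)

lemma monomials_mdvd: "mdvd a b \<Longrightarrow> b \<in> monomials n \<Longrightarrow> a \<in> monomials n"
  using keys_mdvd by (auto simp: monomials_def)

lemma monomials_add [simp]: "a + b \<in> monomials n \<longleftrightarrow> a \<in> monomials n \<and> b \<in> monomials n"
proof
  assume "a + b \<in> monomials n"
  then show "a \<in> monomials n \<and> b \<in> monomials n"
    using monomials_mdvd[of a "a + b"] monomials_mdvd[of b "a + b"] by simp
next
  assume "a \<in> monomials n \<and> b \<in> monomials n"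
  then show "a + b \<in> monomials n"
    using Poly_Mapping.keys_add[of a b] unfolding monomials_def by blast
qed

lemma monomials_zero [simp]: "0 \<in> monomials n" by (simp add: monomials_def)

lemma lookup_single_mult:
  "lk (Poly_Mapping.single m c * (f :: 'k::field mpoly)) k = (if mdvd m k then c * lk f (k - m) else 0)"
proof -
  have "lk (Poly_Mapping.single m c * f) k = c * Sum_any (\<lambda>q. lk f q when k = m + q)"
    by (simp add: lookup_mult lookup_single when_mult)
  also have "Sum_any (\<lambda>q. lk f q when k = m + q) = (if mdvd m k then lk f (k - m) else 0)"
  proof (cases "mdvd m k")
    case True
    then have "k = m + q \<longleftrightarrow> q = k - m" for q by (metis add_left_imp_eq mdvd_add_minus)
    then show ?thesis using True by simp
  next
    case False
    then have "k \<noteq> m + q" for q by auto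
    then show ?thesis using False by simp
  qed
  finally show ?thesis by simp
qed

text \<open>A term \<open>m e\<close>, with \<open>e\<close> a basis element of multidegree \<open>\<nu>\<close>, has multidegree \<open>m + \<nu>\<close>. So this is the scalar
  that a coefficient \<open>g\<close> of \<open>e\<close> contributes in multidegree \<open>M\<close>.\<close>

definition mcomp :: "mon \<Rightarrow> mon \<Rightarrow> 'k::field mpoly \<Rightarrow> 'k" where
  "mcomp \<nu> M g = (if mdvd \<nu> M then lk g (M - \<nu>) else 0)"

lemma mcomp_zero [simp]: "mcomp \<nu> M 0 = 0" by (simp add: mcomp_def)
lemma mcomp_sum: "mcomp \<nu> M (\<Sum>i\<in>S. f i) = (\<Sum>i\<in>S. mcomp \<nu> M (f i))"
  by (simp add: mcomp_def lookup_sum)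

lemma mcomp_shift: "mcomp \<nu> (k + \<nu>) g = lk g k"
  by (simp add: mcomp_def)

lemma mcomp_eqI:
  assumes "\<And>M. mcomp \<nu> M f = mcomp \<nu> M g"
  shows "f = g"
  by (rule poly_mapping_eqI) (metis assms mcomp_shift)

text \<open>A multigraded map of free modules has entries that are scalars times \<open>x\<^bsup>\<nu> - \<mu>\<^esup>\<close>. In a fixed multidegree the
  monomial factor disappears, and the map is the matrix of these scalars.\<close>

lemma mcomp_entry:
  assumes "mdvd \<mu> \<nu>"
  shows "mcomp \<mu> M (Poly_Mapping.single (\<nu> - \<mu>) c * g) = c * mcomp \<nu> M g"
proof (cases "mdvd \<mu> M")
  case True
  have "mdvd (\<nu> - \<mu>) (M - \<mu>) \<longleftrightarrow> mdvd \<nu> M"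
    using assms True unfolding mdvd_def by (simp add: lookup_minus) (metis le_diff_iff)
  moreover have "(M - \<mu>) - (\<nu> - \<mu>) = M - \<nu>" if "mdvd \<nu> M"
    using assms True that by (intro poly_mapping_eqI) (simp add: lookup_minus mdvd_def)
  ultimately show ?thesis using True by (simp add: mcomp_def lookup_single_mult)
next
  case False
  then have "\<not> mdvd \<nu> M" using assms mdvd_trans by blast
  then show ?thesis using False by (simp add: mcomp_def)
qed

lemma finite_mcomp_support: "finite {M. mcomp \<nu> M g \<noteq> 0}"
proof (rule finite_subset)
  show "{M. mcomp \<nu> M g \<noteq> 0} \<subseteq> (\<lambda>k. k + \<nu>) ` Poly_Mapping.keys g"
  proof
    fix M assume "M \<in> {M. mcomp \<nu> M g \<noteq> 0}"
    then have "mdvd \<nu> M" "M - \<nu> \<in> Poly_Mapping.keys g"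
      by (auto simp: mcomp_def in_keys_iff split: if_splits)
    then show "M \<in> (\<lambda>k. k + \<nu>) ` Poly_Mapping.keys g" by (metis imageI mdvd_minus_add)
  qed
qed simp

text \<open>Solutions of linear equations that were found in each multidegree separately are put together here.\<close>

lemma poly_of_components:
  fixes c :: "mon \<Rightarrow> 'k::field"
  assumes "finite {M. c M \<noteq> 0}" "\<And>M. c M \<noteq> 0 \<Longrightarrow> mdvd \<nu> M"
  obtains g where "\<And>M. mcomp \<nu> M g = c M"
proof -
  have "{k. c (k + \<nu>) \<noteq> 0} \<subseteq> (\<lambda>M. M - \<nu>) ` {M. c M \<noteq> 0}"
  proof
    fix k assume "k \<in> {k. c (k + \<nu>) \<noteq> 0}"
    moreover have "k = (k + \<nu>) - \<nu>" by simp
    ultimately show "k \<in> (\<lambda>M. M - \<nu>) ` {M. c M \<noteq> 0}" by blast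
  qed
  then have "finite {k. c (k + \<nu>) \<noteq> 0}" using assms(1) by (meson finite_imageI finite_subset)
  then have lk: "lk (Abs_poly_mapping (\<lambda>k. c (k + \<nu>))) = (\<lambda>k. c (k + \<nu>))"
    by simp
  have "mcomp \<nu> M (Abs_poly_mapping (\<lambda>k. c (k + \<nu>))) = c M" for M
    using assms(2)[of M] by (cases "mdvd \<nu> M") (auto simp: mcomp_def lk mdvd_minus_add)
  then show thesis by (rule that)
qed

section \<open>Monomial ideals\<close>

lemma poly_sum_terms: "(p :: 'k::field mpoly) = (\<Sum>m\<in>Poly_Mapping.keys p. Poly_Mapping.single m (lk p m))"
  by (rule poly_mapping_eqI)
     (simp add: lookup_sum lookup_single when_def in_keys_iff)

text \<open>The polynomials all of whose terms are multiples of members of \<open>U\<close> form an ideal, and each such term lies in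
  the ideal generated by \<open>U\<close>.\<close>

lemma monomial_ideal_mem:
  fixes p :: "'k::field mpoly"
  assumes "U \<subseteq> monomials n"
  shows "p \<in> monomial_ideal n U \<longleftrightarrow>
    Poly_Mapping.keys p \<subseteq> monomials n \<and> (\<forall>m\<in>Poly_Mapping.keys p. \<exists>u\<in>U. mdvd u m)"
proof -
  interpret R: cring "polyring n :: 'k mpoly ring" by (rule cring_polyring)
  define J where "J = {p :: 'k mpoly. Poly_Mapping.keys p \<subseteq> monomials n \<and> (\<forall>m\<in>Poly_Mapping.keys p. \<exists>u\<in>U. mdvd u m)}"
  have gens: "mono_poly ` U \<subseteq> carrier (polyring n :: 'k mpoly ring)"
    using assms by (auto simp: polyring_def mono_poly_def)
  interpret I: ideal "monomial_ideal n U :: 'k mpoly set" "polyring n :: 'k mpoly ring"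
    unfolding monomial_ideal_def by (rule R.genideal_ideal[OF gens])
  have carr: "carrier (polyring n) = {p :: 'k mpoly. Poly_Mapping.keys p \<subseteq> monomials n}"
    and ops: "\<And>a b. a \<oplus>\<^bsub>polyring n\<^esub> b = a + (b :: 'k mpoly)" "\<And>a b. a \<otimes>\<^bsub>polyring n\<^esub> b = a * (b :: 'k mpoly)"
      "\<zero>\<^bsub>polyring n\<^esub> = (0 :: 'k mpoly)"
    by (simp_all add: polyring_def)
  have "monomial_ideal n U \<subseteq> J"
    unfolding monomial_ideal_def
  proof (rule R.genideal_minimal)
    show "mono_poly ` U \<subseteq> J" using assms by (auto simp: J_def mono_poly_def intro: mdvd_refl)
    have mult: "x * a \<in> J" if "a \<in> J" "Poly_Mapping.keys x \<subseteq> monomials n" for a x :: "'k mpoly"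
    proof -
      have "m \<in> monomials n \<and> (\<exists>u\<in>U. mdvd u m)" if "m \<in> Poly_Mapping.keys (x * a)" for m
      proof -
        from that keys_mult[of x a] obtain k l
          where kl: "m = k + l" "k \<in> Poly_Mapping.keys x" "l \<in> Poly_Mapping.keys a"
          by blast
        have "k \<in> monomials n" using \<open>Poly_Mapping.keys x \<subseteq> monomials n\<close> kl(2) by blast
        moreover have "l \<in> monomials n" "\<exists>u\<in>U. mdvd u l" using \<open>a \<in> J\<close> kl(3) by (auto simp: J_def)
        ultimately show ?thesis
          using mdvd_trans[OF _ mdvd_add(2)[of l k]] by (auto simp: kl(1))
      qed
      then show ?thesis by (auto simp: J_def)
    qed
    have neg: "- a \<in> J" if "a \<in> J" for a
      using mult[of a "- 1"] that by (simp add: J_def in_keys_iff)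
    show "ideal J (polyring n)"
    proof (rule idealI)
      show "ring (polyring n :: 'k mpoly ring)" by (rule R.ring_axioms)
      show "subgroup J (add_monoid (polyring n))"
      proof (rule R.add.subgroupI)
        show "J \<subseteq> carrier (polyring n)" by (auto simp: J_def carr)
        show "J \<noteq> {}" by (auto simp: J_def intro!: exI[of _ 0])
      next
        fix a b assume ab: "a \<in> J" "b \<in> J"
        then show "a \<oplus>\<^bsub>polyring n\<^esub> b \<in> J"
          using Poly_Mapping.keys_add[of a b] by (auto simp: J_def ops)
      next
        fix a assume a: "a \<in> J"
        have "\<ominus>\<^bsub>polyring n\<^esub> a = - a"
        proof (rule R.minus_equality)
          show "a \<in> carrier (polyring n)" "- a \<in> carrier (polyring n)"
            using a neg[OF a] by (simp_all add: J_def carr)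
        qed (simp add: ops)
        then show "\<ominus>\<^bsub>polyring n\<^esub> a \<in> J" using neg[OF a] by simp
      qed
    next
      fix a x assume "a \<in> J" "x \<in> carrier (polyring n :: 'k mpoly ring)"
      then have "x * a \<in> J" using mult by (simp add: carr)
      then show "x \<otimes>\<^bsub>polyring n\<^esub> a \<in> J" "a \<otimes>\<^bsub>polyring n\<^esub> x \<in> J"
        by (simp_all add: ops mult.commute)
    qed
  qed
  moreover have "p \<in> monomial_ideal n U" if "p \<in> J"
  proof -
    have trm: "Poly_Mapping.single m c \<in> monomial_ideal n U"
      if "m \<in> monomials n" "u \<in> U" "mdvd u m" for m u and c :: 'k
    proof -
      have "Poly_Mapping.single m c = Poly_Mapping.single (m - u) c * mono_poly u"
        using that(3) by (simp add: mono_poly_def mult_single mdvd_minus_add)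
      moreover have "m - u \<in> monomials n"
        using that(1,3) by (metis mdvd_minus_add monomials_add)
      then have "Poly_Mapping.single (m - u) c \<in> carrier (polyring n)"
        by (auto simp: carr)
      moreover have "(mono_poly u :: 'k mpoly) \<in> monomial_ideal n U"
        using R.genideal_self[OF gens] that(2) by (auto simp: monomial_ideal_def)
      ultimately show ?thesis using I.I_l_closed by (simp add: ops)
    qed
    have "(\<Sum>m\<in>K. Poly_Mapping.single m (lk p m)) \<in> monomial_ideal n U"
      if "finite K" "K \<subseteq> Poly_Mapping.keys p" for K
      using that
    proof (induction K rule: finite_induct)
      case empty
      show ?case using I.zero_closed by (simp add: ops)
    next
      case (insert m K)
      then have "m \<in> monomials n" "\<exists>u\<in>U. mdvd u m" using \<open>p \<in> J\<close> by (auto simp: J_def)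
      then have "Poly_Mapping.single m (lk p m) \<in> monomial_ideal n U" using trm by blast
      then show ?case using insert I.a_closed by (simp add: ops)
    qed
    from this[of "Poly_Mapping.keys p"] show ?thesis
      using poly_sum_terms[of p] by simp
  qed
  ultimately show ?thesis by (auto simp: J_def)
qed

lemma mono_poly_mem:
  assumes "U \<subseteq> monomials n"
  shows "(mono_poly m :: 'k::field mpoly) \<in> monomial_ideal n U \<longleftrightarrow> m \<in> monomials n \<and> (\<exists>u\<in>U. mdvd u m)"
  using monomial_ideal_mem[OF assms, of "mono_poly m :: 'k mpoly"] by (simp add: mono_poly_def)

section \<open>Boundaries and coboundaries on finite sets\<close>

text \<open>The sign of \<open>s\<close> in front of the increasing list of \<open>F\<close>: one factor \<open>-1\<close> for each element that \<open>s\<close> has to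
  pass.\<close>

definition ksign :: "nat \<Rightarrow> nat set \<Rightarrow> 'k::comm_ring_1" where
  "ksign s F = (- 1) ^ card {f\<in>F. f < s}"

text \<open>The boundary of simplices, written for coefficient functions: the simplex \<open>insert s F\<close> contributes to its
  face \<open>F\<close>. The set \<open>N\<close> contains all vertices.\<close>

definition bdry :: "nat set \<Rightarrow> (nat set \<Rightarrow> 'k::comm_ring_1) \<Rightarrow> nat set \<Rightarrow> 'k" where
  "bdry N c F = (\<Sum>s\<in>N - F. ksign s F * c (insert s F))"

text \<open>The transpose of the boundary.\<close>

definition cobdry :: "(nat set \<Rightarrow> 'k::comm_ring_1) \<Rightarrow> nat set \<Rightarrow> 'k" where
  "cobdry \<phi> G = (\<Sum>s\<in>G. ksign s (G - {s}) * \<phi> (G - {s}))"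

text \<open>The terms for \<open>(s, r)\<close> and \<open>(r, s)\<close> are collected in pairs; there is no division by two, so the argument
  works in every characteristic.\<close>

lemma sum_antisym_zero:
  fixes g :: "'a \<Rightarrow> 'a \<Rightarrow> 'k::comm_ring_1"
  assumes "finite A" "\<And>s r. s \<in> A \<Longrightarrow> r \<in> A \<Longrightarrow> s \<noteq> r \<Longrightarrow> g s r + g r s = 0"
  shows "(\<Sum>s\<in>A. \<Sum>r\<in>A - {s}. g s r) = 0"
  using assms
proof (induction A rule: finite_induct)
  case (insert x A)
  have "(\<Sum>s\<in>insert x A. \<Sum>r\<in>insert x A - {s}. g s r)
      = (\<Sum>r\<in>A. g x r) + (\<Sum>s\<in>A. \<Sum>r\<in>insert x A - {s}. g s r)"
    using insert.hyps by simp
  also have "(\<Sum>s\<in>A. \<Sum>r\<in>insert x A - {s}. g s r) = (\<Sum>s\<in>A. g s x + (\<Sum>r\<in>A - {s}. g s r))"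
  proof (rule sum.cong[OF refl])
    fix s assume s: "s \<in> A"
    then have "insert x A - {s} = insert x (A - {s})" using insert.hyps(2) by blast
    then show "(\<Sum>r\<in>insert x A - {s}. g s r) = g s x + (\<Sum>r\<in>A - {s}. g s r)"
      using insert.hyps by simp
  qed
  also have "(\<Sum>r\<in>A. g x r) + \<dots> = (\<Sum>r\<in>A. g x r + g r x) + (\<Sum>s\<in>A. \<Sum>r\<in>A - {s}. g s r)"
    by (simp add: sum.distrib algebra_simps)
  also have "(\<Sum>s\<in>A. \<Sum>r\<in>A - {s}. g s r) = 0" using insert by simp
  also have "(\<Sum>r\<in>A. g x r + g r x) = 0"
    using insert by (intro sum.neutral) auto
  finally show ?case by simp
qed simp

lemma ksign_insert:
  assumes "finite F" "s \<notin> F"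
  shows "ksign r (insert s F) = (if s < r then - ksign r F else ksign r F :: 'k::comm_ring_1)"
proof (cases "s < r")
  case True
  then have "{f \<in> insert s F. f < r} = insert s {f\<in>F. f < r}" by auto
  then show ?thesis using True assms by (simp add: ksign_def)
next
  case False
  then have "{f \<in> insert s F. f < r} = {f\<in>F. f < r}" by auto
  then show ?thesis using False by (simp add: ksign_def)
qed

lemma ksign_square [simp]: "ksign s F * ksign s F = (1 :: 'k::comm_ring_1)"
  by (simp add: ksign_def power_mult_distrib[symmetric])

text \<open>Removing two vertices in either order yields the same face with opposite signs.\<close>

lemma bdry_bdry:
  assumes "finite N" "finite F"
  shows "bdry N (bdry N c) F = 0"
proof -
  have "bdry N (bdry N c) F
      = (\<Sum>s\<in>N - F. \<Sum>r\<in>(N - F) - {s}. ksign s F * (ksign r (insert s F) * c (insert r (insert s F))))"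
    unfolding bdry_def sum_distrib_left by (intro sum.cong) auto
  also have "\<dots> = 0"
  proof (rule sum_antisym_zero)
    fix s r assume "s \<in> N - F" "r \<in> N - F" "s \<noteq> r"
    then show "ksign s F * (ksign r (insert s F) * c (insert r (insert s F))) +
        ksign r F * (ksign s (insert r F) * c (insert s (insert r F))) = 0"
      using assms by (auto simp: ksign_insert insert_commute algebra_simps)
  qed (use assms in simp)
  finally show ?thesis .
qed

text \<open>Both sides run over the pairs \<open>F \<subset> insert s F\<close>, sorted by the smaller or by the larger set.\<close>

lemma bdry_adjoint:
  fixes \<phi> h :: "nat set \<Rightarrow> 'k::comm_ring_1"
  assumes "finite N"
  shows "(\<Sum>F\<in>Pow N. \<phi> F * bdry N h F) = (\<Sum>G\<in>Pow N. cobdry \<phi> G * h G)"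
proof -
  have "(\<Sum>F\<in>Pow N. \<phi> F * bdry N h F)
      = (\<Sum>(F, s)\<in>Sigma (Pow N) (\<lambda>F. N - F). ksign s F * \<phi> F * h (insert s F))"
    using assms unfolding bdry_def sum_distrib_left
    by (subst sum.Sigma) (auto simp: algebra_simps)
  also have "\<dots> = (\<Sum>(G, s)\<in>Sigma (Pow N) (\<lambda>G. G). ksign s (G - {s}) * \<phi> (G - {s}) * h G)"
    by (rule sum.reindex_bij_witness[where i = "\<lambda>(G, s). (G - {s}, s)" and j = "\<lambda>(F, s). (insert s F, s)"])
       (auto simp: insert_absorb)
  also have "\<dots> = (\<Sum>G\<in>Pow N. cobdry \<phi> G * h G)"
    using assms unfolding cobdry_def sum_distrib_right
    by (subst sum.Sigma) (auto intro: finite_subset)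
  finally show ?thesis .
qed

lemma bdry_indicator_support:
  assumes "bdry N (\<lambda>F. if F = T then 1 else (0::'k::comm_ring_1)) F \<noteq> 0"
  obtains s where "s \<in> T" "F = T - {s}"
proof -
  from assms have "\<exists>s\<in>N - F. ksign s F * (if insert s F = T then 1 else (0::'k)) \<noteq> 0"
    unfolding bdry_def by (meson sum.not_neutral_contains_not_neutral)
  then obtain s where "s \<notin> F" "insert s F = T" by (auto split: if_splits)
  then have "s \<in> T" "F = T - {s}" by auto
  then show thesis by (rule that)
qed

section \<open>The Koszul complex in a multidegree\<close>

text \<open>The squarefree monomial \<open>x\<^sub>F\<close>, which is also the multidegree of the basis element \<open>e\<^sub>F\<close> of the Koszul
  complex.\<close>

definition sqfree :: "nat set \<Rightarrow> mon" where
  "sqfree F = (\<Sum>i\<in>F. Poly_Mapping.single i 1)"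

lemma lookup_sqfree: "finite F \<Longrightarrow> lk (sqfree F) i = (if i \<in> F then 1 else 0)"
  by (simp add: sqfree_def lookup_sum lookup_single when_def)

lemma sqfree_empty [simp]: "sqfree {} = 0" by (simp add: sqfree_def)

lemma sqfree_insert: "finite F \<Longrightarrow> s \<notin> F \<Longrightarrow> sqfree (insert s F) = Poly_Mapping.single s 1 + sqfree F"
  by (simp add: sqfree_def)

lemma keys_sqfree [simp]: "finite F \<Longrightarrow> Poly_Mapping.keys (sqfree F) = F"
  by (auto simp: in_keys_iff lookup_sqfree split: if_splits)

lemma mdvd_sqfree: "finite F \<Longrightarrow> mdvd (sqfree F) M \<longleftrightarrow> F \<subseteq> Poly_Mapping.keys M"
  by (force simp: mdvd_def lookup_sqfree in_keys_iff)

lemma mon_deg_sqfree: "finite F \<Longrightarrow> mon_deg (sqfree F) = card F"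
  by (subst mon_deg_alt[of F]) (simp_all add: lookup_sqfree)

lemma sqfree_insert_minus: "finite F \<Longrightarrow> s \<notin> F \<Longrightarrow> sqfree (insert s F) - sqfree F = Poly_Mapping.single s 1"
  by (simp add: sqfree_insert)

lemma sqfree_mono: "finite G \<Longrightarrow> F \<subseteq> G \<Longrightarrow> mdvd (sqfree F) (sqfree G)"
  by (simp add: mdvd_sqfree finite_subset)

lemma sqfree_monomials: "F \<subseteq> {1..n} \<Longrightarrow> sqfree F \<in> monomials n"
  by (simp add: monomials_def finite_subset[of F "{1..n}"])

text \<open>The differential of the Koszul complex of the variables with indices in \<open>N\<close>: here \<open>f G\<close> is the coefficient
  of \<open>e\<^sub>G\<close>, and \<open>e\<^bsub>insert s F\<^esub>\<close> is mapped to a sum that contains \<open>\<plusminus>x\<^sub>s e\<^sub>F\<close>.\<close>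

definition koszul :: "nat set \<Rightarrow> (nat set \<Rightarrow> 'k::field mpoly) \<Rightarrow> nat set \<Rightarrow> 'k mpoly" where
  "koszul N f F = (\<Sum>s\<in>N - F. Poly_Mapping.single (Poly_Mapping.single s 1) (ksign s F) * f (insert s F))"

lemma mcomp_koszul:
  assumes "finite F"
  shows "mcomp (sqfree F) M (koszul N f F) = bdry N (\<lambda>G. mcomp (sqfree G) M (f G)) F"
proof -
  have "mcomp (sqfree F) M (Poly_Mapping.single (Poly_Mapping.single s 1) (ksign s F) * f (insert s F))
      = ksign s F * mcomp (sqfree (insert s F)) M (f (insert s F))" if "s \<in> N - F" for s
  proof -
    have "mdvd (sqfree F) (sqfree (insert s F))" using assms by (intro sqfree_mono) auto
    from mcomp_entry[OF this, of M "ksign s F" "f (insert s F)"] show ?thesis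
      using sqfree_insert_minus[OF assms] that by simp
  qed
  then show ?thesis unfolding koszul_def bdry_def mcomp_sum by (rule sum.cong[OF refl])
qed

text \<open>Adding the vertex \<open>i\<close> is a contracting homotopy on every family \<open>R\<close> of sets that is stable under adding and
  removing \<open>i\<close>. The assumption \<open>up\<close> says that the boundary of \<open>c\<close> at members of \<open>R\<close> only involves members of
  \<open>R\<close>. So only the relative complex on \<open>R\<close> matters, and the conclusion is about the values on \<open>R\<close>.\<close>

lemma bdry_toggle:
  fixes c :: "nat set \<Rightarrow> 'k::comm_ring_1"
  assumes N: "finite N" "i \<in> N"
    and supp: "\<And>F. c F \<noteq> 0 \<Longrightarrow> F \<subseteq> N \<and> card F = p"
    and closed: "\<And>F. F \<subseteq> N \<Longrightarrow> bdry N c F = 0"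
    and toggle: "\<And>F. F \<in> R \<Longrightarrow> F \<subseteq> N \<Longrightarrow> insert i F \<in> R \<and> F - {i} \<in> R"
    and up: "\<And>F s. F \<in> R \<Longrightarrow> F \<subseteq> N \<Longrightarrow> s \<in> N - F \<Longrightarrow> c (insert s F) \<noteq> 0 \<Longrightarrow> insert s F \<in> R"
  shows "\<exists>e. (\<forall>F. e F \<noteq> 0 \<longrightarrow> F \<in> R \<and> F \<subseteq> N \<and> card F = Suc p) \<and>
             (\<forall>F. F \<in> R \<longrightarrow> F \<subseteq> N \<longrightarrow> bdry N e F = c F)"
proof -
  define e where "e F = (if i \<in> F \<and> F \<in> R then ksign i (F - {i}) * c (F - {i}) else 0)" for F
  have 1: "F \<in> R \<and> F \<subseteq> N \<and> card F = Suc p" if "e F \<noteq> 0" for F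
  proof -
    have F: "i \<in> F" "F \<in> R" "c (F - {i}) \<noteq> 0" using that by (auto simp: e_def split: if_splits)
    then have "F - {i} \<subseteq> N" "card (F - {i}) = p" using supp by auto
    moreover have "finite F" using \<open>F - {i} \<subseteq> N\<close> N(1) by (metis finite_Diff2 finite_subset finite.emptyI finite_insert)
    ultimately show ?thesis using F N(2) by (metis Diff_subset_conv card_Suc_Diff1 insert_absorb insert_is_Un)
  qed
  have 2: "bdry N e F = c F" if FR: "F \<in> R" "F \<subseteq> N" for F
  proof (cases "i \<in> F")
    case False
    have "bdry N e F = (\<Sum>s\<in>N - F. if s = i then c F else 0)"
      unfolding bdry_def
    proof (rule sum.cong[OF refl])
      fix s assume s: "s \<in> N - F"
      show "ksign s F * e (insert s F) = (if s = i then c F else 0)"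
      proof (cases "s = i")
        case True
        have "e (insert i F) = ksign i F * c F" using toggle[OF FR] False by (simp add: e_def)
        then show ?thesis using True by (simp add: mult.assoc[symmetric])
      next
        case False
        then show ?thesis using \<open>i \<notin> F\<close> by (simp add: e_def)
      qed
    qed
    then show ?thesis using False N by simp
  next
    case True
    define G where "G = F - {i}"
    have G: "F = insert i G" "i \<notin> G" "G \<in> R" "G \<subseteq> N" "finite G"
      using True toggle[OF FR] FR(2) N(1) by (auto simp: G_def finite_subset)
    have NG: "N - G = insert i (N - F)" using G N(2) by auto
    have "0 = bdry N c G" using closed[OF G(4)] by simp
    also have "\<dots> = ksign i G * c F + (\<Sum>s\<in>N - F. ksign s G * c (insert s G))"
      unfolding bdry_def NG using N(1) True by (simp add: G(1))
    finally have eq: "(\<Sum>s\<in>N - F. ksign s G * c (insert s G)) = - (ksign i G * c F)"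
      by (simp add: eq_neg_iff_add_eq_0 add.commute)
    have "bdry N e F = (\<Sum>s\<in>N - F. - ksign i G * (ksign s G * c (insert s G)))"
      unfolding bdry_def
    proof (rule sum.cong[OF refl])
      fix s assume s: "s \<in> N - F"
      have si: "s \<noteq> i" "s \<notin> G" "s \<in> N - G" using s G(1) by auto
      have rem: "insert s F - {i} = insert s G" using si G(1,2) by auto
      have sg: "ksign s F * ksign i (insert s G) = - (ksign i G * ksign s G :: 'k)"
        using si G by (auto simp: ksign_insert mult.commute)
      show "ksign s F * e (insert s F) = - ksign i G * (ksign s G * c (insert s G))"
      proof (cases "c (insert s G) = 0")
        case True
        then show ?thesis by (simp add: e_def rem)
      next
        case False
        then have "insert s G \<in> R" using up[OF G(3,4) si(3)] by simp
        moreover have "insert s G \<subseteq> N" using si(3) G(4) by auto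
        ultimately have "insert i (insert s G) \<in> R" using toggle by blast
        then have "insert s F \<in> R" by (simp add: G(1) insert_commute)
        then have "e (insert s F) = ksign i (insert s G) * c (insert s G)"
          using True by (simp add: e_def rem)
        then show ?thesis using sg by (simp add: mult.assoc[symmetric])
      qed
    qed
    also have "\<dots> = - ksign i G * (\<Sum>s\<in>N - F. ksign s G * c (insert s G))"
      by (simp only: sum_distrib_left)
    also have "\<dots> = c F" unfolding eq by (simp add: mult.assoc[symmetric])
    finally show ?thesis .
  qed
  show ?thesis using 1 2 by blast
qed

text \<open>The part in multidegree \<open>M\<close> of the Koszul complex with coefficients in an ideal whose set of monomials is
  \<open>P\<close>: the element \<open>e\<^sub>F\<close> occurs there with the coefficient monomial \<open>M/x\<^sub>F\<close>.\<close>

definition mchain :: "nat \<Rightarrow> mon set \<Rightarrow> mon \<Rightarrow> nat \<Rightarrow> (nat set \<Rightarrow> 'k::comm_ring_1) \<Rightarrow> bool" where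
  "mchain n P M p c \<longleftrightarrow>
     (\<forall>F. c F \<noteq> 0 \<longrightarrow> F \<subseteq> {1..n} \<and> card F = p \<and> mdvd (sqfree F) M \<and> M - sqfree F \<in> P)"

definition mexact :: "nat \<Rightarrow> mon set \<Rightarrow> mon \<Rightarrow> nat \<Rightarrow> 'k::comm_ring_1 itself \<Rightarrow> bool" where
  "mexact n P M p _ \<longleftrightarrow>
     (\<forall>c :: nat set \<Rightarrow> 'k. mchain n P M p c \<longrightarrow> (\<forall>F. F \<subseteq> {1..n} \<longrightarrow> bdry {1..n} c F = 0) \<longrightarrow>
        (\<exists>e. mchain n P M (Suc p) e \<and> (\<forall>F. F \<subseteq> {1..n} \<longrightarrow> bdry {1..n} e F = c F)))"

definition pchain :: "nat \<Rightarrow> mon set \<Rightarrow> nat \<Rightarrow> (nat set \<Rightarrow> 'k::field mpoly) \<Rightarrow> bool" where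
  "pchain n P p f \<longleftrightarrow>
     (\<forall>F. f F \<noteq> 0 \<longrightarrow> F \<subseteq> {1..n} \<and> card F = p \<and> Poly_Mapping.keys (f F) \<subseteq> P)"

lemma pchain_mchain:
  assumes "pchain n P p f"
  shows "mchain n P M p (\<lambda>F. mcomp (sqfree F) M (f F))"
  unfolding mchain_def
proof (intro allI impI)
  fix F assume nz: "mcomp (sqfree F) M (f F) \<noteq> 0"
  then have "f F \<noteq> 0" by auto
  moreover have "mdvd (sqfree F) M" "M - sqfree F \<in> Poly_Mapping.keys (f F)"
    using nz by (auto simp: mcomp_def in_keys_iff split: if_splits)
  ultimately show "F \<subseteq> {1..n} \<and> card F = p \<and> mdvd (sqfree F) M \<and> M - sqfree F \<in> P"
    using assms by (auto simp: pchain_def)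
qed

text \<open>The multidegrees that occur in \<open>f\<close> are finite in number and can be treated one at a time. The last
  conclusion says that the preimage needs no new multidegrees; homogeneity of the preimage will follow from
  it.\<close>

lemma koszul_lift:
  fixes f :: "nat set \<Rightarrow> 'k::field mpoly"
  assumes f: "pchain n P p f"
    and closed: "\<And>F. F \<subseteq> {1..n} \<Longrightarrow> koszul {1..n} f F = 0"
    and exact: "\<And>M F. mcomp (sqfree F) M (f F) \<noteq> 0 \<Longrightarrow> mexact n P M p TYPE('k)"
  obtains g where "pchain n P (Suc p) g" "\<And>F. F \<subseteq> {1..n} \<Longrightarrow> koszul {1..n} g F = f F"
    "\<And>F m. m \<in> Poly_Mapping.keys (g F) \<Longrightarrow>
       \<exists>F' m'. m' \<in> Poly_Mapping.keys (f F') \<and> m + sqfree F = m' + sqfree F'"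
proof -
  define c where "c M F = mcomp (sqfree F) M (f F)" for M F
  define Ms where "Ms = {M. \<exists>F. c M F \<noteq> 0}"
  have Ms_sub: "Ms \<subseteq> (\<Union>F\<in>Pow {1..n}. {M. mcomp (sqfree F) M (f F) \<noteq> 0})"
  proof
    fix M assume "M \<in> Ms"
    then obtain F where F: "c M F \<noteq> 0" by (auto simp: Ms_def)
    then have "f F \<noteq> 0" by (auto simp: c_def)
    then have "F \<in> Pow {1..n}" using f by (simp add: pchain_def)
    then show "M \<in> (\<Union>F\<in>Pow {1..n}. {M. mcomp (sqfree F) M (f F) \<noteq> 0})" using F by (auto simp: c_def)
  qed
  have finMs: "finite Ms" by (rule finite_subset[OF Ms_sub]) (simp add: finite_mcomp_support)
  have "\<exists>e. mchain n P M (Suc p) e \<and> (\<forall>F. F \<subseteq> {1..n} \<longrightarrow> bdry {1..n} e F = c M F) \<and> (M \<notin> Ms \<longrightarrow> (\<forall>F. e F = 0))" for M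
  proof (cases "M \<in> Ms")
    case True
    then have ex: "mexact n P M p TYPE('k)" using exact by (auto simp: Ms_def c_def)
    have "mchain n P M p (c M)" unfolding c_def by (rule pchain_mchain[OF f])
    moreover have "bdry {1..n} (c M) F = 0" if "F \<subseteq> {1..n}" for F
    proof -
      have "finite F" using that by (rule finite_subset) simp
      moreover have "c M = (\<lambda>G. mcomp (sqfree G) M (f G))" by (rule ext) (simp add: c_def)
      ultimately have "bdry {1..n} (c M) F = mcomp (sqfree F) M (koszul {1..n} f F)" by (simp add: mcomp_koszul)
      then show ?thesis using closed[OF that] by simp
    qed
    ultimately show ?thesis using ex True unfolding mexact_def by blast
  next
    case False
    then have "c M F = 0" for F by (auto simp: Ms_def)
    then show ?thesis by (intro exI[of _ "\<lambda>_. 0"]) (simp add: mchain_def bdry_def)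
  qed
  then obtain e where e: "\<And>M. mchain n P M (Suc p) (e M)"
    "\<And>M F. F \<subseteq> {1..n} \<Longrightarrow> bdry {1..n} (e M) F = c M F" "\<And>M F. M \<notin> Ms \<Longrightarrow> e M F = 0"
    by metis
  have "\<exists>g. \<forall>M. mcomp (sqfree F) M g = e M F" for F
  proof -
    have "{M. e M F \<noteq> 0} \<subseteq> Ms" using e(3) by blast
    then have fin: "finite {M. e M F \<noteq> 0}" using finMs by (rule finite_subset)
    have le: "mdvd (sqfree F) M" if "e M F \<noteq> 0" for M using e(1)[of M] that by (auto simp: mchain_def)
    obtain g where "\<And>M. mcomp (sqfree F) M g = e M F" using poly_of_components[OF fin le] by blast
    then show ?thesis by blast
  qed
  then obtain g where g: "\<And>F M. mcomp (sqfree F) M (g F) = e M F" by metis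
  have gkeys: "e (m + sqfree F) F \<noteq> 0" if "m \<in> Poly_Mapping.keys (g F)" for m F
    using that mcomp_shift[of "sqfree F" m "g F"] by (simp add: g in_keys_iff)
  show thesis
  proof (rule that)
    show "pchain n P (Suc p) g"
      unfolding pchain_def
    proof (intro allI impI conjI subsetI)
      fix F assume "g F \<noteq> 0"
      then obtain m where m: "m \<in> Poly_Mapping.keys (g F)" by (metis keys_eq_empty ex_in_conv)
      from gkeys[OF m] e(1) show "\<And>x. x \<in> F \<Longrightarrow> x \<in> {1..n}" "card F = Suc p"
        unfolding mchain_def by blast+
    next
      fix F m assume "m \<in> Poly_Mapping.keys (g F)"
      from gkeys[OF this] e(1)[of "m + sqfree F"] show "m \<in> P" unfolding mchain_def by fastforce
    qed
    show "koszul {1..n} g F = f F" if "F \<subseteq> {1..n}" for F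
    proof (rule mcomp_eqI)
      fix M
      have "finite F" using that by (rule finite_subset) simp
      then show "mcomp (sqfree F) M (koszul {1..n} g F) = mcomp (sqfree F) M (f F)"
        using e(2)[OF that, of M] by (simp add: mcomp_koszul g c_def)
    qed
    show "\<exists>F' m'. m' \<in> Poly_Mapping.keys (f F') \<and> m + sqfree F = m' + sqfree F'"
      if "m \<in> Poly_Mapping.keys (g F)" for F m
    proof -
      have "m + sqfree F \<in> Ms" using gkeys[OF that] e(3) by blast
      then obtain F' where "mcomp (sqfree F') (m + sqfree F) (f F') \<noteq> 0" by (auto simp: Ms_def c_def)
      then have "mdvd (sqfree F') (m + sqfree F)" "m + sqfree F - sqfree F' \<in> Poly_Mapping.keys (f F')"
        by (auto simp: mcomp_def in_keys_iff split: if_splits)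
      then show ?thesis by (metis mdvd_minus_add)
    qed
  qed
qed

lemma mchain_ext_zero:
  assumes "mchain n P M p c" "\<not> mdvd (sqfree F) M" "F \<subseteq> {1..n}"
  shows "bdry {1..n} c F = 0"
  unfolding bdry_def
proof (intro sum.neutral ballI)
  fix s assume "s \<in> {1..n} - F"
  have fin: "finite F" using assms(3) by (rule finite_subset) simp
  have "\<not> mdvd (sqfree (insert s F)) M" using assms(2) fin by (simp add: mdvd_sqfree)
  then have "c (insert s F) = 0" using assms(1) unfolding mchain_def by blast
  then show "ksign s F * c (insert s F) = 0" by simp
qed

text \<open>If the variable \<open>i\<close> divides \<open>M\<close>, then \<open>i\<close> can be added to and removed from every \<open>F\<close> with \<open>x\<^sub>F\<close> dividing
  \<open>M\<close>, and the complex is a cone. So the Koszul complex of \<open>S\<close> is exact outside multidegree \<open>0\<close>.\<close>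

lemma mexact_all_monomials:
  assumes "M \<in> monomials n" "M \<noteq> 0"
  shows "mexact n (monomials n) M p TYPE('k::comm_ring_1)"
  unfolding mexact_def
proof (intro allI impI)
  fix c :: "nat set \<Rightarrow> 'k"
  assume c: "mchain n (monomials n) M p c" and closed: "\<forall>F. F \<subseteq> {1..n} \<longrightarrow> bdry {1..n} c F = 0"
  obtain i where i: "i \<in> Poly_Mapping.keys M" using assms(2) by (metis ex_in_conv keys_eq_empty)
  have iN: "i \<in> {1..n}" using i assms(1) by (auto simp: monomials_def)
  define R where "R = {F. F \<subseteq> Poly_Mapping.keys M}"
  have "\<exists>e. (\<forall>F. e F \<noteq> 0 \<longrightarrow> F \<in> R \<and> F \<subseteq> {1..n} \<and> card F = Suc p) \<and>
             (\<forall>F. F \<in> R \<longrightarrow> F \<subseteq> {1..n} \<longrightarrow> bdry {1..n} e F = c F)"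
  proof (rule bdry_toggle[OF _ iN])
    show "F \<subseteq> {1..n} \<and> card F = p" if "c F \<noteq> 0" for F using c that by (auto simp: mchain_def)
    show "insert i F \<in> R \<and> F - {i} \<in> R" if "F \<in> R" for F using that i by (auto simp: R_def)
    show "insert s F \<in> R" if "c (insert s F) \<noteq> 0" for F s
    proof -
      have "insert s F \<subseteq> {1..n}" "mdvd (sqfree (insert s F)) M" using c that unfolding mchain_def by blast+
      then show ?thesis using finite_subset[of "insert s F" "{1..n}"] by (simp add: R_def mdvd_sqfree)
    qed
  qed (use closed in simp_all)
  then obtain e where e: "\<And>F. e F \<noteq> 0 \<Longrightarrow> F \<in> R \<and> F \<subseteq> {1..n} \<and> card F = Suc p"
    "\<And>F. F \<in> R \<Longrightarrow> F \<subseteq> {1..n} \<Longrightarrow> bdry {1..n} e F = c F" by blast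
  have "mchain n (monomials n) M (Suc p) e"
    unfolding mchain_def
  proof (intro allI impI)
    fix F assume "e F \<noteq> 0"
    from e(1)[OF this] have F: "F \<in> R" "F \<subseteq> {1..n}" "card F = Suc p" by simp_all
    then have "mdvd (sqfree F) M" using finite_subset[of F "{1..n}"] by (simp add: R_def mdvd_sqfree)
    moreover have "M - sqfree F \<in> monomials n" using assms(1) calculation by (metis mdvd_minus_add monomials_add)
    ultimately show "F \<subseteq> {1..n} \<and> card F = Suc p \<and> mdvd (sqfree F) M \<and> M - sqfree F \<in> monomials n" using F by simp
  qed
  moreover have "bdry {1..n} e F = c F" if F: "F \<subseteq> {1..n}" for F
  proof (cases "F \<in> R")
    case True
    then show ?thesis using e(2) F by simp
  next
    case False
    then have "\<not> mdvd (sqfree F) M" using finite_subset[OF F] by (simp add: R_def mdvd_sqfree)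
    then show ?thesis using mchain_ext_zero[OF calculation _ F] c unfolding mchain_def by metis
  qed
  ultimately show "\<exists>e. mchain n (monomials n) M (Suc p) e \<and> (\<forall>F. F \<subseteq> {1..n} \<longrightarrow> bdry {1..n} e F = c F)"
    by blast
qed

text \<open>The step from the ideal with monomials \<open>Q\<close> to the one with the additional generator \<open>g\<close>, whose colon ideal
  is generated by the variables in \<open>V\<close>. The sets \<open>F\<close> in the larger complex but not in the smaller one are
  those for which \<open>M/x\<^sub>F\<close> is \<open>q g\<close> with \<open>q\<close> prime to the variables in \<open>V\<close>. A variable \<open>i \<notin> V\<close> that divides
  \<open>M/g\<close> can be moved between \<open>x\<^sub>F\<close> and \<open>q\<close>, so these sets form a cone. If there is no such variable, then
  \<open>q = 1\<close>, and \<open>M\<close> is \<open>g\<close> times \<open>p\<close> distinct variables, which the assumption on the degree excludes.\<close>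

lemma mexact_insert:
  assumes Q: "\<And>a b. a \<in> Q \<Longrightarrow> mdvd a b \<Longrightarrow> b \<in> monomials n \<Longrightarrow> b \<in> Q" "Q \<subseteq> monomials n"
    and g: "g \<in> monomials n"
    and V: "\<And>q. q \<in> monomials n \<Longrightarrow> q + g \<in> Q \<longleftrightarrow> (\<exists>x\<in>V. x \<in> Poly_Mapping.keys q)"
    and IH: "mexact n Q M p TYPE('k::comm_ring_1)"
    and M: "M \<in> monomials n" "mon_deg M \<noteq> mon_deg g + p"
  shows "mexact n (Q \<union> {m \<in> monomials n. mdvd g m}) M p TYPE('k)"
  unfolding mexact_def
proof (intro allI impI)
  define P where "P = Q \<union> {m \<in> monomials n. mdvd g m}"
  fix c :: "nat set \<Rightarrow> 'k"
  assume c: "mchain n (Q \<union> {m \<in> monomials n. mdvd g m}) M p c"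
    and closed: "\<forall>F. F \<subseteq> {1..n} \<longrightarrow> bdry {1..n} c F = 0"
  have cP: "mchain n P M p c" using c by (simp add: P_def)
  have P_up: "b \<in> P" if "a \<in> P" "mdvd a b" "b \<in> monomials n" for a b
    using that Q(1) mdvd_trans by (auto simp: P_def)
  have fin: "finite F" if "F \<subseteq> {1..n}" for F :: "nat set" using that by (rule finite_subset) simp
  have Mminus: "M - sqfree F \<in> monomials n" if "mdvd (sqfree F) M" for F
    using M(1) that by (metis mdvd_minus_add monomials_add)
  \<comment> \<open>the basis of the relative complex\<close>
  define R where "R = {F. F \<subseteq> {1..n} \<and> mdvd (sqfree F) M \<and> M - sqfree F \<in> P \<and> M - sqfree F \<notin> Q}"
  have R_iff: "F \<in> R \<longleftrightarrow> (\<exists>q. M = sqfree F + (q + g) \<and> q \<in> monomials n \<and> V \<inter> Poly_Mapping.keys q = {})"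
    if F: "F \<subseteq> {1..n}" for F
  proof
    assume "F \<in> R"
    then have r: "mdvd (sqfree F) M" "mdvd g (M - sqfree F)" "M - sqfree F \<notin> Q" by (auto simp: R_def P_def)
    define q where "q = M - sqfree F - g"
    have eq: "q + g = M - sqfree F" using r(2) by (simp add: q_def mdvd_minus_add)
    have "q \<in> monomials n" using Mminus[OF r(1)] eq by (metis monomials_add)
    moreover have "M = sqfree F + (q + g)" using r(1) eq by (simp add: mdvd_add_minus)
    moreover have "V \<inter> Poly_Mapping.keys q = {}" using V[OF \<open>q \<in> _\<close>] r(3) eq by auto
    ultimately show "\<exists>q. M = sqfree F + (q + g) \<and> q \<in> monomials n \<and> V \<inter> Poly_Mapping.keys q = {}" by blast
  next
    assume "\<exists>q. M = sqfree F + (q + g) \<and> q \<in> monomials n \<and> V \<inter> Poly_Mapping.keys q = {}"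
    then obtain q where q: "M = sqfree F + (q + g)" "q \<in> monomials n" "V \<inter> Poly_Mapping.keys q = {}" by blast
    then have "M - sqfree F = q + g" by simp
    then show "F \<in> R" using q V[OF q(2)] F g by (auto simp: R_def P_def)
  qed
  have split: "mchain n Q M p' x" if "mchain n P M p' x" "\<And>F. F \<in> R \<Longrightarrow> x F = 0" for x :: "nat set \<Rightarrow> 'k" and p'
    using that unfolding mchain_def R_def by blast
  show "\<exists>e. mchain n (Q \<union> {m \<in> monomials n. mdvd g m}) M (Suc p) e \<and> (\<forall>F. F \<subseteq> {1..n} \<longrightarrow> bdry {1..n} e F = c F)"
    unfolding P_def[symmetric]
  proof (cases "mdvd g M \<and> (\<exists>i\<in>Poly_Mapping.keys (M - g). i \<notin> V)")
    case True
    then obtain i where i: "i \<in> Poly_Mapping.keys (M - g)" "i \<notin> V" and gM: "mdvd g M" by blast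
    have "Poly_Mapping.keys (M - g) \<subseteq> Poly_Mapping.keys M"
      using gM keys_mdvd by (metis mdvd_add(1) mdvd_minus_add)
    then have iN: "i \<in> {1..n}" using i(1) M(1) by (auto simp: monomials_def)
    have toggle: "insert i F \<in> R \<and> F - {i} \<in> R" if FR: "F \<in> R" and F: "F \<subseteq> {1..n}" for F
    proof (cases "i \<in> F")
      case True
      obtain q where q: "M = sqfree F + (q + g)" "q \<in> monomials n" "V \<inter> Poly_Mapping.keys q = {}"
        using FR R_iff[OF F] by blast
      have "sqfree F = Poly_Mapping.single i 1 + sqfree (F - {i})"
        using sqfree_insert[of "F - {i}" i] fin[OF F] True by (simp add: insert_absorb)
      then have "M = sqfree (F - {i}) + ((q + Poly_Mapping.single i 1) + g)" using q(1) by (simp add: ac_simps)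
      moreover have "q + Poly_Mapping.single i 1 \<in> monomials n" using q(2) iN by (simp add: monomials_def[of n, symmetric]) (simp add: monomials_def)
      moreover have "V \<inter> Poly_Mapping.keys (q + Poly_Mapping.single i 1) = {}"
        using q(3) i(2) Poly_Mapping.keys_add[of q "Poly_Mapping.single i 1"] by auto
      ultimately have "F - {i} \<in> R" using R_iff[of "F - {i}"] F by blast
      then show ?thesis using True FR by (simp add: insert_absorb)
    next
      case False
      obtain q where q: "M = sqfree F + (q + g)" "q \<in> monomials n" "V \<inter> Poly_Mapping.keys q = {}"
        using FR R_iff[OF F] by blast
      have "M - g = sqfree F + q" using q(1) by (simp add: add.assoc[symmetric])
      then have "lk q i \<noteq> 0" using i(1) False fin[OF F] by (simp add: in_keys_iff lookup_add lookup_sqfree)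
      then have qi: "mdvd (Poly_Mapping.single i 1) q" by (auto simp: mdvd_def lookup_single when_def)
      define q' where "q' = q - Poly_Mapping.single i 1"
      have q': "q = q' + Poly_Mapping.single i 1" using qi by (simp add: q'_def mdvd_minus_add)
      have "M = sqfree (insert i F) + (q' + g)"
        using q(1) sqfree_insert[OF fin[OF F] False] by (simp add: q' ac_simps)
      moreover have "q' \<in> monomials n" using q(2) by (simp add: q')
      moreover have "Poly_Mapping.keys q' \<subseteq> Poly_Mapping.keys q" using keys_mdvd[of q' q] by (simp add: q')
      then have "V \<inter> Poly_Mapping.keys q' = {}" using q(3) by blast
      ultimately have "insert i F \<in> R" using R_iff[of "insert i F"] F iN by blast
      then show ?thesis using False FR by simp
    qed
    have "\<exists>e. (\<forall>F. e F \<noteq> 0 \<longrightarrow> F \<in> R \<and> F \<subseteq> {1..n} \<and> card F = Suc p) \<and>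
             (\<forall>F. F \<in> R \<longrightarrow> F \<subseteq> {1..n} \<longrightarrow> bdry {1..n} e F = c F)"
    proof (rule bdry_toggle[OF _ iN _ _ toggle])
      show "F \<subseteq> {1..n} \<and> card F = p" if "c F \<noteq> 0" for F using cP that by (auto simp: mchain_def)
      show "insert s F \<in> R" if F: "F \<in> R" "F \<subseteq> {1..n}" "s \<in> {1..n} - F" "c (insert s F) \<noteq> 0" for F s
      proof -
        have s: "insert s F \<subseteq> {1..n}" "mdvd (sqfree (insert s F)) M" "M - sqfree (insert s F) \<in> P"
          using cP F(4) unfolding mchain_def by blast+
        have "M - sqfree (insert s F) \<notin> Q"
        proof
          assume "M - sqfree (insert s F) \<in> Q"
          moreover have "mdvd (M - sqfree (insert s F)) (M - sqfree F)"
            using fin[OF F(2)] by (simp add: mdvd_def lookup_minus lookup_sqfree)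
          moreover have "M - sqfree F \<in> monomials n" using F(1) Mminus by (simp add: R_def)
          ultimately have "M - sqfree F \<in> Q" by (rule Q(1))
          then show False using F(1) by (simp add: R_def)
        qed
        then show ?thesis using s by (simp add: R_def)
      qed
    qed (use closed in simp_all)
    then obtain e where e: "\<And>F. e F \<noteq> 0 \<Longrightarrow> F \<in> R \<and> F \<subseteq> {1..n} \<and> card F = Suc p"
      "\<And>F. F \<in> R \<Longrightarrow> F \<subseteq> {1..n} \<Longrightarrow> bdry {1..n} e F = c F" by blast
    have eP: "mchain n P M (Suc p) e" using e(1) by (auto simp: mchain_def R_def)
    \<comment> \<open>Subtracting the boundary of \<open>e\<close> removes the values on \<open>R\<close>, so that the assumption on \<open>Q\<close> applies to the
        rest.\<close>
    define c' where "c' F = (if F \<subseteq> {1..n} then c F - bdry {1..n} e F else 0)" for F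
    have "mchain n P M p (\<lambda>F. if F \<subseteq> {1..n} then bdry {1..n} e F else 0)"
      unfolding mchain_def
    proof (intro allI impI)
      fix F assume "(if F \<subseteq> {1..n} then bdry {1..n} e F else 0) \<noteq> 0"
      then have F: "F \<subseteq> {1..n}" "bdry {1..n} e F \<noteq> 0" by (auto split: if_splits)
      then obtain s where s: "s \<in> {1..n} - F" "e (insert s F) \<noteq> 0"
        unfolding bdry_def by (metis (no_types, lifting) mult_zero_right sum.not_neutral_contains_not_neutral)
      then have "card (insert s F) = Suc p" "mdvd (sqfree (insert s F)) M" "M - sqfree (insert s F) \<in> P"
        using eP unfolding mchain_def by blast+
      moreover have "mdvd (sqfree F) (sqfree (insert s F))" using fin[OF F(1)] by (intro sqfree_mono) auto
      then have "mdvd (sqfree F) M" using calculation(2) mdvd_trans by blast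
      moreover have "mdvd (M - sqfree (insert s F)) (M - sqfree F)"
        using fin[OF F(1)] by (simp add: mdvd_def lookup_minus lookup_sqfree)
      ultimately show "F \<subseteq> {1..n} \<and> card F = p \<and> mdvd (sqfree F) M \<and> M - sqfree F \<in> P"
        using P_up Mminus F(1) s(1) fin[OF F(1)] by simp
    qed
    then have "mchain n P M p c'" using cP unfolding mchain_def c'_def by (metis diff_0_right diff_zero diff_self)
    then have c'Q: "mchain n Q M p c'"
      by (rule split) (use e(2) in \<open>auto simp: c'_def R_def\<close>)
    have "bdry {1..n} c' F = 0" if F: "F \<subseteq> {1..n}" for F
    proof -
      have "bdry {1..n} c' F = bdry {1..n} c F - bdry {1..n} (bdry {1..n} e) F"
        unfolding bdry_def[of _ c'] bdry_def[of _ c] bdry_def[of _ "bdry {1..n} e"] sum_subtractf[symmetric]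
        by (rule sum.cong) (use F in \<open>auto simp: c'_def algebra_simps\<close>)
      then show ?thesis using closed F bdry_bdry[of "{1..n}" F e] fin[OF F] by simp
    qed
    then obtain e2 where e2: "mchain n Q M (Suc p) e2" "\<And>F. F \<subseteq> {1..n} \<Longrightarrow> bdry {1..n} e2 F = c' F"
      using IH c'Q unfolding mexact_def by blast
    have "mchain n P M (Suc p) (\<lambda>F. e F + e2 F)"
      using eP e2(1) unfolding mchain_def P_def by (metis UnCI add_0)
    moreover have "bdry {1..n} (\<lambda>F. e F + e2 F) F = c F" if "F \<subseteq> {1..n}" for F
    proof -
      have "bdry {1..n} (\<lambda>F. e F + e2 F) F = bdry {1..n} e F + bdry {1..n} e2 F"
        by (simp add: bdry_def sum.distrib algebra_simps)
      then show ?thesis using e2(2)[OF that] that by (simp add: c'_def)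
    qed
    ultimately show "\<exists>e. mchain n P M (Suc p) e \<and> (\<forall>F. F \<subseteq> {1..n} \<longrightarrow> bdry {1..n} e F = c F)" by blast
  next
    case False
    have "c F = 0" if FR: "F \<in> R" for F
    proof (rule ccontr)
      assume "c F \<noteq> 0"
      then have F: "F \<subseteq> {1..n}" "card F = p" using cP by (auto simp: mchain_def)
      obtain q where q: "M = sqfree F + (q + g)" "V \<inter> Poly_Mapping.keys q = {}"
        using FR R_iff[OF F(1)] by blast
      have "M = (sqfree F + q) + g" using q(1) by (simp add: add.assoc)
      then have "mdvd g M" "M - g = sqfree F + q" by simp_all
      then have "Poly_Mapping.keys (sqfree F + q) \<subseteq> V" using False by auto
      moreover have "Poly_Mapping.keys q \<subseteq> Poly_Mapping.keys (sqfree F + q)" by (intro keys_mdvd) simp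
      ultimately have "Poly_Mapping.keys q = {}" using q(2) by blast
      then have "q = 0" by simp
      then have "mon_deg M = mon_deg g + p" using q(1) F fin by (simp add: mon_deg_sqfree)
      then show False using M(2) by simp
    qed
    then have "mchain n Q M p c" using split[OF cP] by blast
    then obtain e where "mchain n Q M (Suc p) e" "\<forall>F. F \<subseteq> {1..n} \<longrightarrow> bdry {1..n} e F = c F"
      using IH closed unfolding mexact_def by blast
    moreover have "mchain n P M (Suc p) e" using calculation(1) by (auto simp: mchain_def P_def)
    ultimately show "\<exists>e. mchain n P M (Suc p) e \<and> (\<forall>F. F \<subseteq> {1..n} \<longrightarrow> bdry {1..n} e F = c F)" by blast
  qed
qed

section \<open>A graded free resolution on tuples of generators\<close>

definition mlcm :: "mon \<Rightarrow> mon \<Rightarrow> mon" where "mlcm a b = a + (b - a)"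

lemma lookup_mlcm: "lk (mlcm a b) i = max (lk a i) (lk b i)"
  by (simp add: mlcm_def lookup_add lookup_minus)

lemma mlcm_le_iff: "mdvd (mlcm a b) c \<longleftrightarrow> mdvd a c \<and> mdvd b c"
  by (auto simp: mdvd_def lookup_mlcm)

lemma mlcm_upper: "mdvd a (mlcm a b)" "mdvd b (mlcm a b)"
  by (auto simp: mdvd_def lookup_mlcm)

text \<open>The number \<open>b < m ^ k\<close> codes a \<open>k\<close>-tuple of generators by its digits in base \<open>m\<close>: the first entry is
  \<open>g (b mod m)\<close>, and \<open>b div m\<close> codes the rest of the tuple. The value is the least common multiple of the
  entries. Entries may be repeated and their order matters, which makes the resolution larger than the Taylor
  complex but its contraction simpler.\<close>

fun tlcm :: "(nat \<Rightarrow> mon) \<Rightarrow> nat \<Rightarrow> nat \<Rightarrow> nat \<Rightarrow> mon" where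
  "tlcm g m 0 b = 0"
| "tlcm g m (Suc k) b = mlcm (g (b mod m)) (tlcm g m k (b div m))"

text \<open>The matrix of the boundary on tuples: delete the first entry with sign \<open>+\<close>, or keep it and apply the
  boundary of the shorter tuple with sign \<open>-\<close>.\<close>

fun tcoef :: "nat \<Rightarrow> nat \<Rightarrow> nat \<Rightarrow> nat \<Rightarrow> 'k::comm_ring_1" where
  "tcoef m 0 a b = 1"
| "tcoef m (Suc k) a b =
     (if b div m = a then 1 else 0) - (if b mod m = a mod m then tcoef m k (a div m) (b div m) else 0)"

text \<open>The same boundary for coefficient functions, where \<open>x + m * a\<close> is the tuple \<open>a\<close> with \<open>x\<close> in front.\<close>

fun tbdry :: "nat \<Rightarrow> nat \<Rightarrow> (nat \<Rightarrow> 'k::comm_ring_1) \<Rightarrow> nat \<Rightarrow> 'k" where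
  "tbdry m 0 c a = (\<Sum>x<m. c (x + m * a))"
| "tbdry m (Suc k) c a = (\<Sum>x<m. c (x + m * a)) - tbdry m k (\<lambda>b. c (a mod m + m * b)) (a div m)"

text \<open>Summing over all tuples is summing over the first entry and the rest.\<close>

lemma sum_digits:
  fixes f :: "nat \<Rightarrow> 'a::comm_monoid_add"
  assumes "m > 0"
  shows "(\<Sum>b<m * r. f b) = (\<Sum>b<r. \<Sum>x<m. f (x + m * b))"
proof -
  have "(\<Sum>b<r. \<Sum>x<m. f (x + m * b)) = (\<Sum>(b, x)\<in>{..<r} \<times> {..<m}. f (x + m * b))"
    by (rule sum.cartesian_product)
  also have "\<dots> = (\<Sum>b<m * r. f b)"
  proof (rule sum.reindex_bij_witness[where i = "\<lambda>b. (b div m, b mod m)" and j = "\<lambda>(b, x). x + m * b"])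
    fix p assume "p \<in> {..<r} \<times> {..<m}"
    then obtain b x where p: "p = (b, x)" "b < r" "x < m" by auto
    have "x + m * b < m * Suc b" using p(3) by simp
    also have "\<dots> \<le> m * r" using p(2) by (intro mult_le_mono2) simp
    finally show "(case p of (b, x) \<Rightarrow> x + m * b) \<in> {..<m * r}" by (simp add: p(1))
    show "(((case p of (b, x) \<Rightarrow> x + m * b) div m, (case p of (b, x) \<Rightarrow> x + m * b) mod m)) = p"
      using p by simp
  next
    fix b assume "b \<in> {..<m * r}"
    then show "(b div m, b mod m) \<in> {..<r} \<times> {..<m}"
      using assms by (simp add: less_mult_imp_div_less mult.commute)
  qed auto
  finally show ?thesis by simp
qed

lemma tbdry_matrix:
  assumes "m > 0" "a < m ^ k"
  shows "tbdry m k c a = (\<Sum>b<m ^ Suc k. tcoef m k a b * c b)"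
  using assms(2)
proof (induction k arbitrary: a c)
  case 0
  then show ?case by simp
next
  case (Suc k)
  have adiv: "a div m < m ^ k" using Suc.prems by (simp add: less_mult_imp_div_less mult.commute)
  have "(\<Sum>b<m ^ Suc (Suc k). tcoef m (Suc k) a b * c b)
      = (\<Sum>b<m ^ Suc k. \<Sum>x<m. tcoef m (Suc k) a (x + m * b) * c (x + m * b))"
    using sum_digits[OF assms(1), of "\<lambda>b. tcoef m (Suc k) a b * c b" "m ^ Suc k"] by simp
  also have "\<dots> = (\<Sum>b<m ^ Suc k. (\<Sum>x<m. if b = a then c (x + m * a) else 0) -
      tcoef m k (a div m) b * c (a mod m + m * b))"
  proof (rule sum.cong[OF refl])
    fix b
    have "(\<Sum>x<m. tcoef m (Suc k) a (x + m * b) * c (x + m * b))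
       = (\<Sum>x<m. (if b = a then c (x + m * a) else 0) -
           (if x = a mod m then tcoef m k (a div m) b * c (a mod m + m * b) else 0))"
      by (rule sum.cong) (auto simp: algebra_simps)
    also have "\<dots> = (\<Sum>x<m. if b = a then c (x + m * a) else 0) -
        (\<Sum>x<m. if x = a mod m then tcoef m k (a div m) b * c (a mod m + m * b) else 0)"
      by (rule sum_subtractf)
    also have "(\<Sum>x<m. if x = a mod m then tcoef m k (a div m) b * c (a mod m + m * b) else 0)
        = tcoef m k (a div m) b * c (a mod m + m * b)"
      using assms(1) by simp
    finally show "(\<Sum>x<m. tcoef m (Suc k) a (x + m * b) * c (x + m * b)) =
      (\<Sum>x<m. if b = a then c (x + m * a) else 0) - tcoef m k (a div m) b * c (a mod m + m * b)" .
  qed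
  also have "\<dots> = (\<Sum>b<m ^ Suc k. \<Sum>x<m. if b = a then c (x + m * a) else 0) -
      (\<Sum>b<m ^ Suc k. tcoef m k (a div m) b * c (a mod m + m * b))"
    by (rule sum_subtractf)
  also have "(\<Sum>b<m ^ Suc k. tcoef m k (a div m) b * c (a mod m + m * b))
      = tbdry m k (\<lambda>b. c (a mod m + m * b)) (a div m)"
    using Suc.IH[OF adiv] by simp
  also have "(\<Sum>b<m ^ Suc k. \<Sum>x<m. if b = a then c (x + m * a) else 0)
      = (\<Sum>b<m ^ Suc k. if b = a then (\<Sum>x<m. c (x + m * a)) else 0)"
    by (rule sum.cong) auto
  also have "\<dots> = (\<Sum>x<m. c (x + m * a))" using Suc.prems by simp
  finally show ?case by simp
qed

lemma tbdry_diff: "tbdry m k (\<lambda>b. c b - d b) a = tbdry m k c a - tbdry m k d a"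
  by (induction k arbitrary: c d a) (simp_all add: sum_subtractf algebra_simps)

lemma tbdry_zero: "tbdry m k (\<lambda>b. 0) a = 0"
  by (induction k arbitrary: a) simp_all

lemma tbdry_add: "tbdry m k (\<lambda>b. c b + d b) a = tbdry m k c a + tbdry m k d a"
  by (induction k arbitrary: c d a) (simp_all add: sum.distrib algebra_simps)

lemma tbdry_sum: "finite S \<Longrightarrow> tbdry m k (\<lambda>b. \<Sum>x\<in>S. c x b) a = (\<Sum>x\<in>S. tbdry m k (c x) a)"
  by (induction S rule: finite_induct) (simp_all add: tbdry_zero tbdry_add)

text \<open>By the recursion, the terms that delete the first two entries cancel after exchange of the two summations,
  the terms that delete the first entry and a later one cancel in pairs, and the rest is the induction
  hypothesis.\<close>

lemma tbdry_tbdry: "tbdry m k (tbdry m (Suc k) c) a = 0"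
proof (induction k arbitrary: c a)
  case 0
  have "tbdry m 0 (tbdry m (Suc 0) c) a = (\<Sum>x<m. (\<Sum>y<m. c (y + m * (x + m * a))) - (\<Sum>y<m. c (x + m * (y + m * a))))"
    by (simp add: algebra_simps)
  also have "\<dots> = (\<Sum>x<m. \<Sum>y<m. c (y + m * (x + m * a))) - (\<Sum>x<m. \<Sum>y<m. c (x + m * (y + m * a)))"
    by (rule sum_subtractf)
  also have "(\<Sum>x<m. \<Sum>y<m. c (x + m * (y + m * a))) = (\<Sum>x<m. \<Sum>y<m. c (y + m * (x + m * a)))"
    by (rule sum.swap)
  finally show ?case by simp
next
  case (Suc k)
  define r where "r = a mod m"
  define C where "C = tbdry m (Suc (Suc k)) c"
  have Cx: "C (x + m * b) = (\<Sum>y<m. c (y + m * (x + m * b))) - tbdry m (Suc k) (\<lambda>b. c (x + m * b)) b"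
    if "x < m" for x b
    using that unfolding C_def by (subst tbdry.simps) simp
  have inner: "tbdry m (Suc k) (\<lambda>b. c (x + m * b)) a
      = (\<Sum>y<m. c (x + m * (y + m * a))) - tbdry m k (\<lambda>b. c (x + m * (r + m * b))) (a div m)" for x
    by (simp add: r_def)
  have 1: "(\<Sum>x<m. C (x + m * a)) = (\<Sum>x<m. tbdry m k (\<lambda>b. c (x + m * (r + m * b))) (a div m))"
  proof -
    have "(\<Sum>x<m. C (x + m * a)) = (\<Sum>x<m. ((\<Sum>y<m. c (y + m * (x + m * a))) -
        (\<Sum>y<m. c (x + m * (y + m * a)))) + tbdry m k (\<lambda>b. c (x + m * (r + m * b))) (a div m))"
    proof (rule sum.cong[OF refl])
      fix x assume "x \<in> {..<m}"
      then have "x < m" by simp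
      show "C (x + m * a) = ((\<Sum>y<m. c (y + m * (x + m * a))) - (\<Sum>y<m. c (x + m * (y + m * a)))) +
          tbdry m k (\<lambda>b. c (x + m * (r + m * b))) (a div m)"
        unfolding Cx[OF \<open>x < m\<close>] inner by (simp only: diff_diff_eq2 diff_add_eq)
    qed
    also have "\<dots> = ((\<Sum>x<m. \<Sum>y<m. c (y + m * (x + m * a))) - (\<Sum>x<m. \<Sum>y<m. c (x + m * (y + m * a)))) +
        (\<Sum>x<m. tbdry m k (\<lambda>b. c (x + m * (r + m * b))) (a div m))"
      by (simp only: sum.distrib sum_subtractf)
    also have "(\<Sum>x<m. \<Sum>y<m. c (x + m * (y + m * a))) = (\<Sum>x<m. \<Sum>y<m. c (y + m * (x + m * a)))"
      by (rule sum.swap)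
    finally show ?thesis by simp
  qed
  have 2: "tbdry m k (\<lambda>b. C (r + m * b)) (a div m) = (\<Sum>x<m. tbdry m k (\<lambda>b. c (x + m * (r + m * b))) (a div m))"
  proof (cases "m = 0")
    case False
    then have "r < m" by (simp add: r_def)
    then have "tbdry m k (\<lambda>b. C (r + m * b)) (a div m)
        = tbdry m k (\<lambda>b. (\<Sum>y<m. c (y + m * (r + m * b))) - tbdry m (Suc k) (\<lambda>b. c (r + m * b)) b) (a div m)"
      by (simp only: Cx)
    also have "\<dots> = tbdry m k (\<lambda>b. \<Sum>y<m. c (y + m * (r + m * b))) (a div m)"
      by (simp only: tbdry_diff Suc.IH diff_zero)
    also have "\<dots> = (\<Sum>y<m. tbdry m k (\<lambda>b. c (y + m * (r + m * b))) (a div m))"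
      by (rule tbdry_sum) simp
    finally show ?thesis .
  next
    case True
    have z: "tbdry 0 k d x = 0" for k and d :: "nat \<Rightarrow> 'a" and x
      by (induction k arbitrary: d x) simp_all
    show ?thesis using True by (simp add: z)
  qed
  have "tbdry m (Suc k) C a = (\<Sum>x<m. C (x + m * a)) - tbdry m k (\<lambda>b. C (r + m * b)) (a div m)"
    by (simp add: r_def)
  then show ?case using 1 2 by (simp add: C_def)
qed

text \<open>A nonzero entry means that \<open>a\<close> arises from \<open>b\<close> by deleting an entry, and then the least common multiple can
  only shrink.\<close>

lemma tcoef_mdvd: "(tcoef m k a b :: 'k::comm_ring_1) \<noteq> 0 \<Longrightarrow> mdvd (tlcm g m k a) (tlcm g m (Suc k) b)"
proof (induction k arbitrary: a b)
  case (Suc k)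
  show ?case
  proof (cases "b div m = a")
    case True
    then show ?thesis by (metis mlcm_upper(2) tlcm.simps(2))
  next
    case False
    then have "b mod m = a mod m" "(tcoef m k (a div m) (b div m) :: 'k) \<noteq> 0"
      using Suc.prems by (auto split: if_splits)
    then have "mdvd (tlcm g m k (a div m)) (tlcm g m (Suc k) (b div m))" using Suc.IH by blast
    then show ?thesis
      using \<open>b mod m = a mod m\<close> mlcm_upper mdvd_trans by (simp only: tlcm.simps mlcm_le_iff)
  qed
qed simp

text \<open>Putting a fixed generator that divides \<open>M\<close> in front of each tuple is a contracting homotopy, and it leaves
  all least common multiples divisors of \<open>M\<close>.\<close>

lemma tbdry_contract:
  fixes c :: "nat \<Rightarrow> 'k::comm_ring_1"
  assumes "m > 0" "p < m"
    and supp: "\<And>b. c b \<noteq> 0 \<Longrightarrow> b < m ^ Suc k \<and> mdvd (tlcm g m (Suc k) b) M"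
    and closed: "\<And>a. a < m ^ k \<Longrightarrow> tbdry m k c a = 0"
    and p: "mdvd (g p) M"
  shows "\<exists>e. (\<forall>b. e b \<noteq> 0 \<longrightarrow> b < m ^ Suc (Suc k) \<and> mdvd (tlcm g m (Suc (Suc k)) b) M) \<and>
             (\<forall>a<m ^ Suc k. tbdry m (Suc k) e a = c a)"
proof -
  define e where "e b = (if b mod m = p then c (b div m) else 0)" for b
  have "b < m ^ Suc (Suc k) \<and> mdvd (tlcm g m (Suc (Suc k)) b) M" if "e b \<noteq> 0" for b
  proof -
    have b: "b mod m = p" "c (b div m) \<noteq> 0" using that by (auto simp: e_def split: if_splits)
    then have "b div m < m ^ Suc k" "mdvd (tlcm g m (Suc k) (b div m)) M" using supp by blast+
    moreover have "b < m * m ^ Suc k"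
      using calculation(1) assms(1) by (simp add: div_less_iff_less_mult mult.commute)
    ultimately show ?thesis using b(1) p by (simp only: tlcm.simps(2)[of g m "Suc k"] mlcm_le_iff) simp
  qed
  moreover have "tbdry m (Suc k) e a = c a" if "a < m ^ Suc k" for a
  proof -
    have "(\<Sum>x<m. e (x + m * a)) = (\<Sum>x<m. if x = p then c a else 0)"
      by (rule sum.cong) (auto simp: e_def)
    then have 1: "(\<Sum>x<m. e (x + m * a)) = c a" using assms(2) by simp
    have 2: "tbdry m k (\<lambda>b. e (a mod m + m * b)) (a div m) = 0"
    proof (cases "a mod m = p")
      case True
      then have "(\<lambda>b. e (a mod m + m * b)) = c" using assms(2) by (auto simp: e_def fun_eq_iff)
      moreover have "a div m < m ^ k" using that by (simp add: less_mult_imp_div_less mult.commute)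
      ultimately show ?thesis using closed by simp
    next
      case False
      then have "(\<lambda>b. e (a mod m + m * b)) = (\<lambda>b. 0)" using assms(1) by (auto simp: e_def fun_eq_iff)
      then show ?thesis by (simp add: tbdry_zero)
    qed
    show ?thesis using 1 2 by simp
  qed
  ultimately show ?thesis by blast
qed

text \<open>The boundary on tuples, with the monomials that make it multigraded.\<close>

definition taylor_map :: "(nat \<Rightarrow> mon) \<Rightarrow> nat \<Rightarrow> nat \<Rightarrow> (nat \<Rightarrow> 'k::field mpoly) \<Rightarrow> nat \<Rightarrow> 'k mpoly" where
  "taylor_map g m k f a =
     (\<Sum>b<m ^ Suc k. Poly_Mapping.single (tlcm g m (Suc k) b - tlcm g m k a) (tcoef m k a b) * f b)"

lemma mcomp_taylor_map:
  fixes f :: "nat \<Rightarrow> 'k::field mpoly"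
  assumes "m > 0" "a < m ^ k"
  shows "mcomp (tlcm g m k a) M (taylor_map g m k f a) = tbdry m k (\<lambda>b. mcomp (tlcm g m (Suc k) b) M (f b)) a"
proof -
  have "mcomp (tlcm g m k a) M (Poly_Mapping.single (tlcm g m (Suc k) b - tlcm g m k a) (tcoef m k a b) * f b)
     = tcoef m k a b * mcomp (tlcm g m (Suc k) b) M (f b)" for b
  proof (cases "(tcoef m k a b :: 'k) = 0")
    case True
    then show ?thesis by (simp only: True) simp
  next
    case False
    show ?thesis by (rule mcomp_entry[OF tcoef_mdvd[OF False]])
  qed
  then show ?thesis unfolding taylor_map_def mcomp_sum tbdry_matrix[OF assms] by (intro sum.cong) simp_all
qed

lemma taylor_map_taylor_map:
  fixes f :: "nat \<Rightarrow> 'k::field mpoly"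
  assumes "m > 0" "a < m ^ k"
  shows "taylor_map g m k (\<lambda>b. if b < m ^ Suc k then taylor_map g m (Suc k) f b else 0) a = 0"
proof (rule mcomp_eqI)
  fix M
  define c where "c = (\<lambda>b. mcomp (tlcm g m (Suc (Suc k)) b) M (f b))"
  have "mcomp (tlcm g m k a) M (taylor_map g m k (\<lambda>b. if b < m ^ Suc k then taylor_map g m (Suc k) f b else 0) a)
    = (\<Sum>b<m ^ Suc k. tcoef m k a b * mcomp (tlcm g m (Suc k) b) M (if b < m ^ Suc k then taylor_map g m (Suc k) f b else 0))"
    by (simp only: mcomp_taylor_map[OF assms] tbdry_matrix[OF assms])
  also have "\<dots> = (\<Sum>b<m ^ Suc k. tcoef m k a b * tbdry m (Suc k) c b)"
    by (rule sum.cong[OF refl]) (simp only: lessThan_iff if_True mcomp_taylor_map[OF assms(1)] c_def)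
  also have "\<dots> = tbdry m k (tbdry m (Suc k) c) a" by (simp only: tbdry_matrix[OF assms])
  also have "\<dots> = 0" by (rule tbdry_tbdry)
  finally show "mcomp (tlcm g m k a) M (taylor_map g m k (\<lambda>b. if b < m ^ Suc k then taylor_map g m (Suc k) f b else 0) a)
      = mcomp (tlcm g m k a) M 0" by simp
qed

lemma poly_of_components_family:
  fixes e :: "mon \<Rightarrow> nat \<Rightarrow> 'k::field"
  assumes "finite Ms" "\<And>M b. e M b \<noteq> 0 \<Longrightarrow> M \<in> Ms \<and> b < r \<and> mdvd (\<nu> b) M" "Ms \<subseteq> monomials n"
  obtains h where "h \<in> free_module n r" "\<And>M b. mcomp (\<nu> b) M (h b) = e M b"
proof -
  have "\<exists>h. \<forall>M. mcomp (\<nu> b) M h = e M b" for b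
  proof -
    have "{M. e M b \<noteq> 0} \<subseteq> Ms" using assms(2) by blast
    then have fin: "finite {M. e M b \<noteq> 0}" using assms(1) by (rule finite_subset)
    have le: "mdvd (\<nu> b) M" if "e M b \<noteq> 0" for M using assms(2)[OF that] by simp
    obtain h where "\<And>M. mcomp (\<nu> b) M h = e M b" using poly_of_components[OF fin le] by blast
    then show ?thesis by blast
  qed
  then obtain h where h: "\<And>b M. mcomp (\<nu> b) M (h b) = e M b" by metis
  have "h b = 0" if "\<not> b < r" for b
    by (rule mcomp_eqI[of "\<nu> b"]) (use h assms(2) that in \<open>metis mcomp_zero\<close>)
  moreover have "Poly_Mapping.keys (h b) \<subseteq> monomials n" for b
  proof
    fix k assume "k \<in> Poly_Mapping.keys (h b)"
    then have "e (k + \<nu> b) b \<noteq> 0" using h[of b "k + \<nu> b"] by (simp add: mcomp_shift in_keys_iff)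
    then have "k + \<nu> b \<in> monomials n" using assms(2,3) by blast
    then show "k \<in> monomials n" by simp
  qed
  ultimately have "h \<in> free_module n r" by (simp add: free_module_def polyring_def)
  then show thesis using h by (rule that)
qed

lemma tlcm_monomials:
  assumes "m > 0" "\<And>i. i < m \<Longrightarrow> g i \<in> monomials n"
  shows "tlcm g m j b \<in> monomials n"
proof (induction j arbitrary: b)
  case (Suc j)
  have "g (b mod m) \<in> monomials n" using assms by simp
  moreover have "tlcm g m j (b div m) - g (b mod m) \<in> monomials n"
    by (rule monomials_mdvd[OF _ Suc[of "b div m"]]) (simp add: mdvd_def lookup_minus)
  ultimately show ?case by (simp add: mlcm_def)
qed simp

text \<open>In each multidegree that occurs in \<open>f\<close> some generator divides this multidegree, and prepending it contracts
  the complex there. Which generator is used may depend on the multidegree.\<close>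

lemma taylor_map_exact:
  fixes f :: "nat \<Rightarrow> 'k::field mpoly"
  assumes "m > 0" "\<And>i. i < m \<Longrightarrow> g i \<in> monomials n"
    and f: "f \<in> free_module n (m ^ Suc k)" and closed: "\<And>a. a < m ^ k \<Longrightarrow> taylor_map g m k f a = 0"
  obtains h where "h \<in> free_module n (m ^ Suc (Suc k))" "\<And>a. a < m ^ Suc k \<Longrightarrow> taylor_map g m (Suc k) h a = f a"
proof -
  define c where "c M b = mcomp (tlcm g m (Suc k) b) M (f b)" for M b
  define Ms where "Ms = {M. \<exists>b. c M b \<noteq> 0}"
  have mu_mon: "tlcm g m j b \<in> monomials n" for j b
    using assms(1,2) by (rule tlcm_monomials)
  have csupp: "b < m ^ Suc k \<and> mdvd (tlcm g m (Suc k) b) M \<and> M \<in> monomials n" if nz: "c M b \<noteq> 0" for M b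
  proof -
    have "f b \<noteq> 0" using nz by (auto simp: c_def)
    have b: "b < m ^ Suc k"
    proof (rule ccontr)
      assume "\<not> b < m ^ Suc k"
      then have "f b = 0" using f by (simp add: free_module_def del: power_Suc)
      then show False using \<open>f b \<noteq> 0\<close> by simp
    qed
    have "mdvd (tlcm g m (Suc k) b) M" "M - tlcm g m (Suc k) b \<in> Poly_Mapping.keys (f b)"
      using nz by (auto simp: c_def mcomp_def in_keys_iff simp del: tlcm.simps split: if_splits)
    moreover have "Poly_Mapping.keys (f b) \<subseteq> monomials n"
      using f b by (simp add: free_module_def polyring_def)
    ultimately have "M - tlcm g m (Suc k) b + tlcm g m (Suc k) b \<in> monomials n"
      using mu_mon[of "Suc k" b] unfolding monomials_add by blast
    then show ?thesis using b \<open>mdvd _ M\<close> by (simp only: mdvd_minus_add)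
  qed
  have "Ms \<subseteq> (\<Union>b<m ^ Suc k. {M. c M b \<noteq> 0})" using csupp by (auto simp: Ms_def)
  then have finMs: "finite Ms"
    by (rule finite_subset) (simp add: c_def finite_mcomp_support del: tlcm.simps)
  have "\<exists>e. (\<forall>b. e b \<noteq> 0 \<longrightarrow> M \<in> Ms \<and> b < m ^ Suc (Suc k) \<and> mdvd (tlcm g m (Suc (Suc k)) b) M) \<and>
             (\<forall>a<m ^ Suc k. tbdry m (Suc k) e a = c M a)" for M
  proof (cases "M \<in> Ms")
    case True
    then obtain b0 where b0: "c M b0 \<noteq> 0" by (auto simp: Ms_def)
    have "mdvd (g (b0 mod m)) M"
      using csupp[OF b0] by (simp add: mlcm_le_iff)
    moreover have "tbdry m k (c M) a = 0" if "a < m ^ k" for a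
    proof -
      have "tbdry m k (c M) a = mcomp (tlcm g m k a) M (taylor_map g m k f a)"
        unfolding mcomp_taylor_map[OF assms(1) that] c_def[abs_def] ..
      then show ?thesis using closed[OF that] by simp
    qed
    ultimately have "\<exists>e. (\<forall>b. e b \<noteq> 0 \<longrightarrow> b < m ^ Suc (Suc k) \<and> mdvd (tlcm g m (Suc (Suc k)) b) M) \<and>
             (\<forall>a<m ^ Suc k. tbdry m (Suc k) e a = c M a)"
      by (intro tbdry_contract[OF assms(1), of "b0 mod m"]) (use csupp assms(1) in \<open>simp_all del: tlcm.simps tbdry.simps power_Suc\<close>)
    then show ?thesis using True by blast
  next
    case False
    then have "c M b = 0" for b by (auto simp: Ms_def)
    then show ?thesis by (intro exI[of _ "\<lambda>_. 0"]) (simp add: tbdry_zero)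
  qed
  then obtain e where e: "\<And>M b. e M b \<noteq> 0 \<Longrightarrow> M \<in> Ms \<and> b < m ^ Suc (Suc k) \<and> mdvd (tlcm g m (Suc (Suc k)) b) M"
    "\<And>M a. a < m ^ Suc k \<Longrightarrow> tbdry m (Suc k) (e M) a = c M a"
    by metis
  have "Ms \<subseteq> monomials n" using csupp by (auto simp: Ms_def)
  from poly_of_components_family[OF finMs e(1) this]
  obtain h where h: "h \<in> free_module n (m ^ Suc (Suc k))" "\<And>M b. mcomp (tlcm g m (Suc (Suc k)) b) M (h b) = e M b"
    by blast
  have "taylor_map g m (Suc k) h a = f a" if "a < m ^ Suc k" for a
  proof (rule mcomp_eqI)
    fix M
    show "mcomp (tlcm g m (Suc k) a) M (taylor_map g m (Suc k) h a) = mcomp (tlcm g m (Suc k) a) M (f a)"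
      unfolding mcomp_taylor_map[OF assms(1) that] h(2) e(2)[OF that] c_def ..
  qed
  then show thesis using h(1) that by blast
qed

text \<open>Homological degree \<open>i\<close> has the tuples of length \<open>i + 1\<close> as basis; the boundary of a tuple of length \<open>1\<close> is
  the augmentation.\<close>

definition taylor :: "(nat \<Rightarrow> mon) \<Rightarrow> nat \<Rightarrow> 'k::field free_complex" where
  "taylor g m = \<lparr>frank = (\<lambda>i. m ^ Suc i), fdeg = (\<lambda>i b. int (mon_deg (tlcm g m (Suc i) b))),
     fmat = (\<lambda>i a b. Poly_Mapping.single (tlcm g m (Suc (Suc i)) b - tlcm g m (Suc i) a) (tcoef m (Suc i) a b)),
     faug = (\<lambda>b. Poly_Mapping.single (tlcm g m 1 b) 1)\<rparr>"

lemma taylor_sel: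
  "frank (taylor g m) i = m ^ Suc i"
  "fdeg (taylor g m) i b = int (mon_deg (tlcm g m (Suc i) b))"
  "fmat (taylor g m :: 'k::field free_complex) i a b = Poly_Mapping.single (tlcm g m (Suc (Suc i)) b - tlcm g m (Suc i) a) (tcoef m (Suc i) a b)"
  "faug (taylor g m :: 'k free_complex) b = Poly_Mapping.single (tlcm g m 1 b) 1"
  by (simp_all add: taylor_def)

lemma taylor_resolution:
  fixes g :: "nat \<Rightarrow> mon"
  assumes m: "m > 0" and g: "\<And>i. i < m \<Longrightarrow> g i \<in> monomials n"
  shows "graded_free_resolution n (taylor g m :: 'k::field free_complex) (monomial_ideal n (g ` {..<m}))"
proof -
  let ?F = "taylor g m :: 'k free_complex"
  have mu_mon: "tlcm g m j b \<in> monomials n" for j b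
    using m g by (rule tlcm_monomials)
  have minus_mon: "tlcm g m j b - q \<in> monomials n" for j b q
    by (rule monomials_mdvd[OF _ mu_mon[of j b]]) (simp add: mdvd_def lookup_minus)
  have diff: "fdiff ?F i f = (\<lambda>a. if a < m ^ Suc i then taylor_map g m (Suc i) f a else 0)" for i f
    unfolding fdiff_def mat_app_def taylor_map_def taylor_sel ..
  have aug: "faugment ?F f = taylor_map g m 0 f 0" for f
    unfolding faugment_def taylor_map_def taylor_sel by (simp del: tlcm.simps add: tlcm.simps(1))
  have carr: "taylor_map g m k f a \<in> carrier (polyring n)" if f: "f \<in> free_module n (m ^ Suc k)"
    for f :: "nat \<Rightarrow> 'k mpoly" and k a
  proof -
    interpret R: cring "polyring n :: 'k mpoly ring" by (rule cring_polyring)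
    have "Poly_Mapping.keys (taylor_map g m k f a) \<subseteq>
      (\<Union>b<m ^ Suc k. Poly_Mapping.keys (Poly_Mapping.single (tlcm g m (Suc k) b - tlcm g m k a) (tcoef m k a b) * f b))"
      unfolding taylor_map_def by (rule Poly_Mapping.keys_sum)
    also have "\<dots> \<subseteq> monomials n"
    proof (rule UN_least)
      fix b assume "b \<in> {..<m ^ Suc k}"
      then have "f b \<in> carrier (polyring n)" using f by (simp add: free_module_def)
      moreover have "Poly_Mapping.single (tlcm g m (Suc k) b - tlcm g m k a) (tcoef m k a b :: 'k) \<in> carrier (polyring n)"
        using minus_mon[of "Suc k" b] by (simp add: polyring_def del: tlcm.simps)
      ultimately have "Poly_Mapping.single (tlcm g m (Suc k) b - tlcm g m k a) (tcoef m k a b) \<otimes>\<^bsub>polyring n\<^esub> f b \<in> carrier (polyring n)"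
        by (simp only: R.m_closed)
      then show "Poly_Mapping.keys (Poly_Mapping.single (tlcm g m (Suc k) b - tlcm g m k a) (tcoef m k a b) * f b) \<subseteq> monomials n"
        by (simp add: polyring_def del: tlcm.simps tcoef.simps)
    qed
    finally show ?thesis by (simp add: polyring_def)
  qed
  have gm: "g ` {..<m} \<subseteq> monomials n" using g by auto
  have 1: "faug ?F b \<in> carrier (polyring n) \<and> homogeneous (fdeg ?F 0 b) (faug ?F b)" for b
    using mu_mon[of 1 b] by (simp add: taylor_sel polyring_def homogeneous_def)
  have 2: "fmat ?F i a b \<in> carrier (polyring n) \<and> homogeneous (fdeg ?F (Suc i) b - fdeg ?F i a) (fmat ?F i a b)" for i a b
  proof -
    have "homogeneous (fdeg ?F (Suc i) b - fdeg ?F i a) (fmat ?F i a b)"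
    proof (cases "(tcoef m (Suc i) a b :: 'k) = 0")
      case False
      from mon_deg_minus[OF tcoef_mdvd[OF False, of g]] show ?thesis
        by (simp add: taylor_sel homogeneous_def del: tlcm.simps tcoef.simps)
    qed (simp add: taylor_sel homogeneous_def del: tlcm.simps tcoef.simps)
    then show ?thesis
      using minus_mon[of "Suc (Suc i)" b] by (simp add: taylor_sel polyring_def del: tlcm.simps tcoef.simps)
  qed
  have 3: "faugment ?F ` free_module n (frank ?F 0) = monomial_ideal n (g ` {..<m})"
  proof (rule subset_antisym; rule subsetI)
    fix p assume "p \<in> faugment ?F ` free_module n (frank ?F 0)"
    then obtain f where f: "f \<in> free_module n (m ^ Suc 0)" "p = taylor_map g m 0 f 0"
      by (auto simp: taylor_sel aug)
    have "\<exists>u\<in>g ` {..<m}. mdvd u k" if k: "k \<in> Poly_Mapping.keys p" for k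
    proof -
      have "tbdry m 0 (\<lambda>b. mcomp (tlcm g m (Suc 0) b) k (f b)) 0 \<noteq> 0"
        using k mcomp_taylor_map[OF m, of 0 0 g k f] unfolding f(2) by (simp add: mcomp_def in_keys_iff)
      then obtain b where "b < m" "mcomp (tlcm g m (Suc 0) b) k (f b) \<noteq> 0"
        by (auto simp del: tlcm.simps dest: sum.not_neutral_contains_not_neutral)
      then have "mdvd (tlcm g m (Suc 0) b) k" by (auto simp: mcomp_def simp del: tlcm.simps split: if_splits)
      then have "mdvd (g b) k" using \<open>b < m\<close> by (simp add: mlcm_le_iff)
      then show ?thesis using \<open>b < m\<close> by blast
    qed
    moreover have "p \<in> carrier (polyring n)" using carr[OF f(1)] f(2) by simp
    ultimately show "p \<in> monomial_ideal n (g ` {..<m})"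
      unfolding monomial_ideal_mem[OF gm] by (simp add: polyring_def)
  next
    fix p :: "'k mpoly" assume "p \<in> monomial_ideal n (g ` {..<m})"
    then have p: "Poly_Mapping.keys p \<subseteq> monomials n" "\<And>k. k \<in> Poly_Mapping.keys p \<Longrightarrow> \<exists>i<m. mdvd (g i) k"
      unfolding monomial_ideal_mem[OF gm] by auto
    \<comment> \<open>each term of \<open>p\<close> is assigned to one generator that divides it\<close>
    define ch where "ch k = (SOME i. i < m \<and> mdvd (g i) k)" for k
    have ch: "ch k < m" "mdvd (g (ch k)) k" if "k \<in> Poly_Mapping.keys p" for k
      using someI_ex[OF p(2)[OF that, unfolded Bex_def]] by (auto simp: ch_def)
    define e where "e M b = (if M \<in> Poly_Mapping.keys p \<and> b = ch M then lk p M else 0)" for M b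
    have "M \<in> Poly_Mapping.keys p \<and> b < m ^ Suc 0 \<and> mdvd (tlcm g m (Suc 0) b) M" if "e M b \<noteq> 0" for M b
      using that ch[of M] by (auto simp: e_def mlcm_le_iff split: if_splits)
    from poly_of_components_family[OF finite_keys this p(1)]
    obtain h where h: "h \<in> free_module n (m ^ Suc 0)" "\<And>M b. mcomp (tlcm g m (Suc 0) b) M (h b) = e M b"
      by blast
    have "taylor_map g m 0 h 0 = p"
    proof (rule mcomp_eqI[of "tlcm g m 0 0"])
      fix M
      have "mcomp (tlcm g m 0 0) M (taylor_map g m 0 h 0) = tbdry m 0 (e M) 0"
        using mcomp_taylor_map[OF m, of 0 0 g M h] unfolding h(2) by simp
      also have "\<dots> = (\<Sum>b<m. if b = ch M then (if M \<in> Poly_Mapping.keys p then lk p M else 0) else 0)"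
        by (simp add: e_def)
      also have "\<dots> = lk p M"
        using ch(1)[of M] by (auto simp: in_keys_iff)
      finally show "mcomp (tlcm g m 0 0) M (taylor_map g m 0 h 0) = mcomp (tlcm g m 0 0) M p" by (simp add: mcomp_def)
    qed
    then show "p \<in> faugment ?F ` free_module n (frank ?F 0)"
      using h(1) by (intro image_eqI[of _ _ h]) (simp_all add: aug taylor_sel)
  qed
  have exact: "{f \<in> free_module n (m ^ Suc k). \<forall>a<m ^ k. taylor_map g m k f a = (0 :: 'k mpoly)}
      = (\<lambda>h a. if a < m ^ Suc k then taylor_map g m (Suc k) h a else 0) ` free_module n (m ^ Suc (Suc k))" for k
  proof (rule subset_antisym; rule subsetI)
    fix f :: "nat \<Rightarrow> 'k mpoly" assume "f \<in> {f \<in> free_module n (m ^ Suc k). \<forall>a<m ^ k. taylor_map g m k f a = 0}"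
    then have f: "f \<in> free_module n (m ^ Suc k)" "\<And>a. a < m ^ k \<Longrightarrow> taylor_map g m k f a = 0" by auto
    obtain h where h: "h \<in> free_module n (m ^ Suc (Suc k))" "\<And>a. a < m ^ Suc k \<Longrightarrow> taylor_map g m (Suc k) h a = f a"
      using taylor_map_exact[OF m g f] by blast
    have "f = (\<lambda>a. if a < m ^ Suc k then taylor_map g m (Suc k) h a else 0)"
      using h(2) f(1) by (auto simp: fun_eq_iff free_module_def)
    then show "f \<in> (\<lambda>h a. if a < m ^ Suc k then taylor_map g m (Suc k) h a else 0) ` free_module n (m ^ Suc (Suc k))"
      using h(1) by blast
  next
    fix f assume "f \<in> (\<lambda>h a. if a < m ^ Suc k then taylor_map g m (Suc k) h a else (0 :: 'k mpoly)) ` free_module n (m ^ Suc (Suc k))"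
    then obtain h where h: "h \<in> free_module n (m ^ Suc (Suc k))"
      "f = (\<lambda>a. if a < m ^ Suc k then taylor_map g m (Suc k) h a else 0)" by blast
    have "f \<in> free_module n (m ^ Suc k)" using carr[OF h(1)] by (simp add: h(2) free_module_def)
    moreover have "taylor_map g m k f a = 0" if "a < m ^ k" for a
      unfolding h(2) by (rule taylor_map_taylor_map[OF m that])
    ultimately show "f \<in> {f \<in> free_module n (m ^ Suc k). \<forall>a<m ^ k. taylor_map g m k f a = 0}" by blast
  qed
  have 4: "{f \<in> free_module n (frank ?F 0). faugment ?F f = 0} = fdiff ?F 0 ` free_module n (frank ?F (Suc 0))"
    using exact[of 0] unfolding diff aug taylor_sel(1) by simp
  have 5: "{f \<in> free_module n (frank ?F (Suc i)). fdiff ?F i f = 0} = fdiff ?F (Suc i) ` free_module n (frank ?F (Suc (Suc i)))" for i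
  proof -
    have "fdiff ?F i f = 0 \<longleftrightarrow> (\<forall>a<m ^ Suc i. taylor_map g m (Suc i) f a = 0)" for f
      unfolding diff by (auto simp: fun_eq_iff zero_fun_def)
    then show ?thesis using exact[of "Suc i"] unfolding diff taylor_sel(1) by simp
  qed
  show ?thesis unfolding graded_free_resolution_def using 1 2 3 4 5 by blast
qed

section \<open>Double complexes\<close>

text \<open>A diagram chase. The first index counts columns and is lowered by \<open>h\<close>; the second counts rows and is lowered
  by \<open>v\<close>. The actual double complex has both indices positive; row and column \<open>0\<close> hold the targets of the
  augmentations. All other rows and columns are exact, up to and including their augmentations, so exactness
  of row \<open>0\<close> at one place is inherited by column \<open>0\<close>.\<close>

lemma zigzag:
  fixes D :: "nat \<Rightarrow> nat \<Rightarrow> 'a::ab_group_add set" and h v :: "nat \<Rightarrow> nat \<Rightarrow> 'a \<Rightarrow> 'a"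
  assumes hD: "\<And>p q x. x \<in> D (Suc p) q \<Longrightarrow> h p q x \<in> D p q"
    and vD: "\<And>p q x. x \<in> D p (Suc q) \<Longrightarrow> v p q x \<in> D p q"
    and Ddiff: "\<And>p q x y. x \<in> D p q \<Longrightarrow> y \<in> D p q \<Longrightarrow> x - y \<in> D p q"
    and hdiff: "\<And>p q x y. h p q (x - y) = h p q x - h p q y"
    and vdiff: "\<And>p q x y. v p q (x - y) = v p q x - v p q y"
    and comm: "\<And>p q x. x \<in> D (Suc p) (Suc q) \<Longrightarrow> h p q (v (Suc p) q x) = v p q (h p (Suc q) x)"
    and vv: "\<And>p q x. x \<in> D p (Suc (Suc q)) \<Longrightarrow> v p q (v p (Suc q) x) = 0"
    and hh: "\<And>p q x. x \<in> D (Suc (Suc p)) q \<Longrightarrow> h p q (h (Suc p) q x) = 0"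
    and row0: "\<And>q x. x \<in> D 0 (Suc q) \<Longrightarrow> \<exists>y\<in>D (Suc 0) (Suc q). h 0 (Suc q) y = x"
    and row: "\<And>p q x. x \<in> D (Suc p) (Suc q) \<Longrightarrow> h p (Suc q) x = 0 \<Longrightarrow>
                \<exists>y\<in>D (Suc (Suc p)) (Suc q). h (Suc p) (Suc q) y = x"
    and col0: "\<And>p x. x \<in> D (Suc p) 0 \<Longrightarrow> \<exists>y\<in>D (Suc p) (Suc 0). v (Suc p) 0 y = x"
    and col: "\<And>p q x. x \<in> D (Suc p) (Suc q) \<Longrightarrow> v (Suc p) q x = 0 \<Longrightarrow>
                \<exists>y\<in>D (Suc p) (Suc (Suc q)). v (Suc p) (Suc q) y = x"
    and acyclic: "\<And>x. x \<in> D (Suc r) 0 \<Longrightarrow> h r 0 x = 0 \<Longrightarrow> \<exists>y\<in>D (Suc (Suc r)) 0. h (Suc r) 0 y = x"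
    and x: "x \<in> D 0 (Suc r)" "v 0 r x = 0"
  shows "\<exists>y\<in>D 0 (Suc (Suc r)). v 0 (Suc r) y = x"
proof -
  \<comment> \<open>Descend along the antidiagonal from column \<open>1\<close> to row \<open>1\<close>. At its end (\<open>m = 0\<close>) the exactness of row \<open>0\<close> is
      used.\<close>
  have S: "\<exists>y\<in>D (Suc (Suc k)) (Suc m). \<exists>z\<in>D (Suc k) (Suc (Suc m)).
             x = h (Suc k) (Suc m) y + v (Suc k) (Suc m) z"
    if "k + m = r" "x \<in> D (Suc k) (Suc m)" "h k m (v (Suc k) m x) = 0" for k m x
    using that
  proof (induction m arbitrary: k x)
    case 0
    then have k: "k = r" by simp
    obtain y0 where y0: "y0 \<in> D (Suc (Suc k)) 0" "h (Suc k) 0 y0 = v (Suc k) 0 x"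
      using acyclic[of "v (Suc k) 0 x"] vD[OF 0(2)] 0(3) unfolding k by blast
    obtain y where y: "y \<in> D (Suc (Suc k)) (Suc 0)" "v (Suc (Suc k)) 0 y = y0"
      using col0[OF y0(1)] by blast
    have hy: "h (Suc k) (Suc 0) y \<in> D (Suc k) (Suc 0)" by (rule hD[OF y(1)])
    have "v (Suc k) 0 (x - h (Suc k) (Suc 0) y) = v (Suc k) 0 x - h (Suc k) 0 y0"
      using comm[OF y(1)] y(2) by (simp add: vdiff)
    also have "\<dots> = 0" using y0(2) by simp
    finally obtain z where "z \<in> D (Suc k) (Suc (Suc 0))" "v (Suc k) (Suc 0) z = x - h (Suc k) (Suc 0) y"
      using col[OF Ddiff[OF 0(2) hy]] by blast
    then show ?case using y(1) by (metis add.commute diff_add_cancel)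
  next
    case (Suc m)
    obtain x' where x': "x' \<in> D (Suc (Suc k)) (Suc m)" "h (Suc k) (Suc m) x' = v (Suc k) (Suc m) x"
      using row[OF vD[OF Suc.prems(2)] Suc.prems(3)] by blast
    have "h (Suc k) m (v (Suc (Suc k)) m x') = v (Suc k) m (v (Suc k) (Suc m) x)"
      using comm[OF x'(1)] x'(2) by simp
    also have "\<dots> = 0" by (rule vv[OF Suc.prems(2)])
    finally obtain y' z' where yz: "y' \<in> D (Suc (Suc (Suc k))) (Suc m)" "z' \<in> D (Suc (Suc k)) (Suc (Suc m))"
      "x' = h (Suc (Suc k)) (Suc m) y' + v (Suc (Suc k)) (Suc m) z'"
      using Suc.IH[of "Suc k" x'] Suc.prems(1) x'(1) by auto
    have hadd: "h p q (a + b) = h p q a + h p q b" for p q a b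
      using hdiff[of p q "a + b" b] by (simp add: algebra_simps)
    have "v (Suc k) (Suc m) x = h (Suc k) (Suc m) (v (Suc (Suc k)) (Suc m) z')"
      using x'(2) hh[OF yz(1)] unfolding yz(3) hadd by simp
    also have "\<dots> = v (Suc k) (Suc m) (h (Suc k) (Suc (Suc m)) z')" by (rule comm[OF yz(2)])
    finally have "v (Suc k) (Suc m) (x - h (Suc k) (Suc (Suc m)) z') = 0" by (simp add: vdiff)
    then obtain z where "z \<in> D (Suc k) (Suc (Suc (Suc m)))"
      "v (Suc k) (Suc (Suc m)) z = x - h (Suc k) (Suc (Suc m)) z'"
      using col[OF Ddiff[OF Suc.prems(2) hD[OF yz(2)]]] by blast
    then show ?case using yz(2) by (metis add.commute diff_add_cancel)
  qed
  \<comment> \<open>The cycle \<open>x\<close> of column \<open>0\<close> is lifted to column \<open>1\<close>, where the lift can be split.\<close>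
  obtain x1 where x1: "x1 \<in> D (Suc 0) (Suc r)" "h 0 (Suc r) x1 = x" using row0[OF x(1)] by blast
  have "h 0 r (v (Suc 0) r x1) = 0" using comm[OF x1(1)] x1(2) x(2) by simp
  from S[OF _ x1(1) this] obtain y z where yz: "y \<in> D (Suc (Suc 0)) (Suc r)" "z \<in> D (Suc 0) (Suc (Suc r))"
    "x1 = h (Suc 0) (Suc r) y + v (Suc 0) (Suc r) z" by auto
  have "x = h 0 (Suc r) (v (Suc 0) (Suc r) z)"
    using x1(2) yz(3) hh[OF yz(1)] hdiff[of 0 "Suc r" x1 "h (Suc 0) (Suc r) y"] by simp
  also have "\<dots> = v 0 (Suc r) (h 0 (Suc (Suc r)) z)" by (rule comm[OF yz(2)])
  finally show ?thesis using hD[OF yz(2)] by blast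
qed

section \<open>Homogeneous components\<close>

definition hom_part :: "int \<Rightarrow> 'k::field mpoly \<Rightarrow> 'k mpoly" where
  "hom_part e p = Abs_poly_mapping (\<lambda>m. if int (mon_deg m) = e then lk p m else 0)"

lemma lookup_hom_part: "lk (hom_part e p) m = (if int (mon_deg m) = e then lk p m else 0)"
proof -
  have "finite {m. (if int (mon_deg m) = e then lk p m else 0) \<noteq> 0}"
    by (rule finite_subset[of _ "Poly_Mapping.keys p"]) (auto simp: in_keys_iff)
  then show ?thesis by (simp add: hom_part_def)
qed

lemma hom_part_zero [simp]: "hom_part e 0 = 0"
  by (rule poly_mapping_eqI) (simp add: lookup_hom_part)

lemma hom_part_sum: "hom_part e (\<Sum>i\<in>S. f i) = (\<Sum>i\<in>S. hom_part e (f i))"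
  by (rule poly_mapping_eqI) (auto simp: lookup_hom_part lookup_sum)

lemma hom_part_homogeneous: "homogeneous e (hom_part e p)"
  by (auto simp: homogeneous_def in_keys_iff lookup_hom_part split: if_splits)

lemma hom_part_id: "homogeneous e p \<Longrightarrow> hom_part e p = p"
  by (rule poly_mapping_eqI) (auto simp: lookup_hom_part homogeneous_def in_keys_iff)

lemma keys_hom_part: "Poly_Mapping.keys (hom_part e p) \<subseteq> Poly_Mapping.keys p"
  by (auto simp: in_keys_iff lookup_hom_part split: if_splits)

lemma hom_part_mult:
  assumes "homogeneous d a"
  shows "hom_part e (a * p) = a * hom_part (e - d) (p :: 'k::field mpoly)"
proof -
  have single: "hom_part e (Poly_Mapping.single m c * p) = Poly_Mapping.single m c * hom_part (e - int (mon_deg m)) p"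
    for m and c :: 'k
  proof (rule poly_mapping_eqI)
    fix k
    show "lk (hom_part e (Poly_Mapping.single m c * p)) k
        = lk (Poly_Mapping.single m c * hom_part (e - int (mon_deg m)) p) k"
      using mon_deg_minus[of m k] by (auto simp: lookup_hom_part lookup_single_mult)
  qed
  have eq: "a * q = (\<Sum>m\<in>Poly_Mapping.keys a. Poly_Mapping.single m (lk a m) * q)" for q :: "'k mpoly"
    using poly_sum_terms[of a] by (metis sum_distrib_right)
  have "hom_part e (a * p) = (\<Sum>m\<in>Poly_Mapping.keys a. hom_part e (Poly_Mapping.single m (lk a m) * p))"
    by (simp only: eq hom_part_sum)
  also have "\<dots> = (\<Sum>m\<in>Poly_Mapping.keys a. Poly_Mapping.single m (lk a m) * hom_part (e - d) p)"
    by (rule sum.cong) (use assms in \<open>auto simp: single homogeneous_def\<close>)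
  also have "\<dots> = a * hom_part (e - d) p" by (simp only: eq[symmetric])
  finally show ?thesis .
qed

lemma homogeneous_zero [simp]: "homogeneous e 0" by (simp add: homogeneous_def)

definition hom_part_vec :: "'k::field free_complex \<Rightarrow> nat \<Rightarrow> int \<Rightarrow> (nat \<Rightarrow> 'k mpoly) \<Rightarrow> nat \<Rightarrow> 'k mpoly" where
  "hom_part_vec F q e f b = hom_part (e - fdeg F q b) (f b)"

lemma hom_part_vec_free_module: "f \<in> free_module n r \<Longrightarrow> hom_part_vec F q e f \<in> free_module n r"
  using subset_trans[OF keys_hom_part] by (simp add: free_module_def hom_part_vec_def polyring_def) blast

text \<open>The augmentation is homogeneous, so the coefficients of an arbitrary preimage may be replaced by their
  components in the degrees prescribed by \<open>y\<close>.\<close>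

lemma lift_augmentation:
  assumes F: "graded_free_resolution n F I" and y: "y \<in> I" "homogeneous e y"
  obtains f where "f \<in> free_module n (frank F 0)" "\<And>b. homogeneous (e - fdeg F 0 b) (f b)" "faugment F f = y"
proof -
  have "faugment F ` free_module n (frank F 0) = I" using F by (simp add: graded_free_resolution_def)
  then obtain f where f: "f \<in> free_module n (frank F 0)" "faugment F f = y" using y(1) by blast
  have "faugment F (hom_part_vec F 0 e f) = hom_part e (faugment F f)"
    unfolding faugment_def hom_part_sum
  proof (rule sum.cong[OF refl])
    fix b assume "b \<in> {..<frank F 0}"
    then have "homogeneous (fdeg F 0 b) (faug F b)" using F by (simp add: graded_free_resolution_def)
    then show "faug F b * hom_part_vec F 0 e f b = hom_part e (faug F b * f b)"
      by (simp add: hom_part_mult hom_part_vec_def)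
  qed
  then have "faugment F (hom_part_vec F 0 e f) = y" using f(2) hom_part_id[OF y(2)] by simp
  then show thesis
    by (intro that[of "hom_part_vec F 0 e f"] hom_part_vec_free_module f(1)) (simp_all add: hom_part_vec_def hom_part_homogeneous)
qed

text \<open>The differentials are homogeneous as well, and the same replacement works.\<close>

lemma lift_differential:
  assumes F: "graded_free_resolution n F I"
    and y: "y \<in> fdiff F q ` free_module n (frank F (Suc q))" "\<And>a. homogeneous (e - fdeg F q a) (y a)"
  obtains f where "f \<in> free_module n (frank F (Suc q))" "\<And>b. homogeneous (e - fdeg F (Suc q) b) (f b)"
    "fdiff F q f = y"
proof -
  obtain f where f: "f \<in> free_module n (frank F (Suc q))" "y = fdiff F q f" using y(1) by blast
  have "fdiff F q (hom_part_vec F (Suc q) e f) a = y a" for a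
  proof (cases "a < frank F q")
    case True
    have "(\<Sum>b<frank F (Suc q). fmat F q a b * hom_part_vec F (Suc q) e f b)
        = hom_part (e - fdeg F q a) (\<Sum>b<frank F (Suc q). fmat F q a b * f b)"
      unfolding hom_part_sum
    proof (rule sum.cong[OF refl])
      fix b assume "b \<in> {..<frank F (Suc q)}"
      then have "homogeneous (fdeg F (Suc q) b - fdeg F q a) (fmat F q a b)"
        using F True by (simp add: graded_free_resolution_def)
      from hom_part_mult[OF this, of "e - fdeg F q a" "f b"]
      show "fmat F q a b * hom_part_vec F (Suc q) e f b = hom_part (e - fdeg F q a) (fmat F q a b * f b)"
        by (simp add: hom_part_vec_def)
    qed
    also have "(\<Sum>b<frank F (Suc q). fmat F q a b * f b) = y a"
      using True f(2) by (simp add: fdiff_def mat_app_def)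
    finally show ?thesis using True hom_part_id[OF y(2)] by (simp add: fdiff_def mat_app_def)
  next
    case False
    then show ?thesis by (simp add: f(2) fdiff_def mat_app_def)
  qed
  then have "fdiff F q (hom_part_vec F (Suc q) e f) = y" by (rule ext)
  then show thesis
    by (intro that[of "hom_part_vec F (Suc q) e f"] hom_part_vec_free_module f(1)) (simp_all add: hom_part_vec_def hom_part_homogeneous)
qed

text \<open>The constant term is a ring homomorphism, namely reduction modulo the variables.\<close>

lemma lookup_mult_zero: "lk (a * b) 0 = lk a 0 * lk (b :: 'k::field mpoly) 0"
proof -
  have m0: "mdvd m 0 \<longleftrightarrow> m = 0" for m by (auto intro: mdvd_antisym)
  have "lk (a * b) 0 = (\<Sum>m\<in>Poly_Mapping.keys a. lk (Poly_Mapping.single m (lk a m) * b) 0)"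
    using poly_sum_terms[of a] by (metis (no_types, lifting) lookup_sum sum.cong sum_distrib_right)
  also have "\<dots> = (\<Sum>m\<in>Poly_Mapping.keys a. if m = 0 then lk a 0 * lk b 0 else 0)"
    by (rule sum.cong) (simp_all add: lookup_single_mult m0)
  also have "\<dots> = lk a 0 * lk b 0" by (simp add: in_keys_iff)
  finally show ?thesis .
qed

section \<open>The double complex of a resolution and the Koszul complex\<close>

text \<open>Elements of the tensor product of the Koszul complex with a free module: \<open>f G b\<close> is the coefficient of
  \<open>e\<^sub>G \<otimes> e\<^sub>b\<close>.\<close>

type_synonym 'k darray = "nat set \<Rightarrow> nat \<Rightarrow> 'k mpoly"

definition cells :: "nat \<Rightarrow> nat \<Rightarrow> nat set set" where
  "cells n p = {G. G \<subseteq> {1..n} \<and> card G = p}"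

text \<open>Arrays supported on \<open>C\<close> and \<open>B\<close>. The set \<open>A\<close> of admitted monomials selects the coefficients: all monomials
  for \<open>S\<close>, the monomials in \<open>I\<close> for \<open>I\<close>, and \<open>{0}\<close> for \<open>K\<close>.\<close>

definition arrays :: "nat set set \<Rightarrow> nat set \<Rightarrow> mon set \<Rightarrow> (nat \<Rightarrow> int) \<Rightarrow> 'k::field darray set" where
  "arrays C B A e = {f. \<forall>G b. Poly_Mapping.keys (f G b) \<subseteq> A \<and> homogeneous (e b) (f G b) \<and>
     (f G b \<noteq> 0 \<longrightarrow> G \<in> C \<and> b \<in> B)}"

text \<open>The part of internal degree \<open>j\<close> of the double complex formed by the Koszul complex (first index) and the
  resolution \<open>F\<close> (second index), both shifted by one. Index \<open>0\<close> stands for the augmented modules: \<open>(p + 1, 0)\<close>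
  is the Koszul complex with coefficients in the ideal with monomials \<open>P\<close>, and \<open>(0, q + 1)\<close> is \<open>F\<^sub>q \<otimes> K\<close>.\<close>

fun dbl :: "nat \<Rightarrow> 'k::field free_complex \<Rightarrow> mon set \<Rightarrow> int \<Rightarrow> nat \<Rightarrow> nat \<Rightarrow> 'k darray set" where
  "dbl n F P j 0 0 = {0}"
| "dbl n F P j 0 (Suc q) = arrays {{}} {..<frank F q} {0} (\<lambda>b. j - fdeg F q b)"
| "dbl n F P j (Suc p) 0 = arrays (cells n p) {0} P (\<lambda>b. j - int p)"
| "dbl n F P j (Suc p) (Suc q) =
     arrays (cells n p) {..<frank F q} (monomials n) (\<lambda>b. j - int p - fdeg F q b)"

definition cpart :: "'k::field mpoly \<Rightarrow> 'k mpoly" where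
  "cpart p = Poly_Mapping.single 0 (lk p 0)"

text \<open>The restriction to subsets of \<open>{1..n}\<close> makes the Koszul relation \<open>d d = 0\<close> an equation between functions on
  all sets.\<close>

definition dkoszul :: "nat \<Rightarrow> 'k::field darray \<Rightarrow> 'k darray" where
  "dkoszul n f = (\<lambda>G b. if G \<subseteq> {1..n} then koszul {1..n} (\<lambda>G. f G b) G else 0)"

fun hmap :: "nat \<Rightarrow> nat \<Rightarrow> nat \<Rightarrow> 'k::field darray \<Rightarrow> 'k darray" where
  "hmap n 0 0 f = 0"
| "hmap n 0 (Suc q) f = (\<lambda>G b. if G = {} then cpart (f {} b) else 0)"
| "hmap n (Suc p) q f = dkoszul n f"

fun vmap :: "'k::field free_complex \<Rightarrow> nat \<Rightarrow> nat \<Rightarrow> 'k darray \<Rightarrow> 'k darray" where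
  "vmap F 0 0 f = 0"
| "vmap F 0 (Suc q) f = (\<lambda>G b. if G = {} \<and> b < frank F q
      then \<Sum>b'<frank F (Suc q). cpart (fmat F q b b') * f {} b' else 0)"
| "vmap F (Suc p) 0 f = (\<lambda>G b. if b = 0 then faugment F (f G) else 0)"
| "vmap F (Suc p) (Suc q) f = (\<lambda>G. fdiff F q (f G))"

lemma cpart_zero [simp]: "cpart 0 = 0" by (simp add: cpart_def)
lemma cpart_diff: "cpart (a - b) = cpart a - cpart b" by (simp add: cpart_def lookup_minus single_diff)
lemma cpart_mult: "cpart (a * b) = cpart a * cpart b" by (simp add: cpart_def lookup_mult_zero mult_single)
lemma cpart_sum: "cpart (\<Sum>i\<in>S. f i) = (\<Sum>i\<in>S. cpart (f i))"
proof (induction S rule: infinite_finite_induct)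
  case (insert x S)
  then show ?case by (simp add: cpart_def lookup_add single_add)
qed simp_all
lemma cpart_id: "Poly_Mapping.keys p \<subseteq> {0} \<Longrightarrow> cpart p = p"
  by (rule poly_mapping_eqI) (auto simp: cpart_def lookup_single when_def in_keys_iff subset_iff)
lemma keys_cpart: "Poly_Mapping.keys (cpart p) \<subseteq> {0}" by (simp add: cpart_def)

lemma koszul_diff: "koszul N (\<lambda>G. f G - g G) F = koszul N f F - koszul N g F"
  by (simp add: koszul_def algebra_simps sum_subtractf)
lemma koszul_sum: "koszul N (\<lambda>G. \<Sum>b\<in>B. f b G) F = (\<Sum>b\<in>B. koszul N (f b) F)"
  unfolding koszul_def sum_distrib_left by (rule sum.swap)
lemma koszul_scale: "koszul N (\<lambda>G. a * f G) F = a * koszul N f F"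
  by (simp add: koszul_def sum_distrib_left mult.left_commute)
lemma koszul_zero [simp]: "koszul N (\<lambda>G. 0) F = 0"
  by (simp add: koszul_def)

text \<open>In each multidegree this is the vanishing of the iterated boundary.\<close>

lemma koszul_koszul:
  assumes "finite N" "finite F"
  shows "koszul N (\<lambda>G. if G \<subseteq> N then koszul N f G else 0) F = 0"
proof (cases "F \<subseteq> N")
  case True
  show ?thesis
  proof (rule mcomp_eqI[of "sqfree F"])
    fix M
    have "mcomp (sqfree F) M (koszul N (\<lambda>G. if G \<subseteq> N then koszul N f G else 0) F)
       = bdry N (\<lambda>G. mcomp (sqfree G) M (if G \<subseteq> N then koszul N f G else 0)) F"
      by (rule mcomp_koszul[OF assms(2)])
    also have "\<dots> = bdry N (bdry N (\<lambda>G. mcomp (sqfree G) M (f G))) F"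
      unfolding bdry_def[of _ _ F]
    proof (rule sum.cong[OF refl])
      fix s assume "s \<in> N - F"
      then have "insert s F \<subseteq> N" "finite (insert s F)" using True assms by auto
      then show "ksign s F * mcomp (sqfree (insert s F)) M (if insert s F \<subseteq> N then koszul N f (insert s F) else 0)
          = ksign s F * bdry N (\<lambda>G. mcomp (sqfree G) M (f G)) (insert s F)"
        by (simp add: mcomp_koszul)
    qed
    also have "\<dots> = 0" by (rule bdry_bdry[OF assms])
    finally show "mcomp (sqfree F) M (koszul N (\<lambda>G. if G \<subseteq> N then koszul N f G else 0) F) = mcomp (sqfree F) M 0" by simp
  qed
next
  case False
  then show ?thesis unfolding koszul_def by (intro sum.neutral) auto
qed

text \<open>All entries of the first Koszul differential are variables.\<close>

lemma cpart_koszul_empty: "cpart (koszul N f {} :: 'k::field mpoly) = 0"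
proof -
  have "lk (Poly_Mapping.single (Poly_Mapping.single s 1) c * p) 0 = 0" for s :: nat and c :: 'k and p :: "'k mpoly"
  proof -
    have "\<not> mdvd (Poly_Mapping.single s 1) 0" unfolding mdvd_def by (auto intro!: exI[of _ s])
    then show ?thesis by (simp add: lookup_single_mult)
  qed
  then show ?thesis by (simp add: cpart_def koszul_def lookup_sum)
qed

lemma fdiff_diff: "fdiff F q (\<lambda>b. f b - g b) = (\<lambda>a. fdiff F q f a - fdiff F q g a)"
  by (auto simp: fdiff_def mat_app_def algebra_simps sum_subtractf)
lemma faugment_diff: "faugment F (\<lambda>b. f b - g b) = faugment F f - faugment F g"
  by (simp add: faugment_def algebra_simps sum_subtractf)

lemma fdiff_koszul: "fdiff F q (\<lambda>b. koszul N (\<lambda>G. f G b) G) a = koszul N (\<lambda>G. fdiff F q (f G) a) G"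
  by (simp add: fdiff_def mat_app_def koszul_sum koszul_scale)
lemma faugment_koszul: "faugment F (\<lambda>b. koszul N (\<lambda>G. f G b) G) = koszul N (\<lambda>G. faugment F (f G)) G"
  by (simp add: faugment_def koszul_sum koszul_scale)

lemma fdiff_zero [simp]: "fdiff F q (\<lambda>b. 0) = (\<lambda>a. 0)"
  by (auto simp: fdiff_def mat_app_def)
lemma faugment_zero [simp]: "faugment F (\<lambda>b. 0) = 0"
  by (simp add: faugment_def)

lemma homogeneous_diff:
  "homogeneous e a \<Longrightarrow> homogeneous e b \<Longrightarrow> homogeneous e (a - b)"
  by (auto simp: homogeneous_def in_keys_iff lookup_minus)
lemma homogeneous_sum:
  "(\<And>i. i \<in> S \<Longrightarrow> homogeneous e (f i)) \<Longrightarrow> homogeneous e (\<Sum>i\<in>S. f i)"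
  using Poly_Mapping.keys_sum[of f S] unfolding homogeneous_def by blast
lemma homogeneous_mult:
  assumes "homogeneous d a" "homogeneous e b"
  shows "homogeneous (d + e) (a * (b :: 'k::field mpoly))"
proof -
  have "hom_part (d + e) (a * b) = a * b" using hom_part_mult[OF assms(1), of "d + e" b] hom_part_id[OF assms(2)] by simp
  then show ?thesis using hom_part_homogeneous by metis
qed

lemma free_module_bound:
  assumes "f \<in> free_module n r" "f b \<noteq> 0"
  shows "b < r"
proof (rule ccontr)
  assume "\<not> b < r"
  then have "f b = 0" using assms(1) by (simp add: free_module_def)
  then show False using assms(2) by simp
qed

text \<open>If \<open>g\<close> has only multidegrees that occur in \<open>f\<close>, its total degree is the one of \<open>f\<close>.\<close>

lemma homogeneous_transfer:
  assumes "\<And>G m. m \<in> Poly_Mapping.keys (g G) \<Longrightarrow> \<exists>G' m'. m' \<in> Poly_Mapping.keys (f G') \<and> m + sqfree G = m' + sqfree G'"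
    and "\<And>G. f G \<noteq> 0 \<Longrightarrow> G \<subseteq> {1..n} \<and> card G = p \<and> homogeneous (e - int p) (f G)"
    and "\<And>G. g G \<noteq> 0 \<Longrightarrow> G \<subseteq> {1..n} \<and> card G = Suc p"
  shows "homogeneous (e - int (Suc p)) (g G :: 'k::field mpoly)"
  unfolding homogeneous_def
proof
  fix m assume m: "m \<in> Poly_Mapping.keys (g G)"
  then have "g G \<noteq> 0" by auto
  then have G: "G \<subseteq> {1..n}" "card G = Suc p" using assms(3) by blast+
  obtain G' m' where m': "m' \<in> Poly_Mapping.keys (f G')" "m + sqfree G = m' + sqfree G'" using assms(1)[OF m] by blast
  then have "f G' \<noteq> 0" by auto
  then have G': "G' \<subseteq> {1..n}" "card G' = p" "homogeneous (e - int p) (f G')" using assms(2) by blast+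
  have "finite G" "finite G'" using G(1) G'(1) finite_subset by blast+
  then have "mon_deg m + Suc p = mon_deg m' + p"
    using arg_cong[OF m'(2), of mon_deg] G(2) G'(2) by (simp add: mon_deg_sqfree)
  moreover have "int (mon_deg m') = e - int p" using G'(3) m'(1) by (simp add: homogeneous_def)
  ultimately show "int (mon_deg m) = e - int (Suc p)" by simp
qed

lemma arraysI:
  assumes "\<And>G b. Poly_Mapping.keys (f G b) \<subseteq> A" "\<And>G b. homogeneous (e b) (f G b)"
    and "\<And>G b. f G b \<noteq> 0 \<Longrightarrow> G \<in> C \<and> b \<in> B"
  shows "f \<in> arrays C B A e"
  using assms by (simp add: arrays_def)

lemma arraysD:
  assumes "f \<in> arrays C B A e"
  shows "Poly_Mapping.keys (f G b) \<subseteq> A" "homogeneous (e b) (f G b)"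
    and "f G b \<noteq> 0 \<Longrightarrow> G \<in> C" "f G b \<noteq> 0 \<Longrightarrow> b \<in> B"
  using assms unfolding arrays_def by blast+

lemma keys_diff_sub:
  "Poly_Mapping.keys a \<subseteq> A \<Longrightarrow> Poly_Mapping.keys b \<subseteq> A \<Longrightarrow> Poly_Mapping.keys (a - b :: 'k::field mpoly) \<subseteq> A"
  by (auto simp: in_keys_iff lookup_minus subset_iff) metis

lemma keys_sum_sub:
  "(\<And>i. i \<in> S \<Longrightarrow> Poly_Mapping.keys (f i) \<subseteq> A) \<Longrightarrow> Poly_Mapping.keys (\<Sum>i\<in>S. f i :: 'k::field mpoly) \<subseteq> A"
  using Poly_Mapping.keys_sum[of f S] by blast

lemma arrays_diff:
  assumes "x \<in> arrays C B A e" "y \<in> arrays C B A e"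
  shows "x - y \<in> arrays C B A e"
proof (rule arraysI)
  fix G b
  show "Poly_Mapping.keys ((x - y) G b) \<subseteq> A"
    using keys_diff_sub[OF arraysD(1)[OF assms(1)] arraysD(1)[OF assms(2)], of G b G b] by simp
  show "homogeneous (e b) ((x - y) G b)"
    using homogeneous_diff[OF arraysD(2)[OF assms(1)] arraysD(2)[OF assms(2)], of b G G] by simp
  assume "(x - y) G b \<noteq> 0"
  then have "x G b \<noteq> 0 \<or> y G b \<noteq> 0" by auto
  then show "G \<in> C \<and> b \<in> B" using arraysD(3,4)[OF assms(1)] arraysD(3,4)[OF assms(2)] by blast
qed

lemma finite_cell: "G \<in> cells n p \<Longrightarrow> finite G"
  unfolding cells_def using finite_subset by blast

text \<open>The sets of monomials of monomial ideals in \<open>K[x\<^sub>1,\<dots>,x\<^sub>n]\<close>.\<close>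

definition upward :: "nat \<Rightarrow> mon set \<Rightarrow> bool" where
  "upward n A \<longleftrightarrow> A \<subseteq> monomials n \<and> (\<forall>a b. a \<in> A \<longrightarrow> mdvd a b \<longrightarrow> b \<in> monomials n \<longrightarrow> b \<in> A)"

lemma upward_monomials: "upward n (monomials n)" by (simp add: upward_def)

lemma keys_mult_upward:
  assumes "upward n A" "Poly_Mapping.keys a \<subseteq> monomials n" "Poly_Mapping.keys b \<subseteq> A"
  shows "Poly_Mapping.keys (a * b :: 'k::field mpoly) \<subseteq> A"
proof
  fix m assume "m \<in> Poly_Mapping.keys (a * b)"
  then obtain k l where kl: "m = k + l" "k \<in> Poly_Mapping.keys a" "l \<in> Poly_Mapping.keys b"
    using keys_mult[of a b] by blast
  then have "l \<in> A" "k \<in> monomials n" using assms by auto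
  then have "l \<in> A" "mdvd l m" "m \<in> monomials n" using assms(1) by (auto simp: kl(1) upward_def)
  then show "m \<in> A" using assms(1) unfolding upward_def by blast
qed

lemma dkoszul_arrays:
  fixes x :: "'k::field darray"
  assumes x: "x \<in> arrays (cells n (Suc p)) B A (\<lambda>b. e b - 1)" and A: "upward n A"
  shows "dkoszul n x \<in> arrays (cells n p) B A e"
proof (rule arraysI)
  fix G b
  show "Poly_Mapping.keys (dkoszul n x G b) \<subseteq> A"
  proof (cases "G \<subseteq> {1..n}")
    case True
    then show ?thesis unfolding dkoszul_def koszul_def if_P[OF True]
      by (intro keys_sum_sub keys_mult_upward[OF A] arraysD(1)[OF x]) (auto simp: monomials_def)
  qed (simp add: dkoszul_def)
  have "homogeneous (e b) (Poly_Mapping.single (Poly_Mapping.single s 1) (ksign s G) * x (insert s G) b)" for s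
  proof -
    have "homogeneous 1 (Poly_Mapping.single (Poly_Mapping.single s 1) (ksign s G :: 'k))"
      by (simp add: homogeneous_def mon_deg_def)
    from homogeneous_mult[OF this arraysD(2)[OF x, of b "insert s G"]] show ?thesis by simp
  qed
  then show "homogeneous (e b) (dkoszul n x G b)" by (auto simp: dkoszul_def koszul_def intro!: homogeneous_sum)
  assume "dkoszul n x G b \<noteq> 0"
  then have G: "G \<subseteq> {1..n}" and nz: "koszul {1..n} (\<lambda>G. x G b) G \<noteq> 0" by (simp_all add: dkoszul_def split: if_splits)
  from nz obtain s where s: "s \<in> {1..n} - G" "x (insert s G) b \<noteq> 0"
    unfolding koszul_def by (metis (no_types, lifting) mult_zero_right sum.not_neutral_contains_not_neutral)
  have "card (insert s G) = Suc p" "b \<in> B" using arraysD(3,4)[OF x s(2)] by (simp_all add: cells_def)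
  then show "G \<in> cells n p \<and> b \<in> B" using s(1) G finite_subset[OF G] by (simp add: cells_def)
qed

lemma dkoszul_zero_cells:
  assumes "x \<in> arrays (cells n 0) B A e"
  shows "dkoszul n x = 0"
proof (intro ext)
  fix G b
  have "x (insert s G) b = 0" for s
  proof (rule ccontr)
    assume "x (insert s G) b \<noteq> 0"
    then have c: "insert s G \<in> cells n 0" by (rule arraysD(3)[OF assms])
    show False using finite_cell[OF c] c by (simp add: cells_def)
  qed
  then show "dkoszul n x G b = 0 G b" by (simp add: dkoszul_def koszul_def)
qed

text \<open>Exactness in the multidegrees of degree \<open>e b + p\<close> suffices, because \<open>x G b\<close> has degree \<open>e b\<close> and \<open>x\<^sub>G\<close> has
  degree \<open>p\<close>.\<close>

lemma dkoszul_exact: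
  fixes x :: "'k::field darray"
  assumes x: "x \<in> arrays (cells n p) B A e" and closed: "dkoszul n x = 0" and A: "A \<subseteq> monomials n"
    and ex: "\<And>M G b. M \<in> monomials n \<Longrightarrow> int (mon_deg M) = e b + int p \<Longrightarrow> mcomp (sqfree G) M (x G b) \<noteq> 0 \<Longrightarrow>
        mexact n A M p TYPE('k)"
  shows "\<exists>y\<in>arrays (cells n (Suc p)) B A (\<lambda>b. e b - 1). dkoszul n y = x"
proof -
  have xn: "G \<subseteq> {1..n}" "card G = p" if "x G b \<noteq> 0" for G b
    using arraysD(3)[OF x that] by (simp_all add: cells_def)
  have "\<exists>g. pchain n A (Suc p) g \<and> (\<forall>G. G \<subseteq> {1..n} \<longrightarrow> koszul {1..n} g G = x G b) \<and>
     (\<forall>G. homogeneous (e b - 1) (g G))" for b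
  proof -
    have k: "pchain n A p (\<lambda>G. x G b)"
      unfolding pchain_def using xn arraysD(1)[OF x] by blast
    have "\<exists>g. pchain n A (Suc p) g \<and> (\<forall>G. G \<subseteq> {1..n} \<longrightarrow> koszul {1..n} g G = x G b) \<and>
      (\<forall>G m. m \<in> Poly_Mapping.keys (g G) \<longrightarrow>
         (\<exists>G' m'. m' \<in> Poly_Mapping.keys (x G' b) \<and> m + sqfree G = m' + sqfree G'))"
    proof (rule koszul_lift[OF k])
      show "koszul {1..n} (\<lambda>G. x G b) G = 0" if "G \<subseteq> {1..n}" for G
        using fun_cong[OF fun_cong[OF closed, of G], of b] that by (simp add: dkoszul_def)
    next
      fix M G assume nz: "mcomp (sqfree G) M (x G b) \<noteq> 0"
      then have "x G b \<noteq> 0" by auto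
      then have G: "G \<subseteq> {1..n}" "card G = p" by (rule xn)+
      have M: "mdvd (sqfree G) M" "M - sqfree G \<in> Poly_Mapping.keys (x G b)"
        using nz by (auto simp: mcomp_def in_keys_iff split: if_splits)
      have "M - sqfree G \<in> monomials n" using M(2) arraysD(1)[OF x, of G b] A by blast
      then have "M - sqfree G + sqfree G \<in> monomials n" using sqfree_monomials[OF G(1)] unfolding monomials_add by blast
      then have "M \<in> monomials n" using M(1) by (simp add: mdvd_minus_add)
      moreover have "int (mon_deg (M - sqfree G)) = e b" using arraysD(2)[OF x] M(2) unfolding homogeneous_def by blast
      then have "int (mon_deg M) = e b + int p"
        using mon_deg_minus[OF M(1)] G finite_subset[OF G(1)] by (simp add: mon_deg_sqfree)
      ultimately show "mexact n A M p TYPE('k)" using nz by (rule ex)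
    qed blast
    then obtain g where g: "pchain n A (Suc p) g" "\<And>G. G \<subseteq> {1..n} \<Longrightarrow> koszul {1..n} g G = x G b"
      "\<And>G m. m \<in> Poly_Mapping.keys (g G) \<Longrightarrow> \<exists>G' m'. m' \<in> Poly_Mapping.keys (x G' b) \<and> m + sqfree G = m' + sqfree G'"
      by blast
    have "homogeneous (e b + int p - int (Suc p)) (g G)" for G
    proof (rule homogeneous_transfer[OF g(3)])
      show "G \<subseteq> {1..n} \<and> card G = p \<and> homogeneous (e b + int p - int p) (x G b)" if "x G b \<noteq> 0" for G
        using xn[OF that] arraysD(2)[OF x] by simp
      show "G \<subseteq> {1..n} \<and> card G = Suc p" if "g G \<noteq> 0" for G using g(1) that unfolding pchain_def by blast
    qed
    then show ?thesis using g(1,2) by (intro exI[of _ g]) simp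
  qed
  then obtain g where g: "\<And>b. pchain n A (Suc p) (g b)"
    "\<And>b G. G \<subseteq> {1..n} \<Longrightarrow> koszul {1..n} (g b) G = x G b" "\<And>b G. homogeneous (e b - 1) (g b G)" by metis
  define y where "y G b = (if b \<in> B then g b G else 0)" for G b
  have "y \<in> arrays (cells n (Suc p)) B A (\<lambda>b. e b - 1)"
  proof (rule arraysI)
    fix G b
    have gA: "g b G \<noteq> 0 \<Longrightarrow> G \<subseteq> {1..n} \<and> card G = Suc p \<and> Poly_Mapping.keys (g b G) \<subseteq> A"
      using g(1)[of b] unfolding pchain_def by blast
    show "Poly_Mapping.keys (y G b) \<subseteq> A" using gA by (cases "g b G = 0") (simp_all add: y_def)
    show "homogeneous (e b - 1) (y G b)" using g(3) by (simp add: y_def)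
    assume "y G b \<noteq> 0"
    then show "G \<in> cells n (Suc p) \<and> b \<in> B" using gA by (auto simp: y_def cells_def split: if_splits)
  qed
  moreover have "dkoszul n y = x"
  proof (intro ext)
    fix G b
    show "dkoszul n y G b = x G b"
    proof (cases "b \<in> B \<and> G \<subseteq> {1..n}")
      case True
      then show ?thesis using g(2)[of G b] by (simp add: dkoszul_def y_def)
    next
      case False
      then have "x G b = 0" using arraysD(4)[OF x, of G b] xn(1)[of G b] by blast
      then show ?thesis using False by (auto simp: dkoszul_def y_def)
    qed
  qed
  ultimately show ?thesis by blast
qed

lemma hmap_diff: "hmap n p q (x - y) = hmap n p q x - (hmap n p q y :: 'k::field darray)"
  by (cases p; cases q) (auto simp: fun_eq_iff cpart_diff koszul_diff dkoszul_def)

lemma vmap_diff: "vmap F p q (x - y) = vmap F p q x - vmap F p q y"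
  by (cases p; cases q)
     (auto simp: fun_eq_iff faugment_diff fdiff_diff algebra_simps sum_subtractf fun_diff_def)

lemma hmap_hmap: "hmap n p q (hmap n (Suc p) q x) = (0 :: 'k::field darray)"
proof (cases p)
  case 0
  then show ?thesis by (cases q) (auto simp: fun_eq_iff cpart_koszul_empty dkoszul_def)
next
  case (Suc p')
  have "koszul {1..n} (\<lambda>G. if G \<subseteq> {1..n} then koszul {1..n} (\<lambda>G. x G b) G else 0) G = 0"
    if "G \<subseteq> {1..n}" for G b
    using that by (intro koszul_koszul) (auto intro: finite_subset)
  then show ?thesis using Suc by (auto simp: fun_eq_iff dkoszul_def)
qed

text \<open>The horizontal maps act on the first index of an array and the vertical maps on the second. No sign is
  needed for the diagram chase.\<close>

lemma hmap_vmap_commute: "hmap n p q (vmap F (Suc p) q x) = vmap F p q (hmap n p (Suc q) x)"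
proof -
  consider "p = 0" "q = 0" | q' where "p = 0" "q = Suc q'" | p' where "p = Suc p'" "q = 0"
    | p' q' where "p = Suc p'" "q = Suc q'" by (cases p; cases q) auto
  then show ?thesis
  proof cases
    case 2
    show ?thesis by (auto simp: 2 fun_eq_iff fdiff_def mat_app_def cpart_sum cpart_mult)
  next
    case 3
    show ?thesis by (auto simp: 3 fun_eq_iff faugment_koszul dkoszul_def)
  next
    case 4
    show ?thesis by (auto simp: 4 fun_eq_iff fdiff_koszul[symmetric] dkoszul_def)
  qed simp
qed

lemma carr_iff: "p \<in> carrier (polyring n) \<longleftrightarrow> Poly_Mapping.keys (p :: 'k::field mpoly) \<subseteq> monomials n"
  by (simp add: polyring_def)

context
  fixes n :: nat and F :: "'k::field free_complex" and I :: "'k mpoly set" and j :: int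
    and P :: "mon set"
  assumes F: "graded_free_resolution n F I"
    and I: "\<And>p :: 'k mpoly. p \<in> I \<longleftrightarrow> Poly_Mapping.keys p \<subseteq> P"
    and P: "upward n P"
begin

lemma fmat_mem:
  assumes "a < frank F i" "b < frank F (Suc i)"
  shows "Poly_Mapping.keys (fmat F i a b) \<subseteq> monomials n"
    "homogeneous (fdeg F (Suc i) b - fdeg F i a) (fmat F i a b)"
  using F assms by (simp_all add: graded_free_resolution_def carr_iff)

lemma faug_mem: "b < frank F 0 \<Longrightarrow> homogeneous (fdeg F 0 b) (faug F b)"
  using F by (simp add: graded_free_resolution_def)

lemma arrays_free_module:
  assumes "(f :: 'k darray) \<in> arrays C {..<frank F q} (monomials n) e"
  shows "f G \<in> free_module n (frank F q)"
proof -
  have "f G b = 0" if "frank F q \<le> b" for b using arraysD(4)[OF assms, of G b] that by fastforce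
  then show ?thesis using arraysD(1)[OF assms] by (simp add: free_module_def carr_iff)
qed

lemma arrays_outside:
  assumes "f \<in> arrays C B A e" "G \<notin> C"
  shows "f G = (\<lambda>b. 0)"
  by (rule ext) (use arraysD(3)[OF assms(1)] assms(2) in blast)

lemma free_module_arrays:
  fixes y :: "'k darray"
  assumes "\<And>G. y G \<in> free_module n (frank F q)" "\<And>G b. homogeneous (e b) (y G b)"
    and "\<And>G. G \<notin> C \<Longrightarrow> y G = (\<lambda>b. 0)"
  shows "y \<in> arrays C {..<frank F q} (monomials n) e"
proof (rule arraysI)
  fix G b
  have "y G b \<in> carrier (polyring n)"
    using assms(1)[of G] free_module_bound[OF assms(1), of G b] by (cases "y G b = 0") (simp_all add: free_module_def carr_iff)
  then show "Poly_Mapping.keys (y G b) \<subseteq> monomials n" by (simp add: carr_iff)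
  show "homogeneous (e b) (y G b)" by (rule assms(2))
  assume nz: "y G b \<noteq> 0"
  then have "G \<in> C" using assms(3)[of G] by (metis (full_types))
  then show "G \<in> C \<and> b \<in> {..<frank F q}" using free_module_bound[OF assms(1) nz] by simp
qed

lemma dbl_diff: "x \<in> dbl n F P j p q \<Longrightarrow> y \<in> dbl n F P j p q \<Longrightarrow> x - y \<in> dbl n F P j p q"
  by (cases p; cases q) (simp_all add: arrays_diff)

lemma hmap_mem:
  assumes x: "x \<in> dbl n F P j (Suc p) q"
  shows "hmap n p q x \<in> dbl n F P j p q"
proof -
  consider "p = 0" "q = 0" | q' where "p = 0" "q = Suc q'" | p' where "p = Suc p'" "q = 0"
    | p' q' where "p = Suc p'" "q = Suc q'" by (cases p; cases q) auto
  then show ?thesis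
  proof cases
    case 2
    have x': "x \<in> arrays (cells n 0) {..<frank F q'} (monomials n) (\<lambda>b. j - int 0 - fdeg F q' b)"
      using x 2 by simp
    show ?thesis unfolding 2 dbl.simps hmap.simps
    proof (rule arraysI)
      fix G b
      show "Poly_Mapping.keys (if G = {} then cpart (x {} b) else 0) \<subseteq> {0}"
        by (cases "G = {}") (simp_all only: if_True if_False simp_thms keys_cpart Poly_Mapping.keys_zero empty_subsetI)
      have "Poly_Mapping.keys (cpart (x {} b)) \<subseteq> Poly_Mapping.keys (x {} b)"
        by (auto simp: cpart_def in_keys_iff split: if_splits)
      then have "homogeneous (j - fdeg F q' b) (cpart (x {} b))"
        using arraysD(2)[OF x', of b "{}"] unfolding homogeneous_def by auto
      then show "homogeneous (j - fdeg F q' b) (if G = {} then cpart (x {} b) else 0)" by simp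
      assume "(if G = {} then cpart (x {} b) else 0) \<noteq> 0"
      then have "G = {}" "x {} b \<noteq> 0" by (auto split: if_splits)
      then show "G \<in> {{}} \<and> b \<in> {..<frank F q'}" using arraysD(4)[OF x'] by blast
    qed
  next
    case 3
    have eq: "(\<lambda>b. j - int (Suc p')) = (\<lambda>b::nat. j - int p' - 1)" by auto
    have "x \<in> arrays (cells n (Suc p')) {0} P (\<lambda>b. j - int p' - 1)" using x unfolding 3 dbl.simps eq .
    then show ?thesis unfolding 3 dbl.simps hmap.simps by (rule dkoszul_arrays[OF _ P])
  next
    case 4
    have eq: "(\<lambda>b. j - int (Suc p') - fdeg F q' b) = (\<lambda>b. j - int p' - fdeg F q' b - 1)" by auto
    have "x \<in> arrays (cells n (Suc p')) {..<frank F q'} (monomials n) (\<lambda>b. j - int p' - fdeg F q' b - 1)"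
      using x unfolding 4 dbl.simps eq .
    then show ?thesis unfolding 4 dbl.simps hmap.simps by (rule dkoszul_arrays[OF _ upward_monomials])
  qed simp
qed

lemma vmap_mem:
  assumes x: "x \<in> dbl n F P j p (Suc q)"
  shows "vmap F p q x \<in> dbl n F P j p q"
proof -
  consider "p = 0" "q = 0" | q' where "p = 0" "q = Suc q'" | p' where "p = Suc p'" "q = 0"
    | p' q' where "p = Suc p'" "q = Suc q'" by (cases p; cases q) auto
  then show ?thesis
  proof cases
    case 2
    have x': "x \<in> arrays {{}} {..<frank F (Suc q')} {0} (\<lambda>b. j - fdeg F (Suc q') b)" using x 2 by simp
    show ?thesis unfolding 2 dbl.simps vmap.simps
    proof (rule arraysI)
      fix G b
      let ?s = "if G = {} \<and> b < frank F q' then \<Sum>b'<frank F (Suc q'). cpart (fmat F q' b b') * x {} b' else 0"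
      have "Poly_Mapping.keys (cpart a * x {} b') \<subseteq> {0}" for a b'
      proof -
        have "cpart (x {} b') = x {} b'" by (rule cpart_id[OF arraysD(1)[OF x']])
        then have "cpart a * x {} b' = cpart (a * x {} b')" by (simp add: cpart_mult)
        then show ?thesis using keys_cpart by metis
      qed
      then show "Poly_Mapping.keys ?s \<subseteq> {0}" by (simp add: keys_sum_sub)
      have "homogeneous (j - fdeg F q' b) (cpart (fmat F q' b b') * x {} b')"
        if b: "b < frank F q'" "b' < frank F (Suc q')" for b'
      proof -
        have "Poly_Mapping.keys (cpart (fmat F q' b b')) \<subseteq> Poly_Mapping.keys (fmat F q' b b')"
          by (auto simp: cpart_def in_keys_iff split: if_splits)
        then have "homogeneous (fdeg F (Suc q') b' - fdeg F q' b) (cpart (fmat F q' b b'))"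
          using fmat_mem(2)[OF b] unfolding homogeneous_def by blast
        from homogeneous_mult[OF this arraysD(2)[OF x', of b' "{}"]] show ?thesis by (simp add: algebra_simps)
      qed
      then show "homogeneous (j - fdeg F q' b) ?s" by (auto intro!: homogeneous_sum)
    qed (auto split: if_splits)
  next
    case 3
    have x': "x \<in> arrays (cells n p') {..<frank F 0} (monomials n) (\<lambda>b. j - int p' - fdeg F 0 b)" using x 3 by simp
    show ?thesis unfolding 3 dbl.simps vmap.simps
    proof (rule arraysI)
      fix G and b :: nat
      have "faugment F (x G) \<in> I"
        using F arrays_free_module[OF x', of G] unfolding graded_free_resolution_def by blast
      then show "Poly_Mapping.keys (if b = 0 then faugment F (x G) else 0) \<subseteq> P" by (simp add: I)
      have "homogeneous (j - int p') (faugment F (x G))"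
        unfolding faugment_def
      proof (rule homogeneous_sum)
        fix b assume "b \<in> {..<frank F 0}"
        then have "homogeneous (fdeg F 0 b) (faug F b)" using faug_mem by simp
        from homogeneous_mult[OF this arraysD(2)[OF x', of b G]]
        show "homogeneous (j - int p') (faug F b * x G b)" by simp
      qed
      then show "homogeneous (j - int p') (if b = 0 then faugment F (x G) else 0)" by simp
      assume "(if b = 0 then faugment F (x G) else 0) \<noteq> 0"
      then show "G \<in> cells n p' \<and> b \<in> {0}" using arrays_outside[OF x', of G] by (metis faugment_zero insertI1)
    qed
  next
    case 4
    have x': "x \<in> arrays (cells n p') {..<frank F (Suc q')} (monomials n) (\<lambda>b. j - int p' - fdeg F (Suc q') b)"
      using x 4 by simp
    have eq: "fdiff F q' (x G) b = (if b < frank F q' then \<Sum>b'<frank F (Suc q'). fmat F q' b b' * x G b' else 0)"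
      for G b by (simp add: fdiff_def mat_app_def)
    show ?thesis unfolding 4 dbl.simps vmap.simps
    proof (rule arraysI)
      fix G b
      show "Poly_Mapping.keys (fdiff F q' (x G) b) \<subseteq> monomials n"
      proof (cases "b < frank F q'")
        case True
        then show ?thesis unfolding eq if_P[OF True]
          by (intro keys_sum_sub keys_mult_upward[OF upward_monomials fmat_mem(1) arraysD(1)[OF x']]) simp_all
      qed (simp add: eq)
      have "homogeneous (j - int p' - fdeg F q' b) (fmat F q' b b' * x G b')"
        if "b < frank F q'" "b' < frank F (Suc q')" for b'
        using homogeneous_mult[OF fmat_mem(2)[OF that] arraysD(2)[OF x', of b' G]] by (simp add: algebra_simps)
      then show "homogeneous (j - int p' - fdeg F q' b) (fdiff F q' (x G) b)"
        unfolding eq by (auto intro!: homogeneous_sum)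
      assume nz: "fdiff F q' (x G) b \<noteq> 0"
      then have "G \<in> cells n p'" using arrays_outside[OF x', of G] by (metis fdiff_zero)
      then show "G \<in> cells n p' \<and> b \<in> {..<frank F q'}" using nz unfolding eq by (simp split: if_splits)
    qed
  qed simp
qed

text \<open>A constant array is its own preimage.\<close>

lemma row0_exact:
  assumes "x \<in> dbl n F P j 0 (Suc q)"
  shows "\<exists>y\<in>dbl n F P j (Suc 0) (Suc q). hmap n 0 (Suc q) y = x"
proof (intro bexI[of _ x])
  have x: "x \<in> arrays {{}} {..<frank F q} {0} (\<lambda>b. j - fdeg F q b)" using assms by simp
  show "hmap n 0 (Suc q) x = x"
  proof (intro ext)
    fix G b
    have "cpart (x {} b) = x {} b" by (rule cpart_id[OF arraysD(1)[OF x]])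
    moreover have "x G b = 0" if "G \<noteq> {}" using arraysD(3)[OF x, of G b] that by blast
    ultimately show "hmap n 0 (Suc q) x G b = x G b" by auto
  qed
  show "x \<in> dbl n F P j (Suc 0) (Suc q)"
    unfolding dbl.simps
  proof (rule arraysI)
    fix G b
    show "Poly_Mapping.keys (x G b) \<subseteq> monomials n" using arraysD(1)[OF x] by (rule subset_trans) simp
    show "homogeneous (j - int 0 - fdeg F q b) (x G b)" using arraysD(2)[OF x] by simp
    show "G \<in> cells n 0 \<and> b \<in> {..<frank F q}" if "x G b \<noteq> 0"
      using arraysD(3,4)[OF x that] by (simp add: cells_def)
  qed
qed

text \<open>The Koszul complex of \<open>S\<close> is exact except in multidegree \<open>0\<close>. Only the constant terms at \<open>G = {}\<close> live
  there, and the assumption says that they vanish.\<close>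

lemma row_exact:
  assumes x: "x \<in> dbl n F P j (Suc p) (Suc q)" and hx: "hmap n p (Suc q) x = 0"
  shows "\<exists>y\<in>dbl n F P j (Suc (Suc p)) (Suc q). hmap n (Suc p) (Suc q) y = x"
proof -
  have x': "x \<in> arrays (cells n p) {..<frank F q} (monomials n) (\<lambda>b. j - int p - fdeg F q b)" using x by simp
  have "\<exists>y\<in>arrays (cells n (Suc p)) {..<frank F q} (monomials n) (\<lambda>b. j - int p - fdeg F q b - 1). dkoszul n y = x"
  proof (rule dkoszul_exact[OF x' _ order_refl])
    show "dkoszul n x = 0" using hx dkoszul_zero_cells[of x n] x' by (cases p) auto
  next
    fix M G b assume M: "M \<in> monomials n" and nz: "mcomp (sqfree G) M (x G b) \<noteq> 0"
    have "M \<noteq> 0"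
    proof
      assume M0: "M = 0"
      have "x G b \<noteq> 0" using nz by auto
      then have G: "G \<in> cells n p" using arraysD(3)[OF x'] by blast
      have "mdvd (sqfree G) M" using nz by (auto simp: mcomp_def split: if_splits)
      then have "G = {}" using M0 finite_cell[OF G] by (simp add: mdvd_sqfree)
      then have "p = 0" using G by (simp add: cells_def)
      then have "hmap n 0 (Suc q) x {} b = 0" using hx by simp
      then have "lk (x {} b) 0 = 0" by (simp add: cpart_def) (metis lookup_single_eq lookup_zero)
      then show False using nz M0 \<open>G = {}\<close> by (simp add: mcomp_def)
    qed
    then show "mexact n (monomials n) M p TYPE('k)" by (rule mexact_all_monomials[OF M])
  qed
  moreover have "(\<lambda>b. j - int p - fdeg F q b - 1) = (\<lambda>b. j - int (Suc p) - fdeg F q b)" by auto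
  ultimately show ?thesis by simp
qed

text \<open>For each \<open>G\<close> separately, the augmentation \<open>F\<^sub>0 \<rightarrow> I\<close> is onto, also in each degree.\<close>

lemma col0_exact:
  assumes x: "x \<in> dbl n F P j (Suc p) 0"
  shows "\<exists>y\<in>dbl n F P j (Suc p) (Suc 0). vmap F (Suc p) 0 y = x"
proof -
  have x': "x \<in> arrays (cells n p) {0} P (\<lambda>b. j - int p)" using x by simp
  have "\<exists>f. f \<in> free_module n (frank F 0) \<and> (\<forall>b. homogeneous (j - int p - fdeg F 0 b) (f b)) \<and>
      faugment F f = x G 0 \<and> (G \<notin> cells n p \<longrightarrow> f = (\<lambda>b. 0))" for G
  proof (cases "G \<in> cells n p")
    case False
    then show ?thesis using arrays_outside[OF x' False]
      by (intro exI[of _ "\<lambda>b. 0"]) (simp add: free_module_def carr_iff)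
  next
    case True
    have "x G 0 \<in> I" using arraysD(1)[OF x'] by (simp add: I)
    then show ?thesis using lift_augmentation[OF F _ arraysD(2)[OF x']] True by metis
  qed
  then obtain y where y: "\<And>G. y G \<in> free_module n (frank F 0)"
    "\<And>G b. homogeneous (j - int p - fdeg F 0 b) (y G b)" "\<And>G. faugment F (y G) = x G 0"
    "\<And>G. G \<notin> cells n p \<Longrightarrow> y G = (\<lambda>b. 0)" by metis
  have "y \<in> dbl n F P j (Suc p) (Suc 0)"
    unfolding dbl.simps by (rule free_module_arrays[OF y(1,2,4)])
  moreover have "vmap F (Suc p) 0 y G b = x G b" for G b
    using y(3)[of G] arraysD(4)[OF x', of G b] by (cases "b = 0") auto
  then have "vmap F (Suc p) 0 y = x" by (intro ext)
  ultimately show ?thesis by blast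
qed

text \<open>For each \<open>G\<close> separately, this is exactness of the resolution, with preimages of the right degree.\<close>

lemma col_exact:
  assumes x: "x \<in> dbl n F P j (Suc p) (Suc q)" and vx: "vmap F (Suc p) q x = 0"
  shows "\<exists>y\<in>dbl n F P j (Suc p) (Suc (Suc q)). vmap F (Suc p) (Suc q) y = x"
proof -
  have x': "x \<in> arrays (cells n p) {..<frank F q} (monomials n) (\<lambda>b. j - int p - fdeg F q b)" using x by simp
  have im: "x G \<in> fdiff F q ` free_module n (frank F (Suc q))" for G
  proof (cases q)
    case 0
    have "faugment F (x G) = 0" using arg_cong[OF vx, of "\<lambda>f. f G 0"] 0 by simp
    then show ?thesis using F arrays_free_module[OF x', of G] unfolding graded_free_resolution_def 0 by blast
  next
    case (Suc q')
    have "fdiff F q' (x G) = 0" using arg_cong[OF vx, of "\<lambda>f. f G"] Suc by simp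
    then show ?thesis using F arrays_free_module[OF x', of G] unfolding graded_free_resolution_def Suc by blast
  qed
  have "\<exists>f. f \<in> free_module n (frank F (Suc q)) \<and> (\<forall>b. homogeneous (j - int p - fdeg F (Suc q) b) (f b)) \<and>
      fdiff F q f = x G \<and> (G \<notin> cells n p \<longrightarrow> f = (\<lambda>b. 0))" for G
  proof (cases "G \<in> cells n p")
    case False
    then show ?thesis using arrays_outside[OF x' False]
      by (intro exI[of _ "\<lambda>b. 0"]) (simp add: free_module_def carr_iff)
  next
    case True
    then show ?thesis using lift_differential[OF F im arraysD(2)[OF x']] by metis
  qed
  then obtain y where y: "\<And>G. y G \<in> free_module n (frank F (Suc q))"
    "\<And>G b. homogeneous (j - int p - fdeg F (Suc q) b) (y G b)" "\<And>G. fdiff F q (y G) = x G"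
    "\<And>G. G \<notin> cells n p \<Longrightarrow> y G = (\<lambda>b. 0)" by metis
  have "y \<in> dbl n F P j (Suc p) (Suc (Suc q))"
    unfolding dbl.simps by (rule free_module_arrays[OF y(1,2,4)])
  moreover have "vmap F (Suc p) (Suc q) y = x" using y(3) by (intro ext) simp
  ultimately show ?thesis by blast
qed

text \<open>In the columns of the double complex this is part of the definition of a resolution. It is carried over to
  the column of the \<open>F\<^sub>q \<otimes> K\<close> by the horizontal maps, which are onto there and commute with the vertical ones.\<close>

lemma vmap_vmap:
  assumes x: "x \<in> dbl n F P j p (Suc (Suc q))"
  shows "vmap F p q (vmap F p (Suc q) x) = 0"
proof -
  have pos: "vmap F (Suc p) q (vmap F (Suc p) (Suc q) x) = 0" if x: "x \<in> dbl n F P j (Suc p) (Suc (Suc q))" for x p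
  proof -
    have x': "x \<in> arrays (cells n p) {..<frank F (Suc q)} (monomials n) (\<lambda>b. j - int p - fdeg F (Suc q) b)"
      using x by simp
    have im: "fdiff F q (x G) \<in> fdiff F q ` free_module n (frank F (Suc q))" for G
      using arrays_free_module[OF x'] by blast
    show ?thesis
    proof (cases q)
      case 0
      have "faugment F (fdiff F 0 (x G)) = 0" for G
        using im[of G] F unfolding graded_free_resolution_def 0 by blast
      then show ?thesis using 0 by (auto simp: fun_eq_iff)
    next
      case (Suc q')
      have "fdiff F q' (fdiff F (Suc q') (x G)) = 0" for G
        using im[of G] F unfolding graded_free_resolution_def Suc by blast
      then show ?thesis using Suc by (auto simp: fun_eq_iff)
    qed
  qed
  show ?thesis
  proof (cases p)
    case 0
    obtain y where y: "y \<in> dbl n F P j (Suc 0) (Suc (Suc q))" "hmap n 0 (Suc (Suc q)) y = x"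
      using row0_exact x 0 by blast
    have "vmap F 0 q (vmap F 0 (Suc q) x) = hmap n 0 q (vmap F (Suc 0) q (vmap F (Suc 0) (Suc q) y))"
      by (simp only: hmap_vmap_commute y(2))
    also have "\<dots> = 0" unfolding pos[OF y(1)] using hmap_diff[of n 0 q 0 0] by simp
    finally show ?thesis using 0 by simp
  next
    case (Suc p')
    then show ?thesis using pos x by simp
  qed
qed

text \<open>The hypotheses of the diagram chase are symmetric in rows and columns, so it applies in both directions.\<close>

lemma tor_balanced:
  "(\<forall>x\<in>dbl n F P j 0 (Suc i). vmap F 0 i x = 0 \<longrightarrow> (\<exists>y\<in>dbl n F P j 0 (Suc (Suc i)). vmap F 0 (Suc i) y = x)) \<longleftrightarrow>
   (\<forall>x\<in>dbl n F P j (Suc i) 0. hmap n i 0 x = 0 \<longrightarrow> (\<exists>y\<in>dbl n F P j (Suc (Suc i)) 0. hmap n (Suc i) 0 y = x))"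
  (is "?R \<longleftrightarrow> ?C")
proof
  assume C: ?C
  show ?R
  proof (intro ballI impI)
    fix x assume x: "x \<in> dbl n F P j 0 (Suc i)" "vmap F 0 i x = 0"
    show "\<exists>y\<in>dbl n F P j 0 (Suc (Suc i)). vmap F 0 (Suc i) y = x"
      by (rule zigzag[where D = "dbl n F P j" and h = "hmap n" and v = "vmap F", OF hmap_mem vmap_mem dbl_diff hmap_diff vmap_diff
            hmap_vmap_commute vmap_vmap hmap_hmap row0_exact row_exact col0_exact col_exact])
         (use C x in blast)+
  qed
next
  assume R: ?R
  show ?C
  proof (intro ballI impI)
    fix x assume x: "x \<in> dbl n F P j (Suc i) 0" "hmap n i 0 x = 0"
    show "\<exists>y\<in>dbl n F P j (Suc (Suc i)) 0. hmap n (Suc i) 0 y = x"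
      by (rule zigzag[where D = "\<lambda>p q. dbl n F P j q p" and h = "\<lambda>p q. vmap F q p" and v = "\<lambda>p q. hmap n q p",
            OF vmap_mem hmap_mem dbl_diff vmap_diff hmap_diff hmap_vmap_commute[symmetric] hmap_hmap vmap_vmap
            col0_exact col_exact row0_exact row_exact])
         (use R x in blast)+
  qed
qed

end

section \<open>Betti numbers and Koszul homology\<close>

lemma sum_fun_apply: "(\<Sum>a\<in>A. f a) b = (\<Sum>a\<in>A. f a b :: 'c::comm_monoid_add)"
  by (induction A rule: infinite_finite_induct) simp_all

text \<open>The difference of dimensions is a truncated one, so it vanishes as soon as \<open>dim C \<le> dim B\<close>. A basis of \<open>B\<close>
  that is extended to one of \<open>C\<close> then does not grow.\<close>

lemma dim_diff_zero_iff:
  fixes B C :: "(nat \<Rightarrow> 'k::field) set"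
  assumes "B \<subseteq> C" "module.subspace fun_scale B" "finite S" "C \<subseteq> module.span fun_scale S"
  shows "vector_space.dim fun_scale C - vector_space.dim fun_scale B = 0 \<longleftrightarrow> C \<subseteq> B"
proof -
  interpret vector_space "fun_scale :: 'k \<Rightarrow> _" by (rule vector_space_fun_scale)
  show ?thesis
  proof
    assume "C \<subseteq> B"
    then have "C = B" using assms(1) by blast
    then show "dim C - dim B = 0" by simp
  next
    assume le: "dim C - dim B = 0"
    obtain b where b: "b \<subseteq> B" "independent b" "B \<subseteq> span b" "card b = dim B" by (rule basis_exists)
    obtain c where c: "b \<subseteq> c" "c \<subseteq> C" "independent c" "C \<subseteq> span c"
      using maximal_independent_subset_extend[of b C] b(1,2) assms(1) by blast
    have "card c = dim C" using dim_unique[OF c(2,4,3)] by simp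
    moreover have "finite c" using independent_span_bound[OF assms(3) c(3)] c(2) assms(4) by blast
    ultimately have "c = b" using c(1) b(4) le by (metis card_seteq diff_is_0_eq)
    have "span b \<subseteq> B" using b(1) assms(2) by (rule span_minimal)
    then show "C \<subseteq> B" using c(4) \<open>c = b\<close> by blast
  qed
qed

text \<open>Vectors of \<open>F\<^sub>q \<otimes> K\<close> as elements of column \<open>0\<close> of the double complex.\<close>

definition const_array :: "(nat \<Rightarrow> 'k::field) \<Rightarrow> 'k darray" where
  "const_array w = (\<lambda>G b. if G = {} then Poly_Mapping.single 0 (w b) else 0)"

lemma const_array_mem:
  fixes w :: "nat \<Rightarrow> 'k::field"
  shows "const_array w \<in> dbl n F P j 0 (Suc q) \<longleftrightarrow> w \<in> tensor_part F q j"
proof -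
  have "Poly_Mapping.single 0 c \<noteq> (0 :: 'k mpoly) \<longleftrightarrow> c \<noteq> 0" for c :: 'k
    by (metis lookup_single_eq lookup_zero single_zero)
  then show ?thesis by (auto simp: const_array_def tensor_part_def arrays_def homogeneous_def)
qed

lemma const_array_surj:
  assumes "x \<in> dbl n F P j 0 (Suc q)"
  obtains w where "x = const_array w"
proof -
  have x: "x \<in> arrays {{}} {..<frank F q} {0} (\<lambda>b. j - fdeg F q b)" using assms by simp
  have "x G b = const_array (\<lambda>b. lk (x {} b) 0) G b" for G b
  proof (cases "G = {}")
    case True
    have "cpart (x {} b) = x {} b" by (rule cpart_id[OF arraysD(1)[OF x]])
    then show ?thesis using True by (simp add: const_array_def cpart_def)
  next
    case False
    then have "x G b = 0" using arraysD(3)[OF x] by blast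
    then show ?thesis using False by (simp add: const_array_def)
  qed
  then have "x = const_array (\<lambda>b. lk (x {} b) 0)" by (intro ext)
  then show thesis by (rule that)
qed

lemma const_array_inject: "const_array v = const_array w \<longleftrightarrow> v = w"
proof
  assume "const_array v = const_array w"
  then have "const_array v {} b = const_array w {} b" for b by simp
  then have "v b = w b" for b by (simp add: const_array_def) (metis lookup_single_eq)
  then show "v = w" by (rule ext)
qed simp

lemma const_array_zero: "const_array (\<lambda>b. 0) = 0"
  by (auto simp: const_array_def fun_eq_iff)

lemma vmap_const_array: "vmap F 0 (Suc q) (const_array w) = const_array (tensor_diff F q w)"
proof (intro ext)
  fix G b
  have "(\<Sum>b'<frank F (Suc q). cpart (fmat F q b b') * Poly_Mapping.single 0 (w b')) =
     cpart (\<Sum>b'<frank F (Suc q). fmat F q b b' * Poly_Mapping.single 0 (w b'))"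
    by (simp add: cpart_sum cpart_mult) (simp add: cpart_def)
  then show "vmap F 0 (Suc q) (const_array w) G b = const_array (tensor_diff F q w) G b"
    by (simp add: const_array_def tensor_diff_def mat_app_def cpart_def lookup_sum lookup_mult_zero)
qed

lemma tensor_diff_add: "tensor_diff F q (\<lambda>b. v b + w b) = (\<lambda>b. tensor_diff F q v b + tensor_diff F q w b)"
  by (auto simp: tensor_diff_def mat_app_def fun_eq_iff sum.distrib algebra_simps)
lemma tensor_diff_scale: "tensor_diff F q (fun_scale c v) = fun_scale c (tensor_diff F q v)"
  by (auto simp: tensor_diff_def mat_app_def fun_eq_iff sum_distrib_left mult.left_commute)

text \<open>Vanishing of the homology of the Koszul complex with coefficients in the ideal with monomials \<open>P\<close>, in
  homological degree \<open>i\<close> and internal degree \<open>j\<close>. The second index of the arrays is fixed to be \<open>0\<close>. For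
  \<open>i = 0\<close> the map \<open>hmap n 0 0\<close> is zero and all chains are cycles.\<close>

definition koszul_acyclic :: "nat \<Rightarrow> mon set \<Rightarrow> nat \<Rightarrow> int \<Rightarrow> 'k::field itself \<Rightarrow> bool" where
  "koszul_acyclic n P i j _ \<longleftrightarrow>
     (\<forall>x :: 'k darray \<in> arrays (cells n i) {0} P (\<lambda>b. j - int i). hmap n i 0 x = 0 \<longrightarrow>
        (\<exists>y\<in>arrays (cells n (Suc i)) {0} P (\<lambda>b. j - int (Suc i)). dkoszul n y = x))"

text \<open>Column \<open>0\<close> of the double complex is \<open>F \<otimes> K\<close> and row \<open>0\<close> is the Koszul complex with coefficients in \<open>I\<close>.\<close>

lemma tensor_homology_zero_iff:
  fixes F :: "'k::field free_complex"
  assumes F: "graded_free_resolution n F I"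
    and I: "\<And>p :: 'k mpoly. p \<in> I \<longleftrightarrow> Poly_Mapping.keys p \<subseteq> P"
    and P: "upward n P"
  shows "tensor_homology_dim F i j = 0 \<longleftrightarrow> koszul_acyclic n P i j TYPE('k)"
proof -
  note ctx = F I P
  have part: "v \<in> tensor_part F q j \<longleftrightarrow> const_array v \<in> dbl n F P j 0 (Suc q)" for v q
    by (simp only: const_array_mem)
  have zero: "(0 :: nat \<Rightarrow> 'k) = (\<lambda>b. 0)" by (rule ext) simp
  have cyc: "v \<in> tensor_cycles F i j \<longleftrightarrow> const_array v \<in> dbl n F P j 0 (Suc i) \<and> vmap F 0 i (const_array v) = 0" for v
  proof (cases i)
    case 0
    then show ?thesis by (simp only: tensor_cycles_def part vmap.simps) simp
  next
    case (Suc i')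
    then show ?thesis
      by (simp only: tensor_cycles_def part vmap_const_array const_array_zero[symmetric] const_array_inject) (simp add: zero)
  qed
  have bnd: "v \<in> tensor_boundaries F i j \<longleftrightarrow> (\<exists>y\<in>dbl n F P j 0 (Suc (Suc i)). vmap F 0 (Suc i) y = const_array v)" for v
  proof
    assume "v \<in> tensor_boundaries F i j"
    then obtain w where "w \<in> tensor_part F (Suc i) j" "v = tensor_diff F i w" by (auto simp: tensor_boundaries_def)
    then show "\<exists>y\<in>dbl n F P j 0 (Suc (Suc i)). vmap F 0 (Suc i) y = const_array v"
      unfolding part by (intro bexI[of _ "const_array w"]) (simp_all only: vmap_const_array)
  next
    assume "\<exists>y\<in>dbl n F P j 0 (Suc (Suc i)). vmap F 0 (Suc i) y = const_array v"
    then obtain y where y: "y \<in> dbl n F P j 0 (Suc (Suc i))" "vmap F 0 (Suc i) y = const_array v" by blast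
    obtain w where w: "y = const_array w" using const_array_surj[OF y(1)] by blast
    have "w \<in> tensor_part F (Suc i) j" using y(1) unfolding part w .
    moreover have "v = tensor_diff F i w" using y(2) unfolding w vmap_const_array const_array_inject by simp
    ultimately show "v \<in> tensor_boundaries F i j" by (auto simp: tensor_boundaries_def)
  qed
  have sub: "tensor_boundaries F i j \<subseteq> tensor_cycles F i j"
  proof
    fix v assume "v \<in> tensor_boundaries F i j"
    then obtain y where y: "y \<in> dbl n F P j 0 (Suc (Suc i))" "vmap F 0 (Suc i) y = const_array v" unfolding bnd by blast
    show "v \<in> tensor_cycles F i j"
      unfolding cyc y(2)[symmetric] using vmap_mem[OF ctx y(1)] vmap_vmap[OF ctx y(1)] by blast
  qed
  interpret V: vector_space "fun_scale :: 'k \<Rightarrow> _" by (rule vector_space_fun_scale)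
  have sp: "V.subspace (tensor_part F q j)" for q
  proof (rule V.subspaceI)
    fix v w assume "v \<in> tensor_part F q j" "w \<in> tensor_part F q j"
    moreover have "v b + w b \<noteq> 0 \<Longrightarrow> v b \<noteq> 0 \<or> w b \<noteq> 0" for b by auto
    ultimately show "v + w \<in> tensor_part F q j" by (simp add: tensor_part_def) blast
  qed (auto simp: tensor_part_def)
  have "V.subspace (tensor_boundaries F i j)"
  proof (rule V.subspaceI)
    have "tensor_diff F i 0 = 0" by (auto simp: tensor_diff_def mat_app_def fun_eq_iff)
    then show "0 \<in> tensor_boundaries F i j"
      using V.subspace_0[OF sp] unfolding tensor_boundaries_def by (metis imageI)
  next
    fix v w assume "v \<in> tensor_boundaries F i j" "w \<in> tensor_boundaries F i j"
    then obtain v' w' where *: "v' \<in> tensor_part F (Suc i) j" "w' \<in> tensor_part F (Suc i) j"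
      "v = tensor_diff F i v'" "w = tensor_diff F i w'" by (auto simp: tensor_boundaries_def)
    have "v + w = tensor_diff F i (\<lambda>b. v' b + w' b)" unfolding *(3,4) tensor_diff_add by (rule ext) simp
    moreover have "(\<lambda>b. v' b + w' b) \<in> tensor_part F (Suc i) j"
      using V.subspace_add[OF sp *(1,2)] by (simp add: plus_fun_def)
    ultimately show "v + w \<in> tensor_boundaries F i j" by (auto simp: tensor_boundaries_def)
  next
    fix c v assume "v \<in> tensor_boundaries F i j"
    then obtain v' where *: "v' \<in> tensor_part F (Suc i) j" "v = tensor_diff F i v'" by (auto simp: tensor_boundaries_def)
    have "fun_scale c v = tensor_diff F i (fun_scale c v')" unfolding *(2) tensor_diff_scale ..
    then show "fun_scale c v \<in> tensor_boundaries F i j"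
      using V.subspace_scale[OF sp *(1)] by (auto simp: tensor_boundaries_def)
  qed
  moreover
  define S where "S = (\<lambda>a b. if b = a then (1::'k) else 0) ` {..<frank F i}"
  have "tensor_cycles F i j \<subseteq> V.span S"
  proof
    fix v assume "v \<in> tensor_cycles F i j"
    then have v: "v b = 0" if "\<not> b < frank F i" for b using that by (auto simp: tensor_cycles_def tensor_part_def)
    have "v = (\<Sum>a<frank F i. fun_scale (v a) (\<lambda>b. if b = a then 1 else 0))"
    proof (rule ext)
      fix b
      have "(\<Sum>a<frank F i. fun_scale (v a) (\<lambda>b. if b = a then 1 else 0)) b = (\<Sum>a<frank F i. if b = a then v a else 0)"
        unfolding sum_fun_apply by (rule sum.cong) auto
      then show "v b = (\<Sum>a<frank F i. fun_scale (v a) (\<lambda>b. if b = a then 1 else 0)) b"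
        using v[of b] by simp
    qed
    also have "\<dots> \<in> V.span S"
      by (intro V.span_sum V.span_scale V.span_base) (auto simp: S_def)
    finally show "v \<in> V.span S" .
  qed
  moreover have "finite S" by (simp add: S_def)
  ultimately have "tensor_homology_dim F i j = 0 \<longleftrightarrow> tensor_cycles F i j \<subseteq> tensor_boundaries F i j"
    unfolding tensor_homology_dim_def using dim_diff_zero_iff[OF sub] by blast
  also have "\<dots> \<longleftrightarrow> (\<forall>x\<in>dbl n F P j 0 (Suc i). vmap F 0 i x = 0 \<longrightarrow> (\<exists>y\<in>dbl n F P j 0 (Suc (Suc i)). vmap F 0 (Suc i) y = x))"
  proof
    assume L: "tensor_cycles F i j \<subseteq> tensor_boundaries F i j"
    show "\<forall>x\<in>dbl n F P j 0 (Suc i). vmap F 0 i x = 0 \<longrightarrow> (\<exists>y\<in>dbl n F P j 0 (Suc (Suc i)). vmap F 0 (Suc i) y = x)"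
    proof (intro ballI impI)
      fix x assume x: "x \<in> dbl n F P j 0 (Suc i)" "vmap F 0 i x = 0"
      obtain w where w: "x = const_array w" using const_array_surj[OF x(1)] by blast
      have "w \<in> tensor_cycles F i j" unfolding cyc using x by (simp only: w)
      then have "w \<in> tensor_boundaries F i j" using L by blast
      then show "\<exists>y\<in>dbl n F P j 0 (Suc (Suc i)). vmap F 0 (Suc i) y = x" unfolding bnd w .
    qed
  next
    assume R: "\<forall>x\<in>dbl n F P j 0 (Suc i). vmap F 0 i x = 0 \<longrightarrow> (\<exists>y\<in>dbl n F P j 0 (Suc (Suc i)). vmap F 0 (Suc i) y = x)"
    show "tensor_cycles F i j \<subseteq> tensor_boundaries F i j"
    proof
      fix v assume "v \<in> tensor_cycles F i j"
      then show "v \<in> tensor_boundaries F i j" unfolding cyc bnd using R by blast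
    qed
  qed
  also have "\<dots> \<longleftrightarrow> (\<forall>x\<in>dbl n F P j (Suc i) 0. hmap n i 0 x = 0 \<longrightarrow> (\<exists>y\<in>dbl n F P j (Suc (Suc i)) 0. hmap n (Suc i) 0 y = x))"
    by (rule tor_balanced[OF ctx])
  also have "\<dots> \<longleftrightarrow> koszul_acyclic n P i j TYPE('k)"
    unfolding koszul_acyclic_def dbl.simps(3) hmap.simps(3) ..
  finally show ?thesis .
qed

text \<open>The monomials of the ideal generated by \<open>U\<close>.\<close>

definition multiples :: "nat \<Rightarrow> mon set \<Rightarrow> mon set" where
  "multiples n U = {m \<in> monomials n. \<exists>u\<in>U. mdvd u m}"

lemma monomial_ideal_iff:
  assumes "U \<subseteq> monomials n"
  shows "(p :: 'k::field mpoly) \<in> monomial_ideal n U \<longleftrightarrow> Poly_Mapping.keys p \<subseteq> multiples n U"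
  unfolding monomial_ideal_mem[OF assms] multiples_def by blast

lemma upward_multiples: "upward n (multiples n U)"
  unfolding upward_def multiples_def using mdvd_trans by blast

text \<open>The Betti numbers refer to an unspecified resolution. As the resolution on tuples shows, there is one, and
  the Koszul complex does not depend on it.\<close>

theorem linear_resolution_iff_koszul:
  fixes U :: "mon set"
  assumes "finite U" "U \<noteq> {}" "U \<subseteq> monomials n"
  shows "has_linear_resolution n d (monomial_ideal n U :: 'k::field mpoly set) \<longleftrightarrow>
    (\<forall>i j. j \<noteq> int d \<longrightarrow> koszul_acyclic n (multiples n U) i (int i + j) TYPE('k))"
proof -
  obtain g :: "nat \<Rightarrow> mon" and m where gm: "U = g ` {i. i < m}"
    using finite_imp_nat_seg_image_inj_on[OF assms(1)] by blast
  then have gU: "U = g ` {..<m}" by auto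
  then have "m > 0" using assms(2) by auto
  have "graded_free_resolution n (taylor g m :: 'k free_complex) (monomial_ideal n U)"
    unfolding gU by (rule taylor_resolution[OF \<open>m > 0\<close>]) (use assms(3) gU in auto)
  then have "graded_free_resolution n (SOME F :: 'k free_complex. graded_free_resolution n F (monomial_ideal n U)) (monomial_ideal n U)"
    by (rule someI)
  from tensor_homology_zero_iff[OF this monomial_ideal_iff[OF assms(3)] upward_multiples]
  show ?thesis by (simp add: has_linear_resolution_def betti_def)
qed

text \<open>The Koszul complex is the direct sum of its parts in the multidegrees of degree \<open>j\<close>.\<close>

lemma koszul_acyclic_if_mexact:
  assumes P: "P \<subseteq> monomials n"
    and ex: "\<And>M. M \<in> monomials n \<Longrightarrow> int (mon_deg M) = j \<Longrightarrow> mexact n P M p TYPE('k::field)"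
  shows "koszul_acyclic n P p j TYPE('k)"
  unfolding koszul_acyclic_def
proof (intro ballI impI)
  fix x :: "'k darray"
  assume x: "x \<in> arrays (cells n p) {0} P (\<lambda>b. j - int p)" and hx: "hmap n p 0 x = 0"
  have "dkoszul n x = 0" using hx dkoszul_zero_cells[of x n] x by (cases p) auto
  then have "\<exists>y\<in>arrays (cells n (Suc p)) {0} P (\<lambda>b. j - int p - 1). dkoszul n y = x"
    by (rule dkoszul_exact[OF x _ P]) (simp add: ex)
  then show "\<exists>y\<in>arrays (cells n (Suc p)) {0} P (\<lambda>b. j - int (Suc p)). dkoszul n y = x"
    by (simp add: algebra_simps)
qed

section \<open>Linear quotients imply a linear resolution\<close>

lemma mono_poly_mult_keys:
  "Poly_Mapping.keys (p * mono_poly a :: 'k::field mpoly) = (\<lambda>q. q + a) ` Poly_Mapping.keys p"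
proof (rule subset_antisym; rule subsetI)
  have lkp: "lk (p * mono_poly a) k = (if mdvd a k then lk p (k - a) else 0)" for k
    using lookup_single_mult[of a 1 p k] by (simp add: mono_poly_def mult.commute)
  fix k
  {
    assume "k \<in> Poly_Mapping.keys (p * mono_poly a)"
    then have "mdvd a k" "k - a \<in> Poly_Mapping.keys p" by (auto simp: in_keys_iff lkp split: if_splits)
    then show "k \<in> (\<lambda>q. q + a) ` Poly_Mapping.keys p" by (metis imageI mdvd_minus_add)
  next
    assume "k \<in> (\<lambda>q. q + a) ` Poly_Mapping.keys p"
    then show "k \<in> Poly_Mapping.keys (p * mono_poly a)" by (auto simp: in_keys_iff lkp)
  }
qed

lemma colon_monomial_ideal_mem:
  assumes "U \<subseteq> monomials n" "a \<in> monomials n"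
  shows "(p :: 'k::field mpoly) \<in> colon n (monomial_ideal n U) (mono_poly a) \<longleftrightarrow>
    Poly_Mapping.keys p \<subseteq> {q \<in> monomials n. q + a \<in> multiples n U}"
  unfolding colon_def monomial_ideal_iff[OF assms(1)] mono_poly_mult_keys
  by (auto simp: polyring_def)

lemma var_ideal_mem:
  assumes "V \<subseteq> {1..n}"
  shows "(p :: 'k::field mpoly) \<in> genideal (polyring n) (var ` V) \<longleftrightarrow>
    Poly_Mapping.keys p \<subseteq> {q \<in> monomials n. \<exists>x\<in>V. x \<in> Poly_Mapping.keys q}"
proof -
  define U where "U = (\<lambda>x. Poly_Mapping.single x 1 :: mon) ` V"
  have U: "U \<subseteq> monomials n" using assms by (auto simp: U_def monomials_def)
  have "(var ` V :: 'k mpoly set) = mono_poly ` U" by (simp add: U_def var_def image_image)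
  then have "p \<in> genideal (polyring n) (var ` V) \<longleftrightarrow> p \<in> monomial_ideal n U" by (simp add: monomial_ideal_def)
  moreover have "mdvd (Poly_Mapping.single x 1) q \<longleftrightarrow> x \<in> Poly_Mapping.keys q" for x q
    by (auto simp: mdvd_def lookup_single when_def in_keys_iff)
  then have "multiples n U = {q \<in> monomials n. \<exists>x\<in>V. x \<in> Poly_Mapping.keys q}"
    by (auto simp: multiples_def U_def)
  ultimately show ?thesis by (simp add: monomial_ideal_iff[OF U])
qed

lemma mono_poly_single_keys: "Poly_Mapping.keys (mono_poly m :: 'k::field mpoly) = {m}"
  by (simp add: mono_poly_def)

text \<open>The generators are added one at a time in the given order; each step is an instance of \<open>mexact_insert\<close>. The
  empty set of generators starts the induction.\<close>

theorem linear_resolution_if_linear_quotients: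
  assumes U: "finite U" "U \<noteq> {}" "U \<subseteq> monomials n" and deg: "\<And>u. u \<in> U \<Longrightarrow> mon_deg u = d"
    and lq: "linear_quotients n (monomial_ideal n U :: 'k::field mpoly set)"
  shows "has_linear_resolution n d (monomial_ideal n U :: 'k mpoly set)"
proof -
  let ?I = "monomial_ideal n U :: 'k mpoly set"
  obtain us where us: "distinct us" "minimal_monomial_generators n (set us) ?I"
    and col: "\<And>k. 1 \<le> k \<Longrightarrow> k < length us \<Longrightarrow>
      \<exists>V\<subseteq>{1..n}. colon n (monomial_ideal n (set (take k us)) :: 'k mpoly set) (mono_poly (us ! k))
                        = genideal (polyring n) (var ` V)"
    using lq unfolding linear_quotients_def by blast
  have usm: "set us \<subseteq> monomials n" and usI: "monomial_ideal n (set us) = ?I"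
    and min: "\<And>G'. G' \<subset> set us \<Longrightarrow> monomial_ideal n G' \<noteq> ?I"
    using us(2) by (simp_all add: minimal_monomial_generators_def)
  have memI: "(mono_poly m :: 'k mpoly) \<in> ?I \<longleftrightarrow> m \<in> multiples n U" for m
    using monomial_ideal_iff[OF U(3), of "mono_poly m :: 'k mpoly"] by (simp add: mono_poly_single_keys)
  have memI': "(mono_poly m :: 'k mpoly) \<in> ?I \<longleftrightarrow> m \<in> multiples n (set us)" for m
    using monomial_ideal_iff[OF usm, of "mono_poly m :: 'k mpoly"] usI by (simp add: mono_poly_single_keys)
  have mult_eq: "multiples n U = multiples n (set us)" using memI memI' by blast
  \<comment> \<open>The generators listed by \<open>us\<close> have degree \<open>d\<close>: each is a multiple of a member of \<open>U\<close>, which is a multiple of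
      some \<open>g'\<close> in the list, and minimality forces \<open>g' = g\<close>.\<close>
  have us_deg: "mon_deg g = d" if g: "g \<in> set us" for g
  proof -
    have "g \<in> multiples n (set us)" using g usm by (auto simp: multiples_def intro: mdvd_refl)
    then obtain u where u: "u \<in> U" "mdvd u g" using mult_eq by (auto simp: multiples_def)
    have "u \<in> multiples n U" using u(1) U(3) by (auto simp: multiples_def intro: mdvd_refl)
    then obtain g' where g': "g' \<in> set us" "mdvd g' u" using mult_eq by (auto simp: multiples_def)
    have "mdvd g' g" using g'(2) u(2) by (rule mdvd_trans)
    have "g' = g"
    proof (rule ccontr)
      assume "g' \<noteq> g"
      have sub: "set us - {g} \<subseteq> monomials n" using usm by blast
      have "multiples n (set us - {g}) = multiples n (set us)"
        unfolding multiples_def using \<open>g' \<noteq> g\<close> g'(1) \<open>mdvd g' g\<close> mdvd_trans by blast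
      then have "monomial_ideal n (set us - {g}) = ?I"
        unfolding usI[symmetric] using monomial_ideal_iff[OF sub] monomial_ideal_iff[OF usm] by blast
      then show False using min[of "set us - {g}"] g by blast
    qed
    then have "u = g" using g'(2) u(2) mdvd_antisym by blast
    then show ?thesis using deg u(1) by simp
  qed
  have se: "mexact n (multiples n (set (take k us))) M p TYPE('k)"
    if "k \<le> length us" "M \<in> monomials n" "mon_deg M \<noteq> d + p" for k M p
    using that
  proof (induction k)
    case 0
    then show ?case by (auto simp: mexact_def mchain_def multiples_def bdry_def intro!: exI[of _ "\<lambda>_. 0"])
  next
    case (Suc k)
    define g where "g = us ! k"
    have k: "k < length us" using Suc.prems by simp
    have gs: "g \<in> set us" using k by (simp add: g_def)
    have gm: "g \<in> monomials n" using gs usm by blast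
    have take_m: "set (take k us) \<subseteq> monomials n" using usm set_take_subset by fast
    have "\<exists>V. \<forall>q\<in>monomials n. q + g \<in> multiples n (set (take k us)) \<longleftrightarrow> (\<exists>x\<in>V. x \<in> Poly_Mapping.keys q)"
    proof (cases "k = 0")
      case True
      then show ?thesis by (intro exI[of _ "{}"]) (simp add: multiples_def)
    next
      case False
      then obtain V where V: "V \<subseteq> {1..n}"
        "colon n (monomial_ideal n (set (take k us)) :: 'k mpoly set) (mono_poly g) = genideal (polyring n) (var ` V)"
        using col[of k] k unfolding g_def by auto
      have "q + g \<in> multiples n (set (take k us)) \<longleftrightarrow> (\<exists>x\<in>V. x \<in> Poly_Mapping.keys q)" if q: "q \<in> monomials n" for q
        using colon_monomial_ideal_mem[OF take_m gm, of "mono_poly q :: 'k mpoly"]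
          var_ideal_mem[OF V(1), of "mono_poly q :: 'k mpoly"] q unfolding V(2) mono_poly_single_keys by simp
      then show ?thesis by blast
    qed
    then obtain V where V: "\<And>q. q \<in> monomials n \<Longrightarrow> q + g \<in> multiples n (set (take k us)) \<longleftrightarrow> (\<exists>x\<in>V. x \<in> Poly_Mapping.keys q)"
      by blast
    have "mexact n (multiples n (set (take k us)) \<union> {m \<in> monomials n. mdvd g m}) M p TYPE('k)"
    proof (rule mexact_insert[OF _ _ gm V])
      show "mexact n (multiples n (set (take k us))) M p TYPE('k)" using Suc by simp
      show "M \<in> monomials n" "mon_deg M \<noteq> mon_deg g + p" using Suc.prems us_deg[OF gs] by simp_all
      show "multiples n (set (take k us)) \<subseteq> monomials n" unfolding multiples_def by blast
      show "b \<in> multiples n (set (take k us))" if "a \<in> multiples n (set (take k us))" "mdvd a b" "b \<in> monomials n" for a b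
        using upward_multiples that unfolding upward_def by blast
    qed
    moreover have "multiples n (set (take (Suc k) us)) = multiples n (set (take k us)) \<union> {m \<in> monomials n. mdvd g m}"
      unfolding take_Suc_conv_app_nth[OF k] multiples_def g_def by auto
    ultimately show ?case by simp
  qed
  show ?thesis
    unfolding linear_resolution_iff_koszul[OF U]
  proof (intro allI impI)
    fix i and j :: int assume j: "j \<noteq> int d"
    show "koszul_acyclic n (multiples n U) i (int i + j) TYPE('k)"
    proof (rule koszul_acyclic_if_mexact)
      show "multiples n U \<subseteq> monomials n" unfolding multiples_def by blast
      fix M assume "M \<in> monomials n" "int (mon_deg M) = int i + j"
      then show "mexact n (multiples n U) M i TYPE('k)"
        using se[of "length us" M i] j unfolding mult_eq by simp
    qed
  qed
qed

section \<open>Spread lists and exchange properties\<close>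

definition spread :: "nat \<Rightarrow> nat list \<Rightarrow> bool" where
  "spread t l \<longleftrightarrow> sorted_wrt (\<lambda>x y. x + t \<le> y) l"

lemma spread_Nil [simp]: "spread t []"
  and spread_Cons [simp]: "spread t (x # l) \<longleftrightarrow> (\<forall>y\<in>set l. x + t \<le> y) \<and> spread t l"
  by (auto simp: spread_def)

lemma spread_ConsCons: "spread t (x # y # l) \<longleftrightarrow> x + t \<le> y \<and> spread t (y # l)"
  by (auto; force)

definition spread_lists :: "nat \<Rightarrow> nat \<Rightarrow> nat \<Rightarrow> nat list set" where
  "spread_lists n d t = {l. length l = d \<and> set l \<subseteq> {1..n} \<and> spread t l}"

definition seg :: "nat \<Rightarrow> nat \<Rightarrow> nat \<Rightarrow> nat list \<Rightarrow> nat list \<Rightarrow> nat list set" where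
  "seg n d t u v = {l \<in> spread_lists n d t. u \<le> l \<and> l \<le> v}"

lemma finite_spread_lists: "finite (spread_lists n d t)"
  by (rule finite_subset[OF _ finite_lists_length_eq[of "{1..n}" d]]) (auto simp: spread_lists_def)

lemma finite_seg: "finite (seg n d t u v)"
  by (rule finite_subset[OF _ finite_spread_lists[of n d t]]) (auto simp: seg_def)

lemma Cons_spread_lists:
  "x # l \<in> spread_lists n (Suc d) t \<longleftrightarrow> x \<in> {1..n} \<and> (\<forall>y\<in>set l. x + t \<le> y) \<and> l \<in> spread_lists n d t"
  by (auto simp: spread_lists_def)

lemma spread_lists_SucE:
  assumes "l \<in> spread_lists n (Suc d) t"
  obtains x l' where "l = x # l'" "x \<in> {1..n}" "\<forall>y\<in>set l'. x + t \<le> y" "l' \<in> spread_lists n d t"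
  using assms by (cases l) (auto simp: spread_lists_def)

lemma spread_lists_0 [simp]: "spread_lists n 0 t = {[]}"
  by (auto simp: spread_lists_def)

text \<open>For squarefree monomials the colon ideal of \<open>x\<^sub>b\<close> by \<open>x\<^sub>a\<close> is generated by the product of the variables in
  \<open>b\<close> but not in \<open>a\<close>. So the colon ideal of all of \<open>P\<close> by \<open>a\<close> is generated by variables when each such product
  is divisible by one that is a single variable.\<close>

definition exchangeable :: "nat list set \<Rightarrow> nat list \<Rightarrow> bool" where
  "exchangeable P a \<longleftrightarrow> (\<forall>b\<in>P. \<exists>j\<in>set b - set a. \<exists>z\<in>P. set z - set a = {j})"

text \<open>The sets of lists that have an order with linear quotients; each step adds the next generator.\<close>

inductive lq_set :: "nat list set \<Rightarrow> bool" where
  lq_set_empty: "lq_set {}"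
| lq_set_insert: "lq_set S \<Longrightarrow> a \<notin> S \<Longrightarrow> exchangeable S a \<Longrightarrow> lq_set (insert a S)"

text \<open>The members of \<open>X\<close> are added in increasing order with respect to \<open>lt\<close>.\<close>

lemma lq_set_add_ordered:
  assumes "lq_set S" "finite X" "X \<inter> S = {}"
    and "asymp_on X lt" "transp_on X lt" "totalp_on X lt"
    and "\<And>x. x \<in> X \<Longrightarrow> exchangeable (S \<union> {y\<in>X. lt y x}) x"
  shows "lq_set (S \<union> X)"
  using assms(2-)
proof (induction "card X" arbitrary: X)
  case 0
  then show ?case using assms(1) by simp
next
  case (Suc k)
  have "X \<noteq> {}" using Suc.hyps(2) by auto
  then obtain m where m: "m \<in> X" "\<forall>x\<in>X. x \<noteq> m \<longrightarrow> \<not> lt m x"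
    using Finite_Set.bex_max_element[of X lt, OF Suc.prems(1,3,4)] by blast
  have below: "{y\<in>X. lt y m} = X - {m}"
  proof (rule subset_antisym; rule subsetI)
    fix y assume "y \<in> {y\<in>X. lt y m}"
    then show "y \<in> X - {m}" using m asymp_onD[OF Suc.prems(3), of m m] by blast
  next
    fix y assume "y \<in> X - {m}"
    then show "y \<in> {y\<in>X. lt y m}" using m totalp_onD[OF Suc.prems(5), of y m] by blast
  qed
  have "lq_set (S \<union> (X - {m}))"
  proof (rule Suc.hyps(1))
    show "k = card (X - {m})" using Suc.hyps(2) m Suc.prems(1) by simp
    show "asymp_on (X - {m}) lt" "transp_on (X - {m}) lt" "totalp_on (X - {m}) lt"
      using asymp_on_subset[OF Suc.prems(3), of "X - {m}"] transp_on_subset[OF Suc.prems(4), of "X - {m}"]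
            totalp_on_subset[OF Suc.prems(5), of "X - {m}"] by simp_all
    fix x assume x: "x \<in> X - {m}"
    have "{y \<in> X - {m}. lt y x} = {y\<in>X. lt y x}" using x m by auto
    then show "exchangeable (S \<union> {y \<in> X - {m}. lt y x}) x" using Suc.prems(6)[of x] x by simp
  next
    show "finite (X - {m})" "(X - {m}) \<inter> S = {}" using Suc.prems(1,2) by blast+
  qed
  moreover have "exchangeable (S \<union> (X - {m})) m" using  Suc.prems(6)[OF m(1)] below by simp
  ultimately have "lq_set (insert m (S \<union> (X - {m})))"
    using m Suc.prems(2) by (intro lq_set_insert) auto
  moreover have "insert m (S \<union> (X - {m})) = S \<union> X" using m by auto
  ultimately show ?case by simp
qed

text \<open>An order for \<open>X\<close> also works after \<open>e\<close> is put in front of all its members, since \<open>e\<close> occurs in all of them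
  and drops out of the differences. The members of \<open>S\<close> come earlier, and the last assumption takes care of
  them.\<close>

lemma lq_set_add_Cons:
  assumes "lq_set X" "lq_set S" "\<And>x. x \<in> X \<Longrightarrow> e \<notin> set x"
    and "(#) e ` X \<inter> S = {}"
    and "\<And>x b. x \<in> X \<Longrightarrow> b \<in> S \<Longrightarrow> \<exists>j\<in>set b - set (e # x). \<exists>z\<in>S. set z - set (e # x) = {j}"
  shows "lq_set (S \<union> (#) e ` X)"
  using assms
proof (induction X rule: lq_set.induct)
  case (lq_set_insert X a)
  have "exchangeable (S \<union> (#) e ` X) (e # a)"
    unfolding exchangeable_def
  proof
    fix b assume "b \<in> S \<union> (#) e ` X"
    then consider "b \<in> S" | x where "x \<in> X" "b = e # x" by blast
    then show "\<exists>j\<in>set b - set (e # a). \<exists>z\<in>S \<union> (#) e ` X. set z - set (e # a) = {j}"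
    proof cases
      case 1
      show ?thesis
        using lq_set_insert.prems(4)[OF insertI1 1] by (elim bexE) (intro bexI UnI1)
    next
      case 2
      from lq_set_insert.hyps(3) 2(1) have "\<exists>j\<in>set x - set a. \<exists>z\<in>X. set z - set a = {j}"
        unfolding exchangeable_def by (rule bspec)
      then obtain j z where j: "j \<in> set x - set a" "z \<in> X" "set z - set a = {j}"
        by (elim bexE)
      have "e \<notin> set x" "e \<notin> set z" using lq_set_insert.prems(2) 2(1) j(2) by simp_all
      then have "j \<in> set b - set (e # a)" using j(1) 2(2) by auto
      moreover have "set (e # z) - set (e # a) = set z - set a" using \<open>e \<notin> set z\<close> by auto
      ultimately show ?thesis using j(2,3) by (intro bexI[of _ j] bexI[of _ "e # z"]) simp_all
    qed
  qed
  moreover have "lq_set (S \<union> (#) e ` X)"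
    using lq_set_insert.prems by (intro lq_set_insert.IH) simp_all
  moreover have "e # a \<notin> S \<union> (#) e ` X"
    using lq_set_insert.prems(3) lq_set_insert.hyps(2) by auto
  ultimately have "lq_set (insert (e # a) (S \<union> (#) e ` X))" by (rule lq_set.intros(2)[rotated 2])
  then show ?case by simp
qed simp

lemma list_all2_le_imp_le: "list_all2 (\<le>) xs ys \<Longrightarrow> xs \<le> (ys :: nat list)"
  by (induction rule: list_all2_induct) auto

lemma spread_shift_le:
  "spread t (x # l) \<Longrightarrow> list_all2 (\<le>) (map (\<lambda>i. i + t) (butlast (x # l))) l"
  by (induction l arbitrary: x) auto

text \<open>Let \<open>z\<close> be \<open>x\<close> with its entry at the first difference replaced by the smaller entry of \<open>y\<close>; the gap to the
  next entry only grows. The last conclusion bounds \<open>z\<close> from below: each entry of \<open>z\<close> is at least \<open>t\<close> more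
  than the preceding entry of \<open>x\<close>.\<close>

lemma lex_exchange:
  assumes "length x = length y" "spread t x" "spread t y" "y < x" "t \<ge> 1"
  shows "\<exists>z j. spread t z \<and> length z = length x \<and> set z \<subseteq> set x \<union> set y \<and> z < x \<and>
           j \<in> set y \<and> set z - set x = {j} \<and> hd z \<in> {hd x, hd y} \<and>
           (\<forall>c. (\<forall>k\<in>set x \<union> set y. c + t \<le> k) \<longrightarrow>
              list_all2 (\<le>) (map (\<lambda>i. i + t) (butlast (c # x))) z)"
  using assms
proof (induction x y rule: list_induct2)
  case (Cons a x b y)
  show ?case
  proof (cases "a = b")
    case True
    then have "y < x" using Cons.prems by simp
    then obtain z j where z: "spread t z" "length z = length x" "set z \<subseteq> set x \<union> set y" "z < x"
      "j \<in> set y" "set z - set x = {j}"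
      "\<forall>c. (\<forall>k\<in>set x \<union> set y. c + t \<le> k) \<longrightarrow>
         list_all2 (\<le>) (map (\<lambda>i. i + t) (butlast (c # x))) z"
      using Cons.IH Cons.prems by auto
    have "a < j" using z(5) Cons.prems True by fastforce
    then have "spread t (a # z)" "set (a # z) - set (a # x) = {j}"
      using z Cons.prems True by auto
    moreover have "list_all2 (\<le>) (map (\<lambda>i. i + t) (butlast (c # a # x))) (a # z)"
      if "\<forall>k\<in>set (a # x) \<union> set (b # y). c + t \<le> k" for c
      using z(7) Cons.prems True that by auto
    ultimately show ?thesis using z True by (intro exI[of _ "a # z"] exI[of _ j]) auto
  next
    case False
    then have ba: "b < a" using Cons.prems by simp
    have "b \<notin> set x" using Cons.prems ba by fastforce
    then have "set (b # x) - set (a # x) = {b}" using ba by auto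
    moreover have "spread t (b # x)" using ba Cons.prems by fastforce
    moreover have "list_all2 (\<le>) (map (\<lambda>i. i + t) (butlast (c # a # x))) (b # x)"
      if "\<forall>k\<in>set (a # x) \<union> set (b # y). c + t \<le> k" for c
      using spread_shift_le[of t a x] Cons.prems that by auto
    ultimately show ?thesis using ba by (intro exI[of _ "b # x"] exI[of _ b]) auto
  qed
qed simp

lemma butlast_map_mono:
  fixes x y :: "nat list"
  assumes "length x = length y" "x \<le> y"
  shows "map (\<lambda>i. i + t) (butlast x) \<le> map (\<lambda>i. i + t) (butlast y)"
  using assms by (induction x y rule: list_induct2) auto

lemma append_less_append:
  fixes p q r s :: "nat list"
  assumes "length p = length q" "p < q"
  shows "p @ r < q @ s"
  using assms by (induction p q rule: list_induct2) auto

lemma append_less_same: "p @ r < p @ s \<longleftrightarrow> r < (s :: nat list)"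
  by (induction p) auto

text \<open>Raise the entry of \<open>a\<close> at the first position where the entry of \<open>b\<close> leaves room for the next entry of \<open>a\<close>.
  Such a position exists, the last one if no other. Before it the entries of \<open>a\<close> are smaller than those of
  \<open>b\<close>, because the next entry of \<open>a\<close> is less than \<open>t\<close> beyond the entry of \<open>b\<close>.\<close>

lemma chain_exchange:
  assumes "length a = length b" "a \<noteq> []" "spread t a" "spread t b" "hd a < hd b" "t \<ge> 1"
  shows "\<exists>z j. spread t z \<and> set z \<subseteq> set a \<union> set b \<and> list_all2 (\<le>) a z \<and> j \<in> set b \<and>
           set z - set a = {j} \<and> rev a < rev z"
  using assms
proof (induction a b rule: list_induct2)
  case (Cons x a y b)
  show ?case
  proof (cases "a = []")
    case True
    then show ?thesis using Cons.prems Cons.hyps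
      by (intro exI[of _ "[y]"] exI[of _ y]) auto
  next
    case False
    then obtain x2 a' where a: "a = x2 # a'" by (cases a) auto
    obtain y2 b' where b: "b = y2 # b'" using Cons.hyps a by (cases b) auto
    show ?thesis
    proof (cases "y + t \<le> x2")
      case True
      have "y \<notin> set a" using True Cons.prems by (fastforce simp: a)
      then have "set (y # a) - set (x # a) = {y}" using Cons.prems(4) by auto
      moreover have "spread t (y # a)" using Cons.prems(2) True a by fastforce
      moreover have "list_all2 (\<le>) (x # a) (y # a)" using Cons.prems(4) by (simp add: list.rel_refl)
      moreover have "rev (x # a) < rev (y # a)" using Cons.prems(4) by (simp add: append_less_same)
      moreover have "set (y # a) \<subseteq> set (x # a) \<union> set (y # b)" by auto
      ultimately show ?thesis
        by (intro exI[of _ "y # a"] exI[of _ y] conjI) (assumption | simp)+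
    next
      case False
      then have "x2 < y2" using Cons.prems by (auto simp: b)
      then obtain z j where z: "spread t z" "set z \<subseteq> set a \<union> set b" "list_all2 (\<le>) a z" "j \<in> set b"
         "set z - set a = {j}" "rev a < rev z"
        using Cons.IH Cons.prems a b by auto
      obtain z2 z' where z2: "z = z2 # z'" "x2 \<le> z2" using z(3) a by (cases z) auto
      have "spread t (x # z)"
        using z(1) z2 Cons.prems by (auto simp: a spread_ConsCons)
      moreover have "x < j" using z(4) Cons.prems by fastforce
      then have "set (x # z) - set (x # a) = {j}" using z(5) by auto
      moreover have "rev (x # a) < rev (x # z)"
        using append_less_append[of "rev a" "rev z"] z(3,6) by (simp add: list_all2_lengthD)
      ultimately show ?thesis using z Cons.prems
        by (intro exI[of _ "x # z"] exI[of _ j]) auto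
    qed
  qed
qed simp

text \<open>Let \<open>z\<close> be \<open>a\<close> with its entry at the last difference replaced by the larger entry of \<open>b\<close>; the common rest
  leaves room for it.\<close>

lemma rev_exchange:
  assumes "length a = length b" "spread t a" "spread t b" "rev a < rev b" "t \<ge> 1"
  shows "\<exists>z j. spread t z \<and> set z \<subseteq> set a \<union> set b \<and> list_all2 (\<le>) a z \<and> j \<in> set b \<and>
           set z - set a = {j} \<and> rev a < rev z"
  using assms
proof (induction "length a" arbitrary: a b)
  case (Suc k)
  obtain x a' where a: "a = a' @ [x]" using Suc.hyps(2) by (cases a rule: rev_cases) auto
  obtain y b' where b: "b = b' @ [y]" using Suc.hyps(2) Suc.prems(1) by (cases b rule: rev_cases) auto
  have sa: "spread t a'" "\<forall>k\<in>set a'. k + t \<le> x" and sb: "spread t b'" "\<forall>k\<in>set b'. k + t \<le> y"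
    using Suc.prems by (auto simp: a b spread_def sorted_wrt_append)
  show ?case
  proof (cases "x = y")
    case True
    then obtain z j where z: "spread t z" "set z \<subseteq> set a' \<union> set b'" "list_all2 (\<le>) a' z" "j \<in> set b'"
         "set z - set a' = {j}" "rev a' < rev z"
      using Suc.hyps(1)[of a' b'] Suc.prems Suc.hyps(2) sa sb by (auto simp: a b)
    have "spread t (z @ [x])" using z sa sb True by (auto simp: spread_def sorted_wrt_append)
    moreover have "j \<noteq> x" using z(4) sb True Suc.prems(5) by auto
    then have "set (z @ [x]) - set a = {j}" using z(5) by (auto simp: a)
    ultimately show ?thesis using z True
      by (intro exI[of _ "z @ [x]"] exI[of _ j]) (auto simp: a b intro!: list_all2_appendI)
  next
    case False
    then have xy: "x < y" using Suc.prems by (auto simp: a b)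
    have "spread t (a' @ [y])" using sa xy by (fastforce simp: spread_def sorted_wrt_append)
    moreover have "y \<notin> set a'" using sa xy by fastforce
    then have "set (a' @ [y]) - set a = {y}" using xy by (auto simp: a)
    moreover have "list_all2 (\<le>) a (a' @ [y])"
      using xy by (auto simp: a intro!: list_all2_appendI list.rel_refl)
    ultimately show ?thesis using xy
      by (intro exI[of _ "a' @ [y]"] exI[of _ y]) (auto simp: a b)
  qed
qed simp

section \<open>Linear quotients of lexicographic segments\<close>

text \<open>Common initial entries are cancelled. At the first difference the condition compares \<open>u\<close> with the lists
  \<open>c # w\<close> beyond the segment, shifted by \<open>t\<close>. The shifted list consists of the least values that the entries
  of \<open>w\<close> may take after their predecessors in \<open>c # w\<close>; so it bounds from below what can arise from \<open>w\<close> by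
  lowering an entry.\<close>

fun linearity_cond :: "nat \<Rightarrow> nat \<Rightarrow> nat list \<Rightarrow> nat list \<Rightarrow> bool" where
  "linearity_cond n t (e # u) (c # v) \<longleftrightarrow>
     (if e = c then linearity_cond n t u v
      else \<forall>w. c # w \<in> spread_lists n (Suc (length v)) t \<and> v < w \<longrightarrow>
             u \<le> map (\<lambda>i. i + t) (butlast (c # w)))"
| "linearity_cond n t _ _ \<longleftrightarrow> True"

text \<open>If the last assumption holds for lists starting with \<open>c\<close>, then \<open>u\<close> is at most the shift of \<open>c # f # w\<close>,
  whose first entry \<open>c + t\<close> is at most the first entry of \<open>u\<close>. Hence the comparison passes to the tails, and
  the condition recurs for \<open>u\<close> and \<open>v\<close> themselves.\<close>

lemma linearity_cond_tail:
  assumes "u \<in> spread_lists n d t" "v \<in> spread_lists n d t" "u \<le> v" "\<forall>y\<in>set u. c + t \<le> y"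
    and "\<And>w. w \<in> spread_lists n d t \<Longrightarrow> v < w \<Longrightarrow> u \<le> map (\<lambda>i. i + t) (butlast (c # w))"
  shows "linearity_cond n t u v"
  using assms
proof (induction d arbitrary: u v c)
  case (Suc d)
  obtain e u' where u: "u = e # u'" "\<forall>y\<in>set u'. e + t \<le> y" "u' \<in> spread_lists n d t"
    using Suc.prems(1) by (rule spread_lists_SucE)
  obtain f v' where v: "v = f # v'" "v' \<in> spread_lists n d t"
    using Suc.prems(2) by (rule spread_lists_SucE)
  have step: "u' \<le> map (\<lambda>i. i + t) (butlast (f # w))"
    if "f # w \<in> spread_lists n (Suc d) t" "v' < w" for w
  proof -
    have "u \<le> map (\<lambda>i. i + t) (butlast (c # f # w))"
      using Suc.prems(5)[OF that(1)] that(2) v by simp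
    then show ?thesis using Suc.prems(4) u(1) by simp
  qed
  show ?case
  proof (cases "e = f")
    case True
    have len: "length v' = d" using v(2) by (simp add: spread_lists_def)
    have "linearity_cond n t u' v'"
    proof (rule Suc.IH[OF u(3) v(2) _ u(2)])
      show "u' \<le> v'" using Suc.prems(3) u v True by simp
      fix w assume w: "w \<in> spread_lists n d t" "v' < w"
      have "v' \<le> w" using w by simp
      have "\<forall>y\<in>set w. f + t \<le> y"
      proof (cases w)
        case (Cons a w')
        then obtain b v'' where "v' = b # v''" using len w(1) by (cases v') (auto simp: spread_lists_def)
        moreover have "f + t \<le> b"
          using Suc.prems(2) v(1) calculation by (simp add: spread_lists_def)
        ultimately have "f + t \<le> a" using \<open>v' \<le> w\<close> Cons by auto
        then show ?thesis using w(1) Cons by (fastforce simp: spread_lists_def)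
      qed simp
      then have "f # w \<in> spread_lists n (Suc d) t"
        using w(1) Suc.prems(2) v(1) by (simp add: Cons_spread_lists)
      from step[OF this w(2)] show "u' \<le> map (\<lambda>i. i + t) (butlast (e # w))" using True by simp
    qed
    then show ?thesis using u(1) v(1) True by simp
  next
    case False
    have len: "length v' = d" using v(2) by (simp add: spread_lists_def)
    show ?thesis using step False by (auto simp: u(1) v(1) len)
  qed
qed simp

text \<open>The first entry bounds all others from below, and it can only grow in the lexicographic order.\<close>

lemma spread_lists_lower:
  assumes "u \<in> spread_lists n d t" "l \<in> spread_lists n d t" "u \<le> l" "\<forall>y\<in>set u. k \<le> y"
  shows "\<forall>y\<in>set l. k \<le> (y::nat)"
proof (cases d)
  case (Suc d')
  obtain a u' where u: "u = a # u'" using assms(1) Suc spread_lists_SucE by metis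
  obtain b l' where l: "l = b # l'" "\<forall>y\<in>set l'. b + t \<le> y"
    using assms(2) Suc spread_lists_SucE by metis
  have "k \<le> b" using assms(3,4) u l(1) by auto
  then show ?thesis using l by fastforce
qed (use assms in auto)

lemma exchangeI:
  assumes "j \<in> set b" "z \<in> P" "set z - set a = {j}"
  shows "\<exists>j\<in>set b - set a. \<exists>z\<in>P. set z - set a = {j}"
proof -
  have "j \<notin> set a" using assms(3) by (metis DiffD2 singletonI)
  then show ?thesis using assms by (intro bexI[of _ j] bexI[of _ z]) simp_all
qed

text \<open>The increasing lexicographic order on \<open>X\<close> works if \<open>X\<close>, together with \<open>S\<close>, contains the lists produced by
  \<open>lex_exchange\<close>; these are smaller than \<open>x\<close> and begin like \<open>x\<close> or like \<open>y\<close>.\<close>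

lemma lq_set_lex:
  assumes "lq_set S" "finite X" "X \<inter> S = {}" "t \<ge> 1"
    and X: "\<And>x. x \<in> X \<Longrightarrow> x \<in> spread_lists n d t"
    and SX: "\<And>x b. x \<in> X \<Longrightarrow> b \<in> S \<Longrightarrow>
               \<exists>j\<in>set b - set x. \<exists>z\<in>S \<union> {y\<in>X. y < x}. set z - set x = {j}"
    and XX: "\<And>x y z. x \<in> X \<Longrightarrow> y \<in> X \<Longrightarrow> z \<in> spread_lists n d t \<Longrightarrow> z < x \<Longrightarrow> hd z \<in> {hd x, hd y} \<Longrightarrow>
               z \<in> S \<union> X"
  shows "lq_set (S \<union> X)"
proof (rule lq_set_add_ordered[of S X "(<)"])
  fix x assume x: "x \<in> X"
  show "exchangeable (S \<union> {y \<in> X. y < x}) x"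
    unfolding exchangeable_def
  proof
    fix b assume "b \<in> S \<union> {y \<in> X. y < x}"
    then consider "b \<in> S" | "b \<in> X" "b < x" by blast
    then show "\<exists>j\<in>set b - set x. \<exists>z\<in>S \<union> {y \<in> X. y < x}. set z - set x = {j}"
    proof cases
      case 1
      then show ?thesis using SX x by simp
    next
      case 2
      have xb: "x \<in> spread_lists n d t" "b \<in> spread_lists n d t" using X x 2(1) by simp_all
      then have "length x = length b" "spread t x" "spread t b" by (auto simp: spread_lists_def)
      from lex_exchange[OF this 2(2) \<open>t \<ge> 1\<close>]
      obtain z j where z: "spread t z" "length z = length x" "set z \<subseteq> set x \<union> set b" "z < x"
        "j \<in> set b" "set z - set x = {j}" "hd z \<in> {hd x, hd b}"
        by (elim exE conjE)
      have "z \<in> spread_lists n d t" using z(1,2,3) xb by (auto simp: spread_lists_def)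
      from XX[OF x 2(1) this z(4,7)] have "z \<in> S \<union> {y \<in> X. y < x}" using z(4) by blast
      then show ?thesis by (rule exchangeI[OF z(5) _ z(6)])
    qed
  qed
qed (use assms in auto)

text \<open>By induction on the length. If \<open>e = c\<close>, the common head is put in front of an order for the tails. Otherwise
  the segment consists of the lists with head strictly between \<open>e\<close> and \<open>c\<close>, of the \<open>e # a\<close> with \<open>u' \<le> a\<close>, and
  of the \<open>c # b\<close> with \<open>b \<le> v'\<close>.

  If \<open>u' \<le> b\<close> for all these \<open>b\<close>, the three families are added in this order, the middle one starting with the
  largest last entries. Then the exchange for \<open>e # a\<close> raises entries, which cannot lead below \<open>u'\<close>, and for
  \<open>c # b\<close> the list \<open>e # b\<close> has come before.

  If \<open>b < u'\<close> for some such \<open>b\<close>, then all entries of \<open>u'\<close> are at least \<open>c + t\<close>, and every head up to \<open>c\<close> can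
  be put in front of each \<open>a \<ge> u'\<close>. The lists with head greater than \<open>e\<close> are added first in lexicographic
  order, then the \<open>e # a\<close> with \<open>a \<le> v'\<close> in an order that the induction hypothesis provides, and then those
  with \<open>v' < a\<close> in lexicographic order. In the last step an entry of \<open>a\<close> must be lowered, and the result stays
  above the shift of \<open>c # a\<close>, hence above \<open>u'\<close> by the condition.\<close>

theorem lq_set_seg:
  assumes "t \<ge> 1" "u \<in> spread_lists n d t" "v \<in> spread_lists n d t" "u \<le> v" "linearity_cond n t u v"
  shows "lq_set (seg n d t u v)"
  using assms(2-)
proof (induction d arbitrary: u v)
  case 0
  have "seg n 0 t u v = insert [] {}" using 0 by (auto simp: seg_def)
  then show ?case using lq_set_insert[OF lq_set_empty, of "[]"] by (simp add: exchangeable_def)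
next
  case (Suc d)
  obtain e u' where u: "u = e # u'" "e \<in> {1..n}" "\<forall>y\<in>set u'. e + t \<le> y" "u' \<in> spread_lists n d t"
    using Suc.prems(1) by (rule spread_lists_SucE)
  obtain c v' where v: "v = c # v'" "c \<in> {1..n}" "\<forall>y\<in>set v'. c + t \<le> y" "v' \<in> spread_lists n d t"
    using Suc.prems(2) by (rule spread_lists_SucE)
  have e_cons: "e # a \<in> spread_lists n (Suc d) t" if "a \<in> spread_lists n d t" "u' \<le> a" for a
    using spread_lists_lower[OF u(4) that u(3)] that u(2) by (simp add: Cons_spread_lists)
  have lenv: "length v' = d" using v(4) by (simp add: spread_lists_def)
  show ?case
  proof (cases "e = c")
    case True
    have seg: "seg n (Suc d) t u v = (#) e ` seg n d t u' v'"
    proof (rule subset_antisym; rule subsetI)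
      fix l assume "l \<in> seg n (Suc d) t u v"
      then have l: "l \<in> spread_lists n (Suc d) t" "u \<le> l" "l \<le> v" by (auto simp: seg_def)
      obtain x l' where "l = x # l'" "l' \<in> spread_lists n d t" using l(1) by (rule spread_lists_SucE)
      then show "l \<in> (#) e ` seg n d t u' v'" using l u(1) v(1) True by (auto simp: seg_def)
    next
      fix l assume "l \<in> (#) e ` seg n d t u' v'"
      then obtain l' where "l = e # l'" "l' \<in> spread_lists n d t" "u' \<le> l'" "l' \<le> v'"
        by (auto simp: seg_def)
      then show "l \<in> seg n (Suc d) t u v"
        using e_cons[of l'] u(1) v(1) True by (simp add: seg_def)
    qed
    have "lq_set (seg n d t u' v')"
      using Suc.prems u v True by (intro Suc.IH) simp_all
    then have "lq_set ({} \<union> (#) e ` seg n d t u' v')"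
    proof (rule lq_set_add_Cons[OF _ lq_set_empty])
      fix x assume "x \<in> seg n d t u' v'"
      then have "\<forall>y\<in>set x. e + t \<le> y"
        by (intro spread_lists_lower[OF u(4) _ _ u(3)]) (simp_all add: seg_def)
      then show "e \<notin> set x" using \<open>t \<ge> 1\<close> by fastforce
    qed simp_all
    then show ?thesis using seg by simp
  next
    case False
    then have ec: "e < c" using Suc.prems(3) u(1) v(1) by simp
    have cond: "u' \<le> map (\<lambda>i. i + t) (butlast (c # w))"
      if "c # w \<in> spread_lists n (Suc d) t" "v' < w" for w
      using Suc.prems(4) False that by (simp add: u(1) v(1) lenv)
    define S0 where "S0 = {l \<in> spread_lists n (Suc d) t. e < hd l \<and> hd l < c}"
    define A where "A = {a \<in> spread_lists n d t. u' \<le> a}"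
    define C where "C = {b. c # b \<in> spread_lists n (Suc d) t \<and> b \<le> v'}"
    have finS0: "finite S0" unfolding S0_def
      by (rule finite_subset[OF _ finite_spread_lists[of n "Suc d" t]]) auto
    have finA: "finite A" unfolding A_def
      by (rule finite_subset[OF _ finite_spread_lists[of n d t]]) auto
    have finC: "finite C" unfolding C_def
      by (rule finite_subset[OF _ finite_spread_lists[of n d t]]) (auto simp: Cons_spread_lists)
    have Ae: "\<forall>y\<in>set a. e + t \<le> y" if "a \<in> A" for a
      using that by (intro spread_lists_lower[OF u(4) _ _ u(3)]) (simp_all add: A_def)
    have e_notin: "e \<notin> set a" if "a \<in> A" for a
      using Ae[OF that] \<open>t \<ge> 1\<close> by fastforce
    have seg: "seg n (Suc d) t u v = S0 \<union> (#) e ` A \<union> (#) c ` C"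
    proof (rule subset_antisym; rule subsetI)
      fix l assume "l \<in> seg n (Suc d) t u v"
      then have l: "l \<in> spread_lists n (Suc d) t" "u \<le> l" "l \<le> v" by (auto simp: seg_def)
      obtain x l' where l': "l = x # l'" "l' \<in> spread_lists n d t" using l(1) by (rule spread_lists_SucE)
      consider "x = e" | "x = c" | "e < x" "x < c" using l(2,3) l'(1) u(1) v(1) by fastforce
      then show "l \<in> S0 \<union> (#) e ` A \<union> (#) c ` C"
        by cases (use l l' u(1) v(1) ec in \<open>auto simp: S0_def A_def C_def\<close>)
    next
      fix l assume "l \<in> S0 \<union> (#) e ` A \<union> (#) c ` C"
      then consider "l \<in> S0" | a where "a \<in> A" "l = e # a" | b where "b \<in> C" "l = c # b" by blast
      then show "l \<in> seg n (Suc d) t u v"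
      proof cases
        case 1
        then show ?thesis
          by (cases l) (auto simp: S0_def seg_def u(1) v(1) spread_lists_def)
      next
        case 2
        then show ?thesis using e_cons ec by (auto simp: A_def seg_def u(1) v(1))
      next
        case 3
        then show ?thesis using ec by (auto simp: C_def seg_def u(1) v(1))
      qed
    qed
    have S0_hd: "\<exists>x l'. l = x # l' \<and> e < x \<and> x < c" if "l \<in> S0" for l
      using that by (cases l) (auto simp: S0_def spread_lists_def)
    have S0I: "j # a \<in> S0" if "a \<in> spread_lists n d t" "\<forall>y\<in>set a. j + t \<le> y" "e < j" "j < c" for a j
      using that v(2) by (simp add: S0_def Cons_spread_lists)
    have pre: "set (j # a) - set (e # a) = {j}" if "\<forall>y\<in>set a. j + t \<le> y" "e < j" for a j
    proof -
      have "j \<notin> set a" using that(1) \<open>t \<ge> 1\<close> by fastforce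
      then show ?thesis using that(2) by auto
    qed
    show ?thesis
    proof (cases "\<forall>b\<in>C. u' \<le> b")
      case True
      have 1: "lq_set ({} \<union> S0)"
      proof (rule lq_set_lex[OF lq_set_empty finS0 _ \<open>t \<ge> 1\<close>])
        fix x y z assume "x \<in> S0" "y \<in> S0" "z \<in> spread_lists n (Suc d) t" "hd z \<in> {hd x, hd y}"
        then show "z \<in> {} \<union> S0" by (auto simp: S0_def)
      qed (auto simp: S0_def)
      have disj1: "(#) e ` A \<inter> S0 = {}" using S0_hd by fastforce
      have 2: "lq_set (S0 \<union> (#) e ` A)"
      proof (rule lq_set_add_ordered[of S0 "(#) e ` A" "\<lambda>x y. rev y < rev x"])
        fix x assume "x \<in> (#) e ` A"
        then obtain a where a: "x = e # a" "a \<in> A" by blast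
        have sa: "a \<in> spread_lists n d t" "u' \<le> a" using a(2) by (simp_all add: A_def)
        define P where "P = S0 \<union> {y \<in> (#) e ` A. rev x < rev y}"
        \<comment> \<open>Raising an entry of \<open>a\<close> gives a list above \<open>u'\<close> that comes earlier in this order.\<close>
        have up: "\<exists>j\<in>set b - set x. \<exists>z\<in>P. set z - set x = {j}"
          if z: "spread t z" "list_all2 (\<le>) a z" "set z \<subseteq> set a \<union> set b'" "j \<in> set b'"
             "set z - set a = {j}" "rev a < rev z" and b': "b' \<in> spread_lists n d t" "set b' \<subseteq> set b"
             "e \<notin> set b'" for z j b b'
        proof (rule exchangeI)
          show "j \<in> set b" using z(4) b'(2) by blast
          have "length z = d" using sa z(2) by (simp add: spread_lists_def list_all2_lengthD)
          then have zs: "z \<in> spread_lists n d t" using z(1,3) sa b'(1) by (auto simp: spread_lists_def)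
          have "a \<le> z" by (rule list_all2_le_imp_le[OF z(2)])
          then have "z \<in> A" using zs sa(2) by (simp add: A_def)
          moreover have "rev x < rev (e # z)"
            using append_less_append[of "rev a" "rev z"] z(2,6) a(1) by (simp add: list_all2_lengthD)
          ultimately show "e # z \<in> P" by (simp add: P_def)
          have "j \<noteq> e" using z(4) b'(3) by blast
          have "e \<notin> set z" using e_notin \<open>z \<in> A\<close> by simp
          then show "set (e # z) - set x = {j}" using z(5) \<open>j \<noteq> e\<close> a(1) by auto
        qed
        show "exchangeable (S0 \<union> {y \<in> (#) e ` A. rev x < rev y}) x"
          unfolding exchangeable_def P_def[symmetric]
        proof
          fix b assume "b \<in> P"
          then consider "b \<in> S0" | b' where "b' \<in> A" "b = e # b'" "rev x < rev b"
            unfolding P_def by blast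
          then show "\<exists>j\<in>set b - set x. \<exists>z\<in>P. set z - set x = {j}"
          proof cases
            case 1
            then obtain i b' where b: "b = i # b'" "e < i" "i < c" using S0_hd by blast
            have b': "b' \<in> spread_lists n d t" "\<forall>y\<in>set b'. i + t \<le> y"
              using 1 b(1) by (simp_all add: S0_def Cons_spread_lists)
            show ?thesis
            proof (cases "\<forall>y\<in>set a. i + t \<le> y")
              case True
              have "set (i # a) - set x = {i}" using pre[OF True b(2)] a(1) by simp
              moreover have "i # a \<in> P" using S0I[OF sa(1) True b(2,3)] by (simp add: P_def)
              moreover have "i \<in> set b" using b(1) by simp
              ultimately show ?thesis by (intro exchangeI)
            next
              case False
              then obtain h a' where ha: "a = h # a'" by (cases a) auto
              have "spread t a" using sa(1) by (simp add: spread_lists_def)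
              then have "h < i + t" using False ha by fastforce
              moreover obtain h' b'' where hb: "b' = h' # b''"
                using sa(1) b'(1) ha by (cases b') (auto simp: spread_lists_def)
              moreover have "i + t \<le> h'" using b'(2) hb by simp
              ultimately have lt: "hd a < hd b'" using ha by simp
              have "length a = length b'" "spread t b'" "a \<noteq> []"
                using sa(1) b'(1) ha by (simp_all add: spread_lists_def)
              from chain_exchange[OF this(1,3) \<open>spread t a\<close> this(2) lt \<open>t \<ge> 1\<close>]
              obtain z j where z: "spread t z" "set z \<subseteq> set a \<union> set b'" "list_all2 (\<le>) a z"
                "j \<in> set b'" "set z - set a = {j}" "rev a < rev z" by (elim exE conjE)
              have "e \<notin> set b'" using b'(2) b(2) by fastforce
              moreover have "set b' \<subseteq> set b" using b(1) by auto
              ultimately show ?thesis using up[OF z(1,3,2,4,5,6) b'(1)] by simp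
            qed
          next
            case 2
            have b': "b' \<in> spread_lists n d t" using 2(1) by (simp add: A_def)
            have "length a = length b'" "spread t a" "spread t b'"
              using sa(1) b' by (simp_all add: spread_lists_def)
            moreover have "rev a < rev b'"
            proof (rule ccontr)
              assume "\<not> rev a < rev b'"
              then have "rev b' < rev a \<or> rev b' = rev a"
                using less_linear[of "rev a" "rev b'"] by metis
              then have "\<not> rev x < rev b"
              proof
                assume "rev b' < rev a"
                then have "rev b < rev x"
                  using append_less_append[of "rev b'" "rev a"] \<open>length a = length b'\<close> 2(2) a(1)
                  by simp
                then show ?thesis by simp
              next
                assume "rev b' = rev a"
                then show ?thesis using 2(2) a(1) by simp
              qed
              then show False using 2(3) by simp
            qed
            ultimately have "\<exists>z j. spread t z \<and> set z \<subseteq> set a \<union> set b' \<and> list_all2 (\<le>) a z \<and>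
                j \<in> set b' \<and> set z - set a = {j} \<and> rev a < rev z"
              by (rule rev_exchange[OF _ _ _ _ \<open>t \<ge> 1\<close>])
            then obtain z j where z: "spread t z" "set z \<subseteq> set a \<union> set b'" "list_all2 (\<le>) a z"
                "j \<in> set b'" "set z - set a = {j}" "rev a < rev z"
              by (elim exE conjE)
            have "set b' \<subseteq> set b" using 2(2) by auto
            then show ?thesis using up[OF z(1,3,2,4,5,6) b'] e_notin[OF 2(1)] by simp
          qed
        qed
      next
        show "asymp_on ((#) e ` A) (\<lambda>x y. rev y < rev x)" by (rule asymp_onI) simp
        show "transp_on ((#) e ` A) (\<lambda>x y. rev y < rev x)" by (rule transp_onI) (rule less_trans)
        show "totalp_on ((#) e ` A) (\<lambda>x y. rev y < rev x)"
          by (rule totalp_onI) (metis neqE rev_is_rev_conv)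
      qed (use 1 finA disj1 in simp_all)
      have "lq_set ((S0 \<union> (#) e ` A) \<union> (#) c ` C)"
      proof (rule lq_set_lex[OF 2 _ _ \<open>t \<ge> 1\<close>])
        show "finite ((#) c ` C)" using finC by simp
        show "(#) c ` C \<inter> (S0 \<union> (#) e ` A) = {}" using S0_hd ec by fastforce
        fix x assume "x \<in> (#) c ` C"
        then obtain b where b: "x = c # b" "b \<in> C" by blast
        show "x \<in> spread_lists n (Suc d) t" using b by (simp add: C_def)
        then have bs: "b \<in> spread_lists n d t" "\<forall>y\<in>set b. c + t \<le> y"
          using b(1) by (simp_all add: Cons_spread_lists)
        have xs: "length x = Suc d" "spread t x" "set x \<subseteq> {1..n}"
          using \<open>x \<in> spread_lists n (Suc d) t\<close> by (simp_all add: spread_lists_def)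
        {
          fix y assume "y \<in> S0 \<union> (#) e ` A"
          then consider "y \<in> S0" | a where "a \<in> A" "y = e # a" by blast
          then show "\<exists>j\<in>set y - set x. \<exists>z\<in>S0 \<union> (#) e ` A \<union> {y \<in> (#) c ` C. y < x}. set z - set x = {j}"
          proof cases
            case 1
            then have y: "length y = Suc d" "spread t y" "set y \<subseteq> {1..n}"
              by (simp_all add: S0_def spread_lists_def)
            obtain i y' where i: "y = i # y'" "e < i" "i < c" using 1 S0_hd by blast
            have "y < x" using i b(1) by simp
            have "length x = length y" using xs(1) y(1) by simp
            from lex_exchange[OF this xs(2) y(2) \<open>y < x\<close> \<open>t \<ge> 1\<close>]
            obtain z j where z: "spread t z" "length z = length x" "set z \<subseteq> set x \<union> set y" "z < x"
               "j \<in> set y" "set z - set x = {j}" "hd z \<in> {hd x, hd y}"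
              by (elim exE conjE)
            have zs: "z \<in> spread_lists n (Suc d) t" using z(1,2,3) xs y by (auto simp: spread_lists_def)
            obtain k z' where k: "z = k # z'" using z(2) xs(1) by (cases z) auto
            have "k = c \<or> k = i" using z(7) k i(1) b(1) by simp
            then have "z \<in> S0 \<union> (#) e ` A \<union> {y \<in> (#) c ` C. y < x}"
            proof
              assume "k = c"
              then have "z' \<le> b" using z(4) k b(1) by simp
              then have "z' \<in> C" using zs b(2) k \<open>k = c\<close> by (auto simp: C_def)
              then show ?thesis using k \<open>k = c\<close> z(4) by simp
            next
              assume "k = i"
              then show ?thesis using zs k i by (simp add: S0_def)
            qed
            then show ?thesis by (rule exchangeI[OF z(5) _ z(6)])
          next
            case 2
            have "b \<in> A" using True b(2) bs(1) by (simp add: A_def)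
            then have "e # b \<in> S0 \<union> (#) e ` A \<union> {y \<in> (#) c ` C. y < x}" by simp
            moreover have "set (e # b) - set x = {e}"
              using e_notin[OF \<open>b \<in> A\<close>] ec b(1) by auto
            moreover have "e \<in> set y" using 2(2) by simp
            ultimately show ?thesis by (intro exchangeI)
          qed
        }
        fix y z assume yz: "y \<in> (#) c ` C" "z \<in> spread_lists n (Suc d) t" "z < x" "hd z \<in> {hd x, hd y}"
        obtain k z' where k: "z = k # z'" using yz(2) by (rule spread_lists_SucE)
        have "k = c" using k yz(1,4) b(1) by auto
        then have "z' \<in> C" using yz(2,3) k b by (auto simp: C_def)
        then show "z \<in> S0 \<union> (#) e ` A \<union> (#) c ` C" using k \<open>k = c\<close> by simp
      qed
      then show ?thesis using seg by simp
    next
      case False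
      then obtain b0 where b0: "b0 \<in> C" "b0 < u'" by force
      have b0': "\<forall>y\<in>set b0. c + t \<le> y" "b0 \<in> spread_lists n d t"
        using b0(1) by (simp_all add: C_def Cons_spread_lists)
      \<comment> \<open>the entries of \<open>b0\<close> exceed \<open>c\<close> by at least \<open>t\<close>, and \<open>b0 < u'\<close>\<close>
      have uc: "\<forall>y\<in>set u'. c + t \<le> y"
        by (rule spread_lists_lower[OF b0'(2) u(4) _ b0'(1)]) (use b0(2) in simp)
      have Ac: "\<forall>y\<in>set a. c + t \<le> y" if "a \<in> A" for a
        using that by (intro spread_lists_lower[OF u(4) _ _ uc]) (simp_all add: A_def)
      define B where "B = S0 \<union> (#) c ` C"
      have B_iff: "i # b \<in> B \<longleftrightarrow> i # b \<in> spread_lists n (Suc d) t \<and> e < i \<and> i # b \<le> v" for i b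
        using ec by (auto simp: B_def S0_def C_def v(1))
      have BI: "i # a \<in> B" if "e < i" "i \<le> c" "a \<in> A" "i < c \<or> a \<le> v'" for i a
        using that Ac[OF that(3)] v(2) by (fastforce simp: B_iff Cons_spread_lists A_def v(1))
      have BE: "\<exists>i b'. b = i # b' \<and> e < i \<and> i \<le> c \<and> b' \<in> spread_lists n d t \<and>
                  (\<forall>y\<in>set b'. i + t \<le> y) \<and> (i < c \<or> b' \<le> v')"
        if "b \<in> B" for b
      proof -
        have "b \<in> spread_lists n (Suc d) t" using that by (auto simp: B_def S0_def C_def)
        then obtain i b' where b: "b = i # b'" "\<forall>y\<in>set b'. i + t \<le> y" "b' \<in> spread_lists n d t"
          by (rule spread_lists_SucE)
        then show ?thesis using that B_iff[of i b'] by (auto simp: v(1))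
      qed
      have lqB: "lq_set ({} \<union> B)"
      proof (rule lq_set_lex[OF lq_set_empty _ _ \<open>t \<ge> 1\<close>])
        show "finite B" using finS0 finC by (simp add: B_def)
        show "x \<in> spread_lists n (Suc d) t" if "x \<in> B" for x using that by (auto simp: B_def S0_def C_def)
        fix x y z assume xyz: "x \<in> B" "y \<in> B" "z \<in> spread_lists n (Suc d) t" "z < x" "hd z \<in> {hd x, hd y}"
        obtain i x' where x: "x = i # x'" using BE[OF xyz(1)] by blast
        obtain j y' where y: "y = j # y'" using BE[OF xyz(2)] by blast
        obtain k z' where z: "z = k # z'" using xyz(3) by (rule spread_lists_SucE)
        have "e < k" using xyz(1,2,5) B_iff[of i x'] B_iff[of j y'] by (auto simp: x y z)
        moreover have "z \<le> v" using xyz(1,4) B_iff[of i x'] x by auto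
        ultimately show "z \<in> {} \<union> B" using xyz(3) B_iff[of k z'] z by simp
      qed simp_all
      \<comment> \<open>Against a list \<open>b\<close> with greater head \<open>i\<close>, the head \<open>e\<close> is replaced by \<open>i\<close>.\<close>
      have prep: "\<exists>j\<in>set b - set (e # a). \<exists>z\<in>B. set z - set (e # a) = {j}"
        if ab: "a \<in> A" "b \<in> B" "a \<le> v' \<or> hd b < c" for a b
      proof -
        obtain i b' where b: "b = i # b'" "e < i" "i \<le> c" using BE[OF ab(2)] by blast
        have "\<forall>y\<in>set a. i + t \<le> y" using Ac[OF ab(1)] b(3) by fastforce
        from pre[OF this b(2)] have "set (i # a) - set (e # a) = {i}" .
        moreover have "i # a \<in> B" using BI[OF b(2,3) ab(1)] ab(3) b(1,3) by auto
        moreover have "i \<in> set b" using b(1) by simp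
        ultimately show ?thesis by (intro exchangeI)
      qed
      define T1 where "T1 = seg n d t u' v'"
      define T2 where "T2 = {a \<in> A. v' < a}"
      have T1A: "a \<in> A" "a \<le> v'" if "a \<in> T1" for a
        using that by (simp_all add: T1_def seg_def A_def)
      have A_split: "A = T1 \<union> T2" by (auto simp: A_def T1_def T2_def seg_def)
      have "lq_set T1"
      proof (cases "u' \<le> v'")
        case True
        have "linearity_cond n t u' v'"
        proof (rule linearity_cond_tail[OF u(4) v(4) True uc])
          fix w assume w: "w \<in> spread_lists n d t" "v' < w"
          have "\<forall>y\<in>set w. c + t \<le> y"
            by (rule spread_lists_lower[OF v(4) w(1) _ v(3)]) (use w(2) in simp)
          then have "c # w \<in> spread_lists n (Suc d) t" using w(1) v(2) by (simp add: Cons_spread_lists)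
          then show "u' \<le> map (\<lambda>i. i + t) (butlast (c # w))" by (rule cond[OF _ w(2)])
        qed
        then show ?thesis unfolding T1_def by (rule Suc.IH[OF u(4) v(4) True])
      next
        case False
        then have "T1 = {}" by (auto simp: T1_def seg_def)
        then show ?thesis by (simp add: lq_set_empty)
      qed
      then have lq1: "lq_set (B \<union> (#) e ` T1)"
      proof (rule lq_set_add_Cons)
        show "lq_set B" using lqB by simp
        show "e \<notin> set x" if "x \<in> T1" for x using e_notin T1A(1) that by simp
        show "(#) e ` T1 \<inter> B = {}" using BE by fastforce
        show "\<exists>j\<in>set b - set (e # x). \<exists>z\<in>B. set z - set (e # x) = {j}"
          if "x \<in> T1" "b \<in> B" for x b
          using prep T1A that by simp
      qed
      have "lq_set ((B \<union> (#) e ` T1) \<union> (#) e ` T2)"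
      proof (rule lq_set_add_ordered[of _ _ "(<)"])
        fix x assume "x \<in> (#) e ` T2"
        then obtain a where a: "x = e # a" "a \<in> A" "v' < a" by (auto simp: T2_def)
        define P where "P = B \<union> (#) e ` T1 \<union> {y \<in> (#) e ` T2. y < x}"
        have PI: "e # z \<in> P" if "z \<in> A" "z < a" for z
          using that a(1) by (auto simp: P_def A_split)
        have sa: "a \<in> spread_lists n d t" using a(2) by (simp add: A_def)
        have "c # a \<in> spread_lists n (Suc d) t" using Ac[OF a(2)] sa v(2) by (simp add: Cons_spread_lists)
        then have shift: "u' \<le> map (\<lambda>i. i + t) (butlast (c # a))" using cond a(3) by simp
        \<comment> \<open>Lowering an entry of \<open>a\<close>. The condition is used for the list \<open>c # a\<close>, which lies beyond \<open>v\<close>.\<close>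
        have down: "\<exists>j\<in>set b - set x. \<exists>z\<in>P. set z - set x = {j}"
          if b': "b' \<in> spread_lists n d t" "b' < a" "\<forall>y\<in>set b'. c + t \<le> y" "set b' \<subseteq> set b" for b b'
        proof -
          have "length a = length b'" "spread t a" "spread t b'"
            using sa b'(1) by (simp_all add: spread_lists_def)
          from lex_exchange[OF this b'(2) \<open>t \<ge> 1\<close>]
          obtain z j where z: "spread t z" "length z = length a" "set z \<subseteq> set a \<union> set b'" "z < a"
            "j \<in> set b'" "set z - set a = {j}"
            and zc: "\<forall>c. (\<forall>k\<in>set a \<union> set b'. c + t \<le> k) \<longrightarrow>
              list_all2 (\<le>) (map (\<lambda>i. i + t) (butlast (c # a))) z"
            by (elim exE conjE)
          have "\<forall>k\<in>set a \<union> set b'. c + t \<le> k" using Ac[OF a(2)] b'(3) by blast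
          then have "list_all2 (\<le>) (map (\<lambda>i. i + t) (butlast (c # a))) z" using zc by simp
          then have "map (\<lambda>i. i + t) (butlast (c # a)) \<le> z" by (rule list_all2_le_imp_le)
          then have "u' \<le> z" using shift by simp
          moreover have "z \<in> spread_lists n d t" using z(1,2,3) sa b'(1) by (auto simp: spread_lists_def)
          ultimately have zA: "z \<in> A" by (simp add: A_def)
          have "j \<noteq> e" using z(5) b'(3) ec by fastforce
          then have "set (e # z) - set x = {j}" using z(6) e_notin[OF zA] a(1) by auto
          moreover have "j \<in> set b" using z(5) b'(4) by blast
          ultimately show ?thesis using PI[OF zA z(4)] by (intro exchangeI)
        qed
        show "exchangeable (B \<union> (#) e ` T1 \<union> {y \<in> (#) e ` T2. y < x}) x"
          unfolding exchangeable_def P_def[symmetric]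
        proof
          fix b assume "b \<in> P"
          then consider "b \<in> B" "hd b < c" | "b \<in> B" "\<not> hd b < c" | b' where "b' \<in> A" "b = e # b'" "b' < a"
            using a(1,3) T1A by (fastforce simp: P_def T2_def)
          then show "\<exists>j\<in>set b - set x. \<exists>z\<in>P. set z - set x = {j}"
          proof cases
            case 1
            then have "\<exists>j\<in>set b - set (e # a). \<exists>z\<in>B. set z - set (e # a) = {j}"
              using prep a(2) by simp
            then obtain j z where "j \<in> set b - set x" "z \<in> B" "set z - set x = {j}"
              unfolding a(1) by (elim bexE)
            moreover have "z \<in> P" using calculation(2) by (simp add: P_def)
            ultimately show ?thesis by (intro bexI)
          next
            case 2
            obtain i b' where b: "b = i # b'" "i \<le> c" "b' \<in> spread_lists n d t" "\<forall>y\<in>set b'. i + t \<le> y"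
              "i < c \<or> b' \<le> v'" using BE[OF 2(1)] by blast
            have "i = c" using 2(2) b(1,2) by simp
            then have "b' < a" "\<forall>y\<in>set b'. c + t \<le> y" using b(4,5) a(3) by auto
            moreover have "set b' \<subseteq> set b" using b(1) by auto
            ultimately show ?thesis using down[OF b(3)] by simp
          next
            case 3
            have "b' \<in> spread_lists n d t" using 3(1) by (simp add: A_def)
            moreover have "set b' \<subseteq> set b" using 3(2) by auto
            ultimately show ?thesis using down 3(3) Ac[OF 3(1)] by simp
          qed
        qed
      next
        show "finite ((#) e ` T2)" using finA by (simp add: T2_def)
        show "(#) e ` T2 \<inter> (B \<union> (#) e ` T1) = {}"
          using BE T1A by (fastforce simp: T2_def)
      qed (use lq1 in simp_all)
      moreover have "(B \<union> (#) e ` T1) \<union> (#) e ` T2 = seg n (Suc d) t u v"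
        unfolding seg A_split B_def by blast
      ultimately show ?thesis by simp
    qed
  qed
qed

section \<open>The interleaving cochain\<close>

text \<open>The comparison of counting functions means that each entry of \<open>xs\<close> is at most the corresponding entry of
  \<open>ys\<close>.\<close>

lemma count_imp_le:
  fixes xs ys :: "nat list"
  assumes "length xs = length ys" "sorted_wrt (<) xs" "sorted_wrt (<) ys"
    and "\<And>x. card {z\<in>set ys. z \<le> x} \<le> card {z\<in>set xs. z \<le> x}"
  shows "xs \<le> ys"
proof -
  have conv: "card {z\<in>set l. z \<le> x} = length (filter (\<lambda>z. z \<le> x) l)" if "sorted_wrt (<) l"
    for l :: "nat list" and x
  proof -
    have "distinct l" using that strict_sorted_iff by blast
    then have "distinct (filter (\<lambda>z. z \<le> x) l)" by simp
    from distinct_card[OF this] show ?thesis by simp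
  qed
  have "\<And>x. length (filter (\<lambda>z. z \<le> x) ys) \<le> length (filter (\<lambda>z. z \<le> x) xs)"
    using assms(4) conv[OF assms(2)] conv[OF assms(3)] by simp
  with assms(1) show ?thesis using assms(2,3)
  proof (induction xs ys rule: list_induct2)
    case (Cons a xs b ys)
    have "0 < length (filter (\<lambda>z. z \<le> b) (b # ys))" by simp
    then have "filter (\<lambda>z. z \<le> b) (a # xs) \<noteq> []" using Cons.prems(1)[of b] by (metis leD length_greater_0_conv order_less_le_trans)
    then obtain z where "z \<in> set (a # xs)" "z \<le> b" by (metis filter_False)
    then have ab: "a \<le> b" using Cons.prems(2) by auto
    show ?case
    proof (cases "a = b")
      case True
      have "length (filter (\<lambda>z. z \<le> x) ys) \<le> length (filter (\<lambda>z. z \<le> x) xs)" for x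
        using Cons.prems(1)[of x] True by (auto split: if_splits)
      then have "xs \<le> ys" using Cons by simp
      then show ?thesis using True by simp
    qed (use ab in simp)
  qed simp
qed

lemma spread_strict: "t \<ge> 1 \<Longrightarrow> spread t l \<Longrightarrow> sorted_wrt (<) l"
  unfolding spread_def by (erule sorted_wrt_mono_rel[rotated]) auto

text \<open>\<open>F\<close> has exactly one element in each of the intervals into which the elements of \<open>E\<close> cut the line, an element
  of \<open>E\<close> being the right end of its interval, and none beyond the last one.\<close>

definition interleaves :: "nat set \<Rightarrow> nat set \<Rightarrow> nat set \<Rightarrow> bool" where
  "interleaves E V F \<longleftrightarrow> F \<subseteq> V \<and> card F = card E \<and>
     (\<forall>x\<in>E. card {f\<in>F. f \<le> x} = card {y\<in>E. y \<le> x})"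

text \<open>Equality holds at the elements of \<open>E\<close>, and in between only the count of \<open>F\<close> can grow.\<close>

lemma interleaves_ge:
  assumes "finite E" "finite V" "interleaves E V F"
  shows "card {y\<in>E. y \<le> x} \<le> card {f\<in>F. f \<le> x}"
proof (cases "{y\<in>E. y \<le> x} = {}")
  case False
  define m where "m = Max {y\<in>E. y \<le> x}"
  have fin: "finite {y\<in>E. y \<le> x}" using assms(1) by simp
  have m: "m \<in> E" "m \<le> x" using Max_in[OF fin False] by (auto simp: m_def)
  have "{y\<in>E. y \<le> x} = {y\<in>E. y \<le> m}"
    using m(2) Max_ge[OF fin] by (auto simp: m_def)
  then have "card {y\<in>E. y \<le> x} = card {f\<in>F. f \<le> m}"
    using assms(3) m(1) by (simp add: interleaves_def)
  also have "\<dots> \<le> card {f\<in>F. f \<le> x}"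
    using m(2) assms(2,3) by (intro card_mono) (auto simp: interleaves_def intro: finite_subset)
  finally show ?thesis .
next
  case True
  then show ?thesis by (metis card.empty zero_le)
qed

text \<open>Up to \<open>x\<close>, the set \<open>F - {s}\<close> has at most one element more than \<open>E\<close> has before \<open>x\<close>, namely the one in the
  interval that contains \<open>x\<close>. If \<open>x\<close> lies beyond \<open>E\<close>, the additional element is \<open>s\<close>.\<close>

lemma interleaves_le:
  assumes "finite E" "finite F" "interleaves E V (F - {s})" "s \<in> F" "\<forall>x\<in>E. x < s"
  shows "card {f\<in>F. f \<le> x} \<le> Suc (card {y\<in>E. y < x})"
proof (cases "{y\<in>E. x \<le> y} = {}")
  case False
  define m where "m = Min {y\<in>E. x \<le> y}"
  have fin: "finite {y\<in>E. x \<le> y}" using assms(1) by simp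
  have m: "m \<in> E" "x \<le> m" using Min_in[OF fin False] by (auto simp: m_def)
  have "card {f\<in>F. f \<le> x} \<le> card {f\<in>F - {s}. f \<le> m}"
    using m assms(2,5) by (intro card_mono) fastforce+
  also have "\<dots> = card {y\<in>E. y \<le> m}" using assms(3) m(1) by (simp add: interleaves_def)
  also have "{y\<in>E. y \<le> m} \<subseteq> insert m {y\<in>E. y < x}"
    using Min_le[OF fin] by (force simp: m_def)
  then have "card {y\<in>E. y \<le> m} \<le> card (insert m {y\<in>E. y < x})"
    using assms(1) by (intro card_mono) simp_all
  also have "\<dots> \<le> Suc (card {y\<in>E. y < x})"
    using assms(1) by (simp add: card_insert_if)
  finally show ?thesis .
next
  case True
  have "card {f\<in>F. f \<le> x} \<le> card F" using assms(2) by (intro card_mono) auto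
  also have "\<dots> = Suc (card (F - {s}))" using assms(2,4) by (metis card_Suc_Diff1)
  also have "card (F - {s}) = card E" using assms(3) by (simp add: interleaves_def)
  also have "E = {y\<in>E. y < x}" using True by fastforce
  finally show ?thesis .
qed

text \<open>Let \<open>I\<close> be the interval of \<open>E\<close> that contains \<open>s0\<close>. Removing \<open>s \<in> F\<close> leaves an interleaving set exactly when
  \<open>s\<close> lies in \<open>I\<close>. Two elements of \<open>F\<close> lie there; they are neighbours in \<open>F\<close>, so their signs are opposite.\<close>

lemma interleaves_cancel:
  fixes V E F :: "nat set" and s0 x :: nat
  defines "\<phi> \<equiv> (\<lambda>F. if interleaves E V F then 1 else (0::'k::comm_ring_1))"
  assumes "finite E" "finite V" "F \<subseteq> V" "s0 \<in> F" "interleaves E V (F - {s0})" "x \<in> E" "s0 \<le> x"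
  shows "cobdry \<phi> F = 0"
proof -
  have finF: "finite F" using assms by (auto intro: finite_subset)
  define N where "N y = card {f\<in>F. f \<le> y}" for y
  define k where "k y = card {z\<in>E. z \<le> y}" for y
  have rem: "card {f\<in>F - {s}. f \<le> y} + (if s \<le> y then 1 else 0) = N y" if "s \<in> F" for s y
  proof (cases "s \<le> y")
    case True
    then have "{f\<in>F. f \<le> y} = insert s {f\<in>F - {s}. f \<le> y}" using that by auto
    then show ?thesis using True finF by (simp add: N_def)
  next
    case False
    then have "{f\<in>F. f \<le> y} = {f\<in>F - {s}. f \<le> y}" by auto
    then show ?thesis using False by (simp add: N_def)
  qed
  have cardF: "card F = Suc (card E)"
    using assms(5,6) finF by (metis card_Suc_Diff1 interleaves_def)
  have good: "interleaves E V (F - {s}) \<longleftrightarrow> (\<forall>y\<in>E. N y = k y + (if s \<le> y then 1 else 0))" if "s \<in> F" for s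
  proof -
    have "card (F - {s}) = card E" using cardF that finF by simp
    moreover have "card {f\<in>F - {s}. f \<le> y} = k y \<longleftrightarrow> N y = k y + (if s \<le> y then 1 else 0)" for y
      using rem[OF that, of y] by auto
    ultimately show ?thesis using assms(4) by (auto simp: interleaves_def k_def)
  qed
  define U where "U = {y\<in>E. s0 \<le> y}"
  have finU: "finite U" "U \<noteq> {}" using assms by (auto simp: U_def)
  define x0 where "x0 = Min U"
  have x0: "x0 \<in> E" "s0 \<le> x0" using Min_in[OF finU] by (auto simp: x0_def U_def)
  have x0_le: "x0 \<le> y" if "y \<in> E" "s0 \<le> y" for y
    using Min_le[OF finU(1)] that by (simp add: x0_def U_def)
  define I where "I = {f\<in>F. f \<le> x0 \<and> (\<forall>y\<in>E. y < s0 \<longrightarrow> y < f)}"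
  have N0: "N y = k y + (if s0 \<le> y then 1 else 0)" if "y \<in> E" for y
    using good[OF assms(5)] assms(6) that by blast
  \<comment> \<open>At elements of \<open>E\<close>, the count of \<open>F\<close> exceeds that of \<open>E\<close> by one exactly from \<open>x0\<close> on, and \<open>I\<close> is the
      interval of \<open>E\<close> that ends in \<open>x0\<close>.\<close>
  have goodI: "interleaves E V (F - {s}) \<longleftrightarrow> s \<in> I" if "s \<in> F" for s
  proof
    assume "interleaves E V (F - {s})"
    then have eq: "s \<le> y \<longleftrightarrow> s0 \<le> y" if "y \<in> E" for y
      using good[OF \<open>s \<in> F\<close>] N0[OF that] that by (auto split: if_splits)
    show "s \<in> I" unfolding I_def using eq x0 \<open>s \<in> F\<close> by force
  next
    assume "s \<in> I"
    then have "s \<le> y \<longleftrightarrow> s0 \<le> y" if "y \<in> E" for y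
      using x0_le[OF that] that unfolding I_def by force
    then show "interleaves E V (F - {s})" using good[OF that] N0 by simp
  qed
  have cardI: "card I = 2"
  proof -
    define D where "D = {f\<in>F. \<exists>y\<in>E. y < s0 \<and> f \<le> y}"
    have D: "card D = card {y\<in>E. y < s0}"
    proof (cases "{y\<in>E. y < s0} = {}")
      case True
      then show ?thesis by (auto simp: D_def)
    next
      case False
      have fin: "finite {y\<in>E. y < s0}" using assms(2) by simp
      define m where "m = Max {y\<in>E. y < s0}"
      have m: "m \<in> E" "m < s0" using Max_in[OF fin False] by (auto simp: m_def)
      have m_ge: "y \<le> m" if "y \<in> E" "y < s0" for y
        using Max_ge[OF fin] that by (simp add: m_def)
      have "D = {f\<in>F. f \<le> m}" using m m_ge unfolding D_def by force
      then have "card D = N m" by (simp add: N_def)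
      also have "\<dots> = k m" using N0[OF m(1)] m(2) by simp
      also have "{z\<in>E. z \<le> m} = {y\<in>E. y < s0}" using m m_ge by force
      then have "k m = card {y\<in>E. y < s0}" by (simp add: k_def)
      finally show ?thesis .
    qed
    have "{f\<in>F. f \<le> x0} = D \<union> I" "D \<inter> I = {}"
      using x0 unfolding D_def I_def by force+
    then have "N x0 = card D + card I"
      using finF by (simp add: N_def card_Un_disjoint D_def I_def)
    moreover have "{z\<in>E. z \<le> x0} = insert x0 {y\<in>E. y < s0}"
      using x0 x0_le by force
    then have "k x0 = Suc (card {y\<in>E. y < s0})"
      using x0 assms(2) by (simp add: k_def)
    ultimately show ?thesis using N0[OF x0(1)] x0(2) D by simp
  qed
  then obtain a b where ab: "I = {a, b}" "a < b"
    by (metis card_2_iff insert_commute nat_neq_iff)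
  have abF: "a \<in> F" "b \<in> F" using ab unfolding I_def by blast+
  have "cobdry \<phi> F = (\<Sum>s\<in>F. if s \<in> I then ksign s (F - {s}) else 0)"
    unfolding cobdry_def \<phi>_def by (intro sum.cong refl) (simp add: goodI)
  also have "\<dots> = (\<Sum>s\<in>I. ksign s (F - {s}))"
  proof -
    have "F \<inter> I = I" unfolding I_def by blast
    then show ?thesis using sum.inter_restrict[OF finF, of "\<lambda>s. ksign s (F - {s}) :: 'k" I] by simp
  qed
  also have "\<dots> = ksign a (F - {a}) + ksign b (F - {b})"
    using ab by simp
  \<comment> \<open>no element of \<open>F\<close> lies between \<open>a\<close> and \<open>b\<close>\<close>
  also have "{f\<in>F - {b}. f < b} = insert a {f\<in>F - {a}. f < a}"
  proof -
    have "f < a" if "f \<in> F" "f < b" "f \<noteq> a" for f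
    proof (rule ccontr)
      assume "\<not> f < a"
      then have "a < f" using that(3) by simp
      moreover have "a \<in> I" "b \<in> I" using ab by simp_all
      ultimately have "f \<in> I" using that(1,2) unfolding I_def by force
      then show False using ab that by auto
    qed
    then show ?thesis using ab(2) abF by force
  qed
  then have "ksign b (F - {b}) = - (ksign a (F - {a}) :: 'k)"
    using finF by (simp add: ksign_def)
  finally show ?thesis by simp
qed

section \<open>Cycles off the linear strand\<close>

text \<open>The part in the squarefree multidegree \<open>W\<close> of the Koszul complex of the ideal generated by \<open>L\<close>: here \<open>W - F\<close>
  contains a generator when \<open>x\<^sub>W/x\<^sub>F\<close> is in the ideal.\<close>

definition koszul_chain :: "nat list set \<Rightarrow> nat set \<Rightarrow> nat \<Rightarrow> (nat set \<Rightarrow> 'k::comm_ring_1) \<Rightarrow> bool" where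
  "koszul_chain L W p c \<longleftrightarrow>
     (\<forall>F. c F \<noteq> 0 \<longrightarrow> F \<subseteq> W \<and> card F = p \<and> (\<exists>l\<in>L. set l \<subseteq> W - F))"

text \<open>A cochain that is closed on the sets where \<open>h\<close> lives pairs to zero with the boundary of \<open>h\<close>.\<close>

lemma cochain_obstruction:
  fixes c h \<phi> :: "nat set \<Rightarrow> 'k::comm_ring_1"
  assumes "finite N" "\<And>G. G \<subseteq> N \<Longrightarrow> h G \<noteq> 0 \<Longrightarrow> cobdry \<phi> G = 0"
    and "\<And>F. bdry N h F = c F"
  shows "(\<Sum>F\<in>Pow N. \<phi> F * c F) = 0"
proof -
  have "(\<Sum>F\<in>Pow N. \<phi> F * c F) = (\<Sum>G\<in>Pow N. cobdry \<phi> G * h G)"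
    using bdry_adjoint[OF assms(1), of \<phi> h] assms(3) by simp
  also have "\<dots> = 0"
  proof (rule sum.neutral, rule ballI)
    fix G assume "G \<in> Pow N"
    then show "cobdry \<phi> G * h G = 0" using assms(2)[of G] by (cases "h G = 0") simp_all
  qed
  finally show ?thesis .
qed

lemma not_linearity_cond_split:
  assumes "\<not> linearity_cond n t u v" "length u = length v" "u \<le> v"
  obtains p e u' c v' w where "u = p @ e # u'" "v = p @ c # v'" "e < c"
    "c # w \<in> spread_lists n (Suc (length v')) t" "v' < w"
    "\<not> u' \<le> map (\<lambda>i. i + t) (butlast (c # w))"
  using assms
proof (induction n t u v arbitrary: thesis rule: linearity_cond.induct)
  case (1 n t e u c v)
  show ?case
  proof (cases "e = c")
    case True
    have "\<not> linearity_cond n t u v" "length u = length v" "u \<le> v" using "1.prems"(2-) True by simp_all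
    then obtain p e' u' c' v' w where *: "u = p @ e' # u'" "v = p @ c' # v'" "e' < c'"
      "c' # w \<in> spread_lists n (Suc (length v')) t" "v' < w"
      "\<not> u' \<le> map (\<lambda>i. i + t) (butlast (c' # w))"
      using "1.IH"[OF True] by metis
    show ?thesis by (rule "1.prems"(1)[of "e # p" e' u' c' v' w]) (use * True in simp_all)
  next
    case False
    then show ?thesis using "1.prems"(1)[of "[]" e u c v] "1.prems"(2-) by auto
  qed
qed simp_all

lemma between_append:
  fixes l :: "nat list"
  assumes "p @ a \<le> l" "l \<le> p @ b" "length l = length (p @ b)"
  obtains l' where "l = p @ l'" "a \<le> l'" "l' \<le> b"
  using assms
proof (induction p arbitrary: l thesis)
  case (Cons x p)
  obtain y l'' where l: "l = y # l''" using Cons.prems(4) by (cases l) auto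
  have "y = x" using Cons.prems(2,3) l by auto
  then show ?case using Cons.IH[of l''] Cons.prems l
    by (metis Cons_le_Cons append_Cons length_Cons less_irrefl nat.inject)
qed simp

lemma spread_append:
  "spread t (xs @ ys) \<longleftrightarrow> spread t xs \<and> spread t ys \<and> (\<forall>x\<in>set xs. \<forall>y\<in>set ys. x + t \<le> y)"
  by (auto simp: spread_def sorted_wrt_append)

lemma append_le_append_same: "p @ r \<le> p @ s \<longleftrightarrow> r \<le> (s :: nat list)"
  by (induction p) auto

lemma spread_eqI:
  assumes "t \<ge> 1" "spread t a" "spread t b" "set a = set b"
  shows "a = b"
  using assms spread_strict strict_sorted_equal by blast

lemma spread_card: "t \<ge> 1 \<Longrightarrow> spread t a \<Longrightarrow> card (set a) = length a"
  using spread_strict strict_sorted_iff distinct_card by blast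

text \<open>If \<open>s = i + t\<close> with \<open>i\<close> an entry of \<open>w\<close>, replace the entry after \<open>i\<close> by \<open>s\<close>; it is greater than \<open>s\<close>, as \<open>s\<close>
  does not occur in \<open>w\<close>.\<close>

lemma shift_insert:
  assumes "spread t w" "s \<in> set (map (\<lambda>i. i + t) (butlast w))" "s \<notin> set w" "t \<ge> 1"
  shows "\<exists>z. spread t z \<and> length z = length w \<and> set z \<subseteq> insert s (set w) \<and> z < w \<and> hd z = hd w"
  using assms
proof (induction w)
  case (Cons a w)
  then have ne: "w \<noteq> []" by auto
  then obtain b w' where w: "w = b # w'" by (cases w) auto
  show ?case
  proof (cases "s = a + t")
    case True
    then have "s < b" using Cons.prems w by auto
    then have "spread t (a # s # w')" using Cons.prems w True by fastforce
    then show ?thesis using \<open>s < b\<close> w by (intro exI[of _ "a # s # w'"]) auto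
  next
    case False
    then have "s \<in> set (map (\<lambda>i. i + t) (butlast w))" using Cons.prems ne by auto
    then obtain z where z: "spread t z" "length z = length w" "set z \<subseteq> insert s (set w)" "z < w" "hd z = hd w"
      using Cons by auto
    obtain z' where z': "z = b # z'" using z(2,5) w by (cases z) auto
    have "spread t (a # z)" using z(1) z' Cons.prems w by (auto simp: spread_ConsCons simp del: spread_Cons)
    then show ?thesis using z by (intro exI[of _ "a # z"]) auto
  qed
qed simp

text \<open>Map each \<open>y \<in> Y - A\<close> to the next element of \<open>A\<close>. This is not in \<open>Y\<close>: the element of \<open>A\<close> at distance \<open>t\<close>
  below it would exceed \<open>y - t\<close>, hence \<open>y\<close>, and would come before it. The map is injective and misses the
  least element of \<open>A\<close>, which accounts for the additional one.\<close>

lemma shift_count: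
  fixes A Y :: "nat set"
  assumes "t \<ge> 1" "finite A" "\<And>i j. i \<in> A \<Longrightarrow> j \<in> A \<Longrightarrow> i < j \<Longrightarrow> i + t \<le> j"
    and "Y = (\<lambda>i. i + t) ` {i\<in>A. \<exists>j\<in>A. i < j}" "x \<in> A \<union> Y"
  shows "Suc (card {y\<in>Y - A. y < x}) \<le> card {z\<in>A - Y. z \<le> x}"
proof -
  define nx where "nx y = Min {z\<in>A. y < z}" for y
  have nx: "nx y \<in> A - Y" "y < nx y" "\<And>z. z \<in> A \<Longrightarrow> y < z + t \<Longrightarrow> nx y \<le> z" if y: "y \<in> Y - A" for y
  proof -
    obtain i j where i: "y = i + t" "i \<in> A" "j \<in> A" "i < j" using y assms(4) by auto
    have "y < j" using assms(3)[OF i(2,3,4)] i(1,3) y by (cases "y = j") auto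
    then have ne: "{z\<in>A. y < z} \<noteq> {}" using i(3) by blast
    have fin: "finite {z\<in>A. y < z}" using assms(2) by simp
    have in1: "nx y \<in> A" "y < nx y" using Min_in[OF fin ne] by (auto simp: nx_def)
    show "y < nx y" by (fact in1)
    show le: "nx y \<le> z" if "z \<in> A" "y < z + t" for z
    proof -
      have "i < z" using that(2) i(1) by simp
      then have "y \<le> z" "y \<noteq> z" using assms(3)[OF i(2) that(1)] i(1) y that(1) by auto
      then show ?thesis unfolding nx_def using that(1) fin by (intro Min_le) auto
    qed
    have "nx y \<notin> Y"
    proof
      assume "nx y \<in> Y"
      then obtain k where k: "nx y = k + t" "k \<in> A" using assms(4) by auto
      have "nx y \<le> k" using le[OF k(2)] in1(2) k(1) by simp
      then show False using k(1) assms(1) by simp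
    qed
    then show "nx y \<in> A - Y" using in1 by blast
  qed
  have Ane: "A \<noteq> {}" using assms(4,5) by auto
  have minA: "Min A \<in> A" "\<And>z. z \<in> A \<Longrightarrow> Min A \<le> z" using assms(2) Ane by simp_all
  have YA: "\<exists>i\<in>A. y = i + t" if "y \<in> Y" for y using that assms(4) by auto
  have min_notin: "Min A \<notin> Y" using YA minA(2) assms(1) by fastforce
  have inj: "nx y < nx y'" if "y \<in> Y - A" "y' \<in> Y - A" "y < y'" for y y'
  proof -
    from YA[of y'] that(2) obtain i where i: "i \<in> A" "y' = i + t" by blast
    have "nx y \<le> i" using nx(3)[OF that(1) i(1)] that(3) i(2) by simp
    then show ?thesis using nx(2)[OF that(2)] i(2) by simp
  qed
  have fin: "finite {y\<in>Y - A. y < x}" by (rule finite_subset[of _ "{..<x}"]) auto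
  have "inj_on nx {y\<in>Y - A. y < x}"
    by (rule inj_onI) (metis (mono_tags, lifting) inj less_irrefl linorder_neqE_nat mem_Collect_eq)
  then have "card (nx ` {y\<in>Y - A. y < x}) = card {y\<in>Y - A. y < x}" by (rule card_image)
  moreover have "Min A \<notin> nx ` {y\<in>Y - A. y < x}"
  proof
    assume "Min A \<in> nx ` {y\<in>Y - A. y < x}"
    then obtain y where y: "y \<in> Y - A" "Min A = nx y" by auto
    obtain i where "i \<in> A" "y = i + t" using YA y(1) by blast
    then show False using nx(2)[OF y(1)] y(2) minA(2)[of i] by simp
  qed
  ultimately have "Suc (card {y\<in>Y - A. y < x}) = card (insert (Min A) (nx ` {y\<in>Y - A. y < x}))"
    using fin by simp
  also have "\<dots> \<le> card {z\<in>A - Y. z \<le> x}"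
  proof (rule card_mono)
    have "nx y \<le> x" if "y \<in> Y - A" "y < x" for y
    proof (cases "x \<in> A")
      case True
      then show ?thesis using nx(3)[OF that(1) True] that(2) by simp
    next
      case False
      then obtain i where "i \<in> A" "x = i + t" using assms(5) YA by blast
      then show ?thesis using nx(3)[OF that(1), of i] that(2) by simp
    qed
    moreover have "Min A \<le> x" using assms(5) minA(2) YA by fastforce
    ultimately show "insert (Min A) (nx ` {y\<in>Y - A. y < x}) \<subseteq> {z\<in>A - Y. z \<le> x}"
      using minA(1) min_notin nx(1) by auto
  qed (use assms(2) in simp)
  finally show ?thesis .
qed

text \<open>Dropping the last entry of an increasing list leaves the entries that have a larger one.\<close>

lemma shift_set:
  assumes "t \<ge> 1" "spread t w"
  shows "set (map (\<lambda>i. i + t) (butlast w)) = (\<lambda>i. i + t) ` {i\<in>set w. \<exists>j\<in>set w. i < j}"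
proof -
  have "set (butlast w) = {i\<in>set w. \<exists>j\<in>set w. i < j}" using assms(2)
  proof (induction w)
    case (Cons a w)
    show ?case
    proof (cases "w = []")
      case False
      then have "set (butlast (a # w)) = insert a (set (butlast w))" by simp
      also have "set (butlast w) = {i\<in>set w. \<exists>j\<in>set w. i < j}" using Cons by simp
      also have "insert a \<dots> = {i\<in>set (a # w). \<exists>j\<in>set (a # w). i < j}"
      proof -
        have lt: "a < j" if "j \<in> set w" for j using that Cons.prems assms(1) by fastforce
        obtain j where "j \<in> set w" using False by (meson last_in_set)
        then show ?thesis using lt by (auto dest: lt less_asym)
      qed
      finally show ?thesis .
    qed simp
  qed simp
  then show ?thesis by simp
qed

text \<open>A nontrivial class in the Koszul homology of the ideal generated by \<open>L\<close>. The linear strand in homological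
  degree \<open>p\<close> has internal degree \<open>d + p\<close>, and the class does not lie there.\<close>

definition koszul_obstruction :: "nat \<Rightarrow> nat \<Rightarrow> nat list set \<Rightarrow> nat set \<Rightarrow> nat \<Rightarrow> (nat set \<Rightarrow> 'k::comm_ring_1) \<Rightarrow> bool" where
  "koszul_obstruction n d L W p c \<longleftrightarrow>
     W \<subseteq> {1..n} \<and> card W \<noteq> d + p \<and> koszul_chain L W p c \<and> (\<forall>F. finite F \<longrightarrow> bdry {1..n} c F = 0) \<and>
     \<not> (\<exists>h. koszul_chain L W (Suc p) h \<and> (\<forall>F. bdry {1..n} h F = c F))"

text \<open>The cycle is the boundary of the simplex \<open>T\<close> with vertices \<open>e\<close> and \<open>E\<close>. The complement of \<open>T\<close> in \<open>W\<close> is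
  \<open>p @ c # w\<close>, just outside the segment, but the complement of each facet contains a member: without \<open>e\<close> one
  has \<open>p @ e # w\<close>, and without \<open>s \<in> E\<close> the entry \<open>s\<close> may replace a larger entry of \<open>w\<close>, which gives a list not
  beyond \<open>v'\<close> because \<open>w\<close> is the least list beyond \<open>v'\<close>. The indicator function of the sets that interleave
  with \<open>E\<close> takes the value \<open>1\<close> on this cycle. It vanishes on boundaries: a set \<open>F\<close> with \<open>card E + 1\<close> elements
  and nonzero coboundary either contains \<open>e\<close>, and then its complement is at or beyond \<open>c # w\<close>, or its
  complement is some \<open>e # g\<close> after \<open>p\<close>, and then \<open>g\<close> is at most the shifted list, hence smaller than \<open>u'\<close>.\<close>

lemma obstruction_if_sphere:
  fixes n d t :: nat
  assumes "t \<ge> 1" and u: "u = p @ e # u'" "u \<in> spread_lists n d t"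
    and v: "v = p @ c # v'" "v \<in> spread_lists n d t" and ec: "e < c" and uv: "u' \<le> v'"
    and w: "c # w \<in> spread_lists n (Suc (length v')) t" "v' < w"
    and shift: "\<not> u' \<le> map (\<lambda>i. i + t) (butlast (c # w))"
    and least: "\<And>z. c # z \<in> spread_lists n (Suc (length v')) t \<Longrightarrow> z < w \<Longrightarrow> z \<le> v'"
  shows "\<exists>W q (x :: nat set \<Rightarrow> 'k::comm_ring_1). koszul_obstruction n d (seg n d t u v) W q x"
proof -
  define A where "A = set (c # w)"
  define yl where "yl = map (\<lambda>i. i + t) (butlast (c # w))"
  define Y where "Y = set yl"
  define E where "E = Y - A"
  define V where "V = A \<union> Y"
  define T where "T = insert e E"
  define W where "W = set p \<union> insert e V"
  define x where "x = bdry {1..n} (\<lambda>F. if F = T then 1 else (0::'k))"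
  define L where "L = seg n d t u v"
  define \<phi> where "\<phi> = (\<lambda>F. if interleaves E V F then 1 else (0::'k))"
  have spw: "spread t (c # w)" and spu: "spread t (p @ e # u')" and spv: "spread t (p @ c # v')"
    and lenw: "length w = length v'" and lend: "length p + Suc (length v') = d"
    and lenu: "length u' = length v'"
    using w(1) u v by (simp_all add: spread_lists_def)
  have sub: "set (c # w) \<subseteq> {1..n}" "set (p @ e # u') \<subseteq> {1..n}" "set (p @ c # v') \<subseteq> {1..n}"
    using w(1) u v by (simp_all add: spread_lists_def)
  have p_lt: "i + t \<le> e" if "i \<in> set p" for i using spu that by (simp add: spread_append)
  have finA: "finite A" and finY: "finite Y" by (simp_all add: A_def Y_def)
  have finE: "finite E" and finV: "finite V" using finA finY by (simp_all add: E_def V_def)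
  have Ageq: "c \<le> i" if "i \<in> A" for i using that spw by (auto simp: A_def)
  have sepA: "i + t \<le> j" if "i \<in> A" "j \<in> A" "i < j" for i j
  proof -
    have gen: "i + t \<le> j" if "spread t l" "i \<in> set l" "j \<in> set l" "i < j" for l
      using that by (induction l) auto
    show ?thesis by (rule gen[OF spw]) (use that in \<open>simp_all only: A_def\<close>)
  qed
  have Y_eq: "Y = (\<lambda>i. i + t) ` {i\<in>A. \<exists>j\<in>A. i < j}"
    using shift_set[OF assms(1) spw] by (simp add: Y_def yl_def A_def)
  have Ygeq: "c < y" if "y \<in> Y" for y using that Y_eq Ageq assms(1) by fastforce
  have Yn: "Y \<subseteq> {1..n}"
  proof
    fix y assume "y \<in> Y"
    then obtain i j where "y = i + t" "i \<in> A" "j \<in> A" "i < j" using Y_eq by auto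
    then show "y \<in> {1..n}" using sepA[of i j] sub(1) assms(1) by (fastforce simp: A_def)
  qed
  have Vgeq: "c \<le> i" if "i \<in> V" for i using that Ageq Ygeq by (force simp: V_def)
  have e_V: "e \<notin> V" using Vgeq ec by force
  have p_V: "set p \<inter> insert e V = {}" using p_lt Vgeq ec assms(1) by fastforce
  have Wn: "W \<subseteq> {1..n}" using sub Yn by (auto simp: W_def V_def A_def)
  have finW: "finite W" using Wn by (rule finite_subset) simp
  have cardA: "card A = Suc (length w)" unfolding A_def using spread_card[OF assms(1) spw] by simp
  have cardp: "card (set p) = length p"
    using spread_card[OF assms(1), of p] spu by (simp add: spread_append)
  have VAE: "V = A \<union> E" "A \<inter> E = {}" by (auto simp: V_def E_def)
  have cardV: "card V = card A + card E"
    unfolding VAE(1) using finA finE VAE(2) by (rule card_Un_disjoint)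
  have cardW: "card W = Suc (d + card E)"
    using card_Un_disjoint[of "set p" "insert e V"] p_V finV e_V cardV cardA cardp lend lenw
    by (simp add: W_def)
  have cardT: "card T = Suc (card E)" using finE e_V VAE by (auto simp: T_def)
  have WT: "W - T = set p \<union> A" using p_V e_V VAE by (auto simp: W_def T_def)
  have TW: "T \<subseteq> W" using VAE by (auto simp: W_def T_def)
  have mem: "p @ z \<in> spread_lists n d t" if "length z = Suc (length v')" "spread t z" "set z \<subseteq> {1..n}"
    "\<forall>i\<in>set z. e \<le> i" for z
    using that lend sub spu p_lt by (fastforce simp: spread_lists_def spread_append)
  have Lsplit: "\<exists>l'. l = p @ l' \<and> e # u' \<le> l' \<and> l' \<le> c # v' \<and> length l' = Suc (length v') \<and> spread t l'"
    if l: "l \<in> L" for l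
  proof -
    have "p @ e # u' \<le> l" "l \<le> p @ c # v'" "length l = length (p @ c # v')" "spread t l"
      using l u v lend by (simp_all add: L_def seg_def spread_lists_def)
    then obtain l' where "l = p @ l'" "e # u' \<le> l'" "l' \<le> c # v'" using between_append by metis
    then show ?thesis using \<open>length l = _\<close> \<open>spread t l\<close> by (simp add: spread_append)
  qed
  have Lcard: "card (set l) = d" if "l \<in> L" for l
    using that spread_card[OF assms(1), of l] by (simp add: L_def seg_def spread_lists_def)
  \<comment> \<open>The complement of a facet is \<open>p\<close>, \<open>c # w\<close> and the missing vertex \<open>s\<close>; it contains a member of the segment.\<close>
  have faceT: "\<exists>l\<in>L. set l \<subseteq> W - (T - {s})" if s: "s \<in> T" for s
  proof (cases "s = e")
    case True
    have le1: "u' \<le> w" using uv w(2) by simp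
    have "\<forall>i\<in>set w. e + t \<le> i" using spw ec by fastforce
    then have "spread t (e # w)" using spw by simp
    then have "p @ e # w \<in> spread_lists n d t"
      using sub ec spw by (intro mem) (auto simp: lenw intro: order_trans[of e c])
    then have "p @ e # w \<in> L" using le1 ec by (simp add: L_def seg_def u(1) v(1) append_le_append_same)
    moreover have "set (p @ e # w) \<subseteq> W - (T - {s})"
    proof -
      have "W - (T - {s}) = insert s (W - T)" using s TW by blast
      then show ?thesis using True unfolding WT by (auto simp: A_def)
    qed
    ultimately show ?thesis by blast
  next
    case False
    then have sE: "s \<in> E" using s by (simp add: T_def)
    have "s \<in> set (map (\<lambda>i. i + t) (butlast (c # w)))" "s \<notin> set (c # w)"
      using sE unfolding E_def Y_def yl_def A_def by blast+
    from shift_insert[OF spw this assms(1)]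
    obtain z where z: "spread t z" "length z = length (c # w)" "set z \<subseteq> insert s (set (c # w))"
      "z < c # w" "hd z = hd (c # w)" by blast
    obtain z' where z': "z = c # z'" using z(2,5) by (cases z) auto
    have szn: "set z \<subseteq> {1..n}" using z(3) sub(1) sE Yn by (auto simp: E_def)
    have "c # z' \<in> spread_lists n (Suc (length v')) t"
      using z(1,2) szn by (simp only: z' spread_lists_def) (simp add: lenw)
    then have "z' \<le> v'" using least z(4) z' by simp
    have "p @ c # z' \<in> spread_lists n d t"
      using z(1,2) szn ec lenw by (intro mem) (auto simp: z')
    then have "p @ c # z' \<in> L"
      using \<open>z' \<le> v'\<close> ec by (simp add: L_def seg_def u(1) v(1) append_le_append_same)
    moreover have "set (p @ c # z') \<subseteq> W - (T - {s})"
    proof -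
      have "W - (T - {s}) = insert s (W - T)" using s TW by blast
      then show ?thesis using z(3) unfolding WT z' by (auto simp: A_def)
    qed
    ultimately show ?thesis by blast
  qed
  have chain: "koszul_chain L W (card E) x"
    unfolding koszul_chain_def
  proof (intro allI impI)
    fix F assume "x F \<noteq> 0"
    then obtain s where s: "s \<in> T" "F = T - {s}"
      unfolding x_def by (rule bdry_indicator_support)
    have "card F = card E" using s cardT finE by (simp add: T_def)
    then show "F \<subseteq> W \<and> card F = card E \<and> (\<exists>l\<in>L. set l \<subseteq> W - F)"
      using s TW faceT by blast
  qed
  \<comment> \<open>Only the facet \<open>E\<close> avoids \<open>e\<close>; its sign is \<open>+\<close> because \<open>e\<close> is the least vertex.\<close>
  have kcobT: "cobdry \<phi> T = 1"
  proof -
    have "cobdry \<phi> T = (\<Sum>s\<in>T. if s = e then 1 else 0)"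
      unfolding cobdry_def
    proof (rule sum.cong[OF refl])
      fix s assume s: "s \<in> T"
      show "ksign s (T - {s}) * \<phi> (T - {s}) = (if s = e then 1 else 0)"
      proof (cases "s = e")
        case True
        have "T - {s} = E" using True e_V VAE by (auto simp: T_def)
        moreover have "{f\<in>E. f < e} = {}" using Vgeq ec VAE by fastforce
        moreover have "interleaves E V E" using VAE by (auto simp: interleaves_def)
        ultimately show ?thesis using True by (simp only: ksign_def \<phi>_def) simp
      next
        case False
        then have "e \<in> T - {s}" by (simp add: T_def)
        then have "\<not> interleaves E V (T - {s})" using e_V by (auto simp: interleaves_def)
        then show ?thesis using False by (simp add: \<phi>_def)
      qed
    qed
    then show ?thesis using finE by (simp add: T_def)
  qed
  have cob0: "cobdry \<phi> F = 0" if F: "F \<subseteq> W" "card F = Suc (card E)" "l \<in> L" "set l \<subseteq> W - F" for F l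
  proof (rule ccontr)
    assume nz: "cobdry \<phi> F \<noteq> 0"
    have finF: "finite F" using F(1) finW by (rule finite_subset)
    have "card (W - F) = d" using F(1,2) cardW finF by (simp add: card_Diff_subset)
    then have l_eq: "set l = W - F" using F(3,4) Lcard finW by (simp add: card_subset_eq)
    obtain l' where l': "l = p @ l'" "e # u' \<le> l'" "l' \<le> c # v'" "length l' = Suc (length v')" "spread t l'"
      using Lsplit[OF F(3)] by blast
    have pl': "set p \<inter> set l' = {}"
      using F(3) l'(1) assms(1) by (fastforce simp: L_def seg_def spread_lists_def spread_append)
    have l'_eq: "set l' = insert e V - F"
      using l_eq l'(1) pl' p_V by (auto simp: W_def)
    have FV: "F \<subseteq> insert e V" using l_eq l'(1) F(1) p_V by (auto simp: W_def)
    obtain s where s: "s \<in> F" "\<phi> (F - {s}) \<noteq> 0"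
      using nz unfolding cobdry_def
      by (metis (no_types, lifting) mult_zero_right sum.not_neutral_contains_not_neutral)
    then have int: "interleaves E V (F - {s})" by (simp add: \<phi>_def split: if_splits)
    have strict: "sorted_wrt (<) (c # w)" "sorted_wrt (<) l'"
      using spread_strict[OF assms(1)] spw l'(5) by blast+
    show False
    proof (cases "e \<in> F")
      case True
      have "s = e" using int True e_V by (auto simp: interleaves_def)
      define F' where "F' = F - {e}"
      have F': "interleaves E V F'" using int \<open>s = e\<close> by (simp add: F'_def)
      have F'V: "F' \<subseteq> V" using F' by (simp add: interleaves_def)
      have l'V: "set l' = V - F'" using l'_eq True e_V by (auto simp: F'_def)
      \<comment> \<open>An interleaving set lies to the left of \<open>E\<close>, so its complement in \<open>V\<close> lies to the right of the complement
          \<open>c # w\<close> of \<open>E\<close>.\<close>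
      have "c # w \<le> l'"
      proof (rule count_imp_le[OF _ strict])
        show "length (c # w) = length l'" using l'(4) lenw by simp
        fix y
        have "{z\<in>V. z \<le> y} = {z\<in>A. z \<le> y} \<union> {z\<in>E. z \<le> y}" using VAE by blast
        then have "card {z\<in>V. z \<le> y} = card {z\<in>A. z \<le> y} + card {z\<in>E. z \<le> y}"
          using finA finE VAE(2) by (simp add: card_Un_disjoint disjoint_iff)
        moreover have "{z\<in>V. z \<le> y} = {z\<in>set l'. z \<le> y} \<union> {z\<in>F'. z \<le> y}"
          using l'V F'V by blast
        then have "card {z\<in>V. z \<le> y} = card {z\<in>set l'. z \<le> y} + card {z\<in>F'. z \<le> y}"
          using finF l'V by (simp add: card_Un_disjoint disjoint_iff F'_def)
        ultimately show "card {z\<in>set l'. z \<le> y} \<le> card {z\<in>set (c # w). z \<le> y}"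
          using interleaves_ge[OF finE finV F', of y] by (simp add: A_def)
      qed
      then have "c # w \<le> c # v'" using l'(3) by (rule order_trans)
      then show False using w(2) by simp
    next
      case False
      then have FV': "F \<subseteq> V" using FV by blast
      \<comment> \<open>otherwise two terms of the coboundary would cancel\<close>
      have "\<forall>y\<in>E. y < s"
        using interleaves_cancel[OF finE finV FV' s(1) int, where 'k = 'k] nz unfolding \<phi>_def
        by (meson not_le)
      obtain g where g: "l' = e # g"
      proof (cases l')
        case (Cons a g)
        have "e \<in> set l'" using l'_eq False by simp
        moreover have "\<forall>i\<in>set l'. e \<le> i" using l'_eq Vgeq ec by fastforce
        ultimately have "a = e" using strict(2) Cons by fastforce
        then show ?thesis using Cons that by simp
      qed (use l'(4) in simp)
      have g_eq: "set g = V - F" using l'_eq g False e_V strict(2) by auto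
      \<comment> \<open>Up to each point \<open>F\<close> has at most as many elements as \<open>A - Y\<close>, so its complement \<open>g\<close> in \<open>V\<close> lies to the left
          of the complement \<open>Y\<close> of \<open>A - Y\<close>.\<close>
      have "g \<le> yl"
      proof (rule count_imp_le)
        show "length g = length yl" using l'(4) g lenw by (simp only: yl_def length_map length_butlast) simp
        show "sorted_wrt (<) g" using strict(2) g by simp
        have "sorted_wrt (<) (butlast (c # w))" using strict(1) by (metis append_butlast_last_id list.discI sorted_wrt_append)
        then show "sorted_wrt (<) yl" unfolding yl_def by (simp add: sorted_wrt_map)
        fix y
        have finf: "finite {f\<in>F. f \<le> y}" using finF by simp
        have "card {f\<in>F. f \<le> y} \<le> card {z\<in>A - Y. z \<le> y}"
        proof (cases "{f\<in>F. f \<le> y} = {}")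
          case False
          define m where "m = Max {f\<in>F. f \<le> y}"
          have m: "m \<in> F" "m \<le> y" using Max_in[OF finf False] by (auto simp: m_def)
          have "{f\<in>F. f \<le> y} = {f\<in>F. f \<le> m}"
            using m(2) Max_ge[OF finf] by (auto simp: m_def)
          then have "card {f\<in>F. f \<le> y} \<le> Suc (card {z\<in>E. z < m})"
            using interleaves_le[OF finE finF int s(1) \<open>\<forall>y\<in>E. y < s\<close>, of m] by simp
          also have "\<dots> \<le> card {z\<in>A - Y. z \<le> m}"
            unfolding E_def
            by (rule shift_count[OF assms(1) finA sepA Y_eq]) (use m FV' in \<open>auto simp: V_def\<close>)
          also have "\<dots> \<le> card {z\<in>A - Y. z \<le> y}"
            using m(2) finA by (intro card_mono) auto
          finally show ?thesis .
        next
          case True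
          then show ?thesis by (metis card.empty zero_le)
        qed
        moreover have "{z\<in>V. z \<le> y} = {z\<in>Y. z \<le> y} \<union> {z\<in>A - Y. z \<le> y}" by (auto simp: V_def)
        then have "card {z\<in>V. z \<le> y} = card {z\<in>Y. z \<le> y} + card {z\<in>A - Y. z \<le> y}"
          using finA finY by (simp add: card_Un_disjoint disjoint_iff)
        moreover have "{z\<in>V. z \<le> y} = {z\<in>set g. z \<le> y} \<union> {f\<in>F. f \<le> y}"
          using g_eq FV' by blast
        then have "card {z\<in>V. z \<le> y} = card {z\<in>set g. z \<le> y} + card {f\<in>F. f \<le> y}"
          using finF g_eq by (simp add: card_Un_disjoint disjoint_iff)
        ultimately show "card {z\<in>set yl. z \<le> y} \<le> card {z\<in>set g. z \<le> y}"
          by (simp add: Y_def)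
      qed
      moreover have "u' \<le> g" using l'(2) g by simp
      ultimately show False using shift by (simp add: yl_def)
    qed
  qed
  have "\<not> (\<exists>h. koszul_chain L W (Suc (card E)) h \<and> (\<forall>F. bdry {1..n} h F = x F))"
  proof
    assume "\<exists>h. koszul_chain L W (Suc (card E)) h \<and> (\<forall>F. bdry {1..n} h F = x F)"
    then obtain h where h: "koszul_chain L W (Suc (card E)) h" "\<And>F. bdry {1..n} h F = x F" by blast
    have "(\<Sum>F\<in>Pow {1..n}. \<phi> F * x F) = 0"
    proof (rule cochain_obstruction[OF _ _ h(2)])
      fix G assume "h G \<noteq> 0"
      then show "cobdry \<phi> G = 0" using h(1) cob0 unfolding koszul_chain_def by blast
    qed simp
    moreover have "(\<Sum>F\<in>Pow {1..n}. \<phi> F * x F)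
        = (\<Sum>G\<in>Pow {1..n}. cobdry \<phi> G * (if G = T then 1 else 0))"
      unfolding x_def by (rule bdry_adjoint) simp
    moreover have "(\<Sum>G\<in>Pow {1..n}. cobdry \<phi> G * (if G = T then 1 else 0))
        = (\<Sum>G\<in>Pow {1..n}. if G = T then cobdry \<phi> G else 0)"
      by (rule sum.cong) simp_all
    moreover have "\<dots> = 1" using kcobT TW Wn by (simp add: subset_trans)
    ultimately show False by simp
  qed
  moreover have "bdry {1..n} x F = 0" if "finite F" for F
    unfolding x_def using that by (intro bdry_bdry) simp_all
  ultimately have "koszul_obstruction n d L W (card E) x"
    using chain Wn cardW by (simp add: koszul_obstruction_def)
  then show ?thesis unfolding L_def by blast
qed

text \<open>Choose members \<open>a\<close> and \<open>b\<close> of the segment on the variables of \<open>u\<close> and \<open>v\<close>, with \<open>e\<close> in \<open>a\<close> only, such that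
  the union \<open>W\<close> is as small as possible. Then \<open>c\<close> is in \<open>b\<close> only. The cycle is the difference of the points
  \<open>c\<close> and \<open>e\<close>, and the cochain is \<open>1\<close> on the points whose complement contains a member with \<open>e\<close>. It is
  constant along edges: if the complement of an edge contains a member without \<open>e\<close>, a member with \<open>e\<close> that
  avoids one end would contradict the choice of \<open>W\<close>. If \<open>W\<close> had only \<open>d + 1\<close> elements, \<open>a\<close> and \<open>b\<close> would have
  the same tail, but \<open>b' \<le> v' < u' \<le> a'\<close>.\<close>

lemma obstruction_if_disconnected:
  fixes n d t :: nat
  assumes "t \<ge> 1" and u: "u = p @ e # u'" "u \<in> spread_lists n d t"
    and v: "v = p @ c # v'" "v \<in> spread_lists n d t" and ec: "e < c" and uv: "v' < u'"
  shows "\<exists>W q (x :: nat set \<Rightarrow> 'k::comm_ring_1). koszul_obstruction n d (seg n d t u v) W q x"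
proof -
  define L where "L = seg n d t u v"
  have spu: "spread t (p @ e # u')" and spv: "spread t (p @ c # v')"
    and lend: "length p + Suc (length v') = d" and lenu: "length u' = length v'"
    using u v by (simp_all add: spread_lists_def)
  have sub: "set u \<union> set v \<subseteq> {1..n}" using u v by (simp add: spread_lists_def)
  have p_lt: "i + t \<le> e" if "i \<in> set p" for i using spu that by (simp add: spread_append)
  have u's: "u' \<in> spread_lists n (length v') t" and v's: "v' \<in> spread_lists n (length v') t"
    using u v lenu by (simp_all add: spread_lists_def spread_append)
  have v'c: "\<forall>y\<in>set v'. c + t \<le> y" using spv by (simp add: spread_append)
  have lower: "\<forall>y\<in>set a. c + t \<le> y" if "a \<in> spread_lists n (length v') t" "v' \<le> a" for a
    by (rule spread_lists_lower[OF v's that v'c])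
  have uvL: "u \<in> L" "v \<in> L" using u v ec by (auto simp: L_def seg_def append_le_append_same)
  have e_v: "e \<notin> set v" using p_lt v'c ec assms(1) v(1) by fastforce
  define Q where "Q a b \<longleftrightarrow> a \<in> L \<and> b \<in> L \<and> e \<in> set a \<and> e \<notin> set b \<and> set a \<union> set b \<subseteq> set u \<union> set v" for a b
  define S where "S = {k. \<exists>a b. Q a b \<and> card (set a \<union> set b) = k}"
  have "Q u v" using uvL e_v by (simp add: Q_def u(1))
  then have "S \<noteq> {}" by (auto simp: S_def)
  then have "(LEAST k. k \<in> S) \<in> S" by (meson LeastI_ex ex_in_conv)
  then obtain a b where ab: "Q a b" "card (set a \<union> set b) = (LEAST k. k \<in> S)"
    by (auto simp: S_def)
  have min: "card (set a \<union> set b) \<le> card (set a' \<union> set b')" if "Q a' b'" for a' b'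
    unfolding ab(2) using that by (intro Least_le) (auto simp: S_def)
  have abL: "a \<in> L" "b \<in> L" "e \<in> set a" "e \<notin> set b" and absub: "set a \<union> set b \<subseteq> set u \<union> set v"
    using ab(1) by (simp_all add: Q_def)
  define W where "W = set a \<union> set b"
  have Lsplit: "\<exists>i l'. l = p @ i # l' \<and> e # u' \<le> i # l' \<and> i # l' \<le> c # v' \<and> l' \<in> spread_lists n (length v') t \<and>
       spread t l" if l: "l \<in> L" for l
  proof -
    have "p @ e # u' \<le> l" "l \<le> p @ c # v'" "length l = length (p @ c # v')" "spread t l" "set l \<subseteq> {1..n}"
      using l u v lend by (simp_all add: L_def seg_def spread_lists_def)
    then obtain l' where l': "l = p @ l'" "e # u' \<le> l'" "l' \<le> c # v'" using between_append by metis
    obtain i l'' where "l' = i # l''" using l'(1) \<open>length l = _\<close> by (cases l') auto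
    then show ?thesis
      using l' \<open>length l = _\<close> \<open>spread t l\<close> \<open>set l \<subseteq> _\<close> by (auto simp: spread_append spread_lists_def)
  qed
  obtain i a' where a: "a = p @ i # a'" "e # u' \<le> i # a'" "a' \<in> spread_lists n (length v') t" "spread t a"
    using Lsplit[OF abL(1)] by blast
  obtain j b' where b: "b = p @ j # b'" "e # u' \<le> j # b'" "j # b' \<le> c # v'" "b' \<in> spread_lists n (length v') t"
    "spread t b" using Lsplit[OF abL(2)] by blast
  have "i = e"
  proof -
    have "e \<notin> set p" using p_lt[of e] assms(1) by auto
    then have "e \<in> set (i # a')" using abL(3) a(1) by simp
    then have "i \<le> e" using a(1,4) by (auto simp: spread_append)
    then show ?thesis using a(2) by auto
  qed
  then have a'u: "u' \<le> a'" using a(2) by simp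
  have a'c: "\<forall>y\<in>set a'. c + t \<le> y" using lower[OF a(3)] a'u uv by simp
  have uc: "\<forall>y\<in>set u'. c + t \<le> y" using lower[OF u's] uv by simp
  have "j = c"
  proof -
    have "j \<noteq> e" using abL(4) b(1) by auto
    then have "e < j" "j \<le> c" using b(2,3) by auto
    have "j \<in> set u \<union> set v" using absub b(1) by auto
    then have "j \<in> set p \<or> j = c \<or> j \<in> set u' \<or> j \<in> set v'"
      using \<open>j \<noteq> e\<close> u(1) v(1) by auto
    moreover have "j \<notin> set p" using p_lt[of j] \<open>e < j\<close> by auto
    moreover have "j \<notin> set u'" "j \<notin> set v'" using uc v'c \<open>j \<le> c\<close> assms(1) by fastforce+
    ultimately show ?thesis by blast
  qed
  then have b'v: "b' \<le> v'" using b(3) by simp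
  have c_a: "c \<notin> set a"
    using a(1) a'c p_lt[of c] ec \<open>i = e\<close> assms(1) by fastforce
  have c_b: "c \<in> set b" using b(1) \<open>j = c\<close> by simp
  have Lcard: "card (set l) = d" if "l \<in> L" for l
    using that spread_card[OF assms(1), of l] by (simp add: L_def seg_def spread_lists_def)
  have cardW: "card W \<noteq> d + 1"
  proof
    assume "card W = d + 1"
    then have "card (set a \<union> (set b - set a)) = d + 1" by (simp add: W_def)
    then have "card (set b - set a) = 1"
      using card_Un_disjoint[of "set a" "set b - set a"] Lcard[OF abL(1)] by simp
    then have "set b - set a = {c}" using c_a c_b by (metis DiffI card_1_singletonE singletonD)
    have "set b' \<subseteq> set a"
    proof
      fix y assume "y \<in> set b'"
      then have "y \<noteq> c" "y \<in> set b" using b(1,5) \<open>j = c\<close> assms(1) by (auto simp: spread_append)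
      then show "y \<in> set a" using \<open>set b - set a = {c}\<close> by blast
    qed
    moreover have "y \<notin> set p \<and> y \<noteq> e" if "y \<in> set b'" for y
    proof -
      have "c + t \<le> y" using b(1,5) \<open>j = c\<close> that by (simp add: spread_append)
      then show ?thesis using p_lt[of y] ec by auto
    qed
    ultimately have "set b' \<subseteq> set a'" using a(1) \<open>i = e\<close> by fastforce
    moreover have "card (set a') = length v'" "card (set b') = length v'"
      using a(3) b(4) spread_card[OF assms(1)] by (simp_all add: spread_lists_def)
    ultimately have "set b' = set a'" by (simp add: card_subset_eq)
    then have "b' = a'" using spread_eqI[OF assms(1)] a(3) b(4) by (simp add: spread_lists_def)
    then show False using b'v a'u uv by simp
  qed
  have Wn: "W \<subseteq> {1..n}" using subset_trans[OF absub sub] by (simp only: W_def)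
  have finW: "finite W" by (simp add: W_def)
  define x where "x = (\<lambda>F. if F = {c} then 1 else if F = {e} then - 1 else (0::'k))"
  define \<phi> where "\<phi> = (\<lambda>F. if \<exists>y l. F = {y} \<and> l \<in> L \<and> e \<in> set l \<and> set l \<subseteq> W - {y} then 1 else (0::'k))"
  have ecW: "e \<in> W" "c \<in> W" using abL(3) c_b by (simp_all add: W_def)
  have chain: "koszul_chain L W 1 x"
    unfolding koszul_chain_def
  proof (intro allI impI)
    fix F assume "x F \<noteq> 0"
    then have "F = {c} \<or> F = {e}" by (simp add: x_def split: if_splits)
    then show "F \<subseteq> W \<and> card F = 1 \<and> (\<exists>l\<in>L. set l \<subseteq> W - F)"
    proof
      assume "F = {c}"
      then show ?thesis using ecW abL(1) c_a by (auto simp: W_def)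
    next
      assume "F = {e}"
      then show ?thesis using ecW abL(2,4) by (auto simp: W_def)
    qed
  qed
  have closed: "bdry {1..n} x F = 0" for F
  proof (cases "F = {}")
    case True
    have "bdry {1..n} x F = (\<Sum>s\<in>{1..n}. (if s = c then 1 else 0) + (if s = e then - 1 else (0::'k)))"
      unfolding bdry_def True using ec by (intro sum.cong) (auto simp: x_def ksign_def)
    also have "\<dots> = 0" using ecW Wn by (simp add: sum.distrib subset_iff)
    finally show ?thesis .
  next
    case False
    then show ?thesis unfolding bdry_def
      by (intro sum.neutral ballI) (auto simp: x_def doubleton_eq_iff insert_eq_iff dest: equalityD1)
  qed
  have nobound: "\<not> (\<exists>h. koszul_chain L W (Suc 1) h \<and> (\<forall>F. bdry {1..n} h F = x F))"
  proof
    assume "\<exists>h. koszul_chain L W (Suc 1) h \<and> (\<forall>F. bdry {1..n} h F = x F)"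
    then obtain h where h: "koszul_chain L W (Suc 1) h" "\<And>F. bdry {1..n} h F = x F" by blast
    have "(\<Sum>F\<in>Pow {1..n}. \<phi> F * x F) = 0"
    proof (rule cochain_obstruction[OF _ _ h(2)])
      fix G assume "h G \<noteq> 0"
      then obtain l where G: "G \<subseteq> W" "card G = 2" "l \<in> L" "set l \<subseteq> W - G"
        using h(1) by (auto simp: koszul_chain_def)
      obtain y z where yz: "G = {y, z}" "y < z"
        using G(2) by (metis card_2_iff insert_commute nat_neq_iff)
      have \<phi>_y: "\<phi> {k} = (if e \<in> set l then 1 else 0)" if "k \<in> G" for k
      proof (cases "e \<in> set l")
        case True
        have "set l \<subseteq> W - {k}" using G(4) that by blast
        then have "\<exists>y l. {k} = {y} \<and> l \<in> L \<and> e \<in> set l \<and> set l \<subseteq> W - {y}"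
          using True G(3) by blast
        then show ?thesis using True by (simp add: \<phi>_def)
      next
        case False
        have "\<not> (\<exists>y l. {k} = {y} \<and> l \<in> L \<and> e \<in> set l \<and> set l \<subseteq> W - {y})"
        proof
          assume "\<exists>y l. {k} = {y} \<and> l \<in> L \<and> e \<in> set l \<and> set l \<subseteq> W - {y}"
          then obtain l2 where l2: "l2 \<in> L" "e \<in> set l2" "set l2 \<subseteq> W - {k}" by auto
          have "set l2 \<union> set l \<subseteq> W - {k}" using l2(3) G(4) that by blast
          then have "Q l2 l" using l2 G(3) False absub unfolding Q_def W_def by blast
          then have "card W \<le> card (set l2 \<union> set l)" using min unfolding W_def by blast
          also have "\<dots> \<le> card (W - {k})"
            using \<open>set l2 \<union> set l \<subseteq> W - {k}\<close> finW by (intro card_mono) auto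
          also have "\<dots> < card W" using that G(1) finW by (intro psubset_card_mono) auto
          finally show False by simp
        qed
        then show ?thesis using False unfolding \<phi>_def by simp
      qed
      have rem: "G - {y} = {z}" "G - {z} = {y}" using yz by auto
      have "{f \<in> {z}. f < y} = {}" "{f \<in> {y}. f < z} = {y}" using yz(2) by auto
      then have "ksign y {z} = (1::'k)" "ksign z {y} = (- 1::'k)" by (simp_all only: ksign_def) simp_all
      moreover have "cobdry \<phi> G = ksign y {z} * \<phi> {z} + ksign z {y} * \<phi> {y}"
        using yz(2) rem unfolding cobdry_def by (simp add: yz(1))
      ultimately show "cobdry \<phi> G = 0"
        using \<phi>_y[of y] \<phi>_y[of z] by (simp add: yz(1))
    qed simp
    moreover have "(\<Sum>F\<in>Pow {1..n}. \<phi> F * x F) = (\<Sum>F\<in>Pow {1..n}. if F = {c} then 1 else 0)"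
    proof (rule sum.cong[OF refl])
      fix F
      have "\<phi> {e} = 0" unfolding \<phi>_def by auto
      moreover have "set a \<subseteq> W - {c}" using c_a by (auto simp: W_def)
      then have "\<exists>y l. {c} = {y} \<and> l \<in> L \<and> e \<in> set l \<and> set l \<subseteq> W - {y}" using abL(1,3) by blast
      then have "\<phi> {c} = 1" unfolding \<phi>_def by simp
      ultimately show "\<phi> F * x F = (if F = {c} then 1 else 0)" by (simp add: x_def)
    qed
    moreover have "\<dots> = (1::'k)" using ecW Wn by (simp add: subset_iff)
    ultimately show False by simp
  qed
  have "koszul_obstruction n d L W 1 x"
    using Wn cardW chain closed nobound by (simp add: koszul_obstruction_def)
  then show ?thesis unfolding L_def by blast
qed

text \<open>Shifting is monotone, so a violation of the condition at some \<open>w\<close> gives one at the least list beyond \<open>v'\<close>.\<close>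

theorem obstruction_if_not_linearity_cond:
  fixes n d t :: nat
  assumes "t \<ge> 1" "u \<in> spread_lists n d t" "v \<in> spread_lists n d t" "u \<le> v" "\<not> linearity_cond n t u v"
  shows "\<exists>W q (x :: nat set \<Rightarrow> 'k::comm_ring_1). koszul_obstruction n d (seg n d t u v) W q x"
proof -
  have "length u = length v" using assms by (simp add: spread_lists_def)
  from assms(5) this assms(4)
  obtain p e u' c v' w where *: "u = p @ e # u'" "v = p @ c # v'" "e < c"
    "c # w \<in> spread_lists n (Suc (length v')) t" "v' < w"
    "\<not> u' \<le> map (\<lambda>i. i + t) (butlast (c # w))" by (rule not_linearity_cond_split)
  show ?thesis
  proof (cases "u' \<le> v'")
    case False
    then show ?thesis using obstruction_if_disconnected assms(1-3) * by (metis not_le)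
  next
    case True
    define R where "R = {z. c # z \<in> spread_lists n (Suc (length v')) t \<and> v' < z}"
    have "finite R" unfolding R_def
      by (rule finite_subset[OF _ finite_spread_lists[of n "length v'" t]]) (auto simp: Cons_spread_lists)
    moreover have "w \<in> R" using * by (simp add: R_def)
    ultimately obtain z0 where m: "z0 \<in> R" "z0 \<le> w" "\<And>z. z \<in> R \<Longrightarrow> z0 \<le> z"
      using Min_in[of R] Min_le[of R] by blast
    have "length (c # z0) = length (c # w)" using m(1) *(4) by (simp add: R_def spread_lists_def)
    then have "map (\<lambda>i. i + t) (butlast (c # z0)) \<le> map (\<lambda>i. i + t) (butlast (c # w))"
      by (rule butlast_map_mono) (use m(2) in simp)
    then have "\<not> u' \<le> map (\<lambda>i. i + t) (butlast (c # z0))" using *(6) by (meson order_trans)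
    moreover have "z \<le> v'" if "c # z \<in> spread_lists n (Suc (length v')) t" "z < z0" for z
      using m(3)[of z] that by (force simp: R_def not_less)
    moreover have "c # z0 \<in> spread_lists n (Suc (length v')) t" "v' < z0" using m(1) unfolding R_def by blast+
    ultimately show ?thesis
      by (intro obstruction_if_sphere[OF assms(1) *(1) assms(2) *(2) assms(3) *(3) True, of z0])
  qed
qed

section \<open>From obstructions to Koszul homology\<close>

lemma mon_of_sqfree: "distinct l \<Longrightarrow> mon_of l = sqfree (set l)"
  by (simp add: mon_of_def sqfree_def sum_list_distinct_conv_sum_set)

text \<open>A scalar chain on the subsets of \<open>W\<close> becomes a chain of polynomials when the coefficient at \<open>G\<close> is
  multiplied by \<open>x\<^sub>W/x\<^sub>G\<close>; a preimage is brought back by taking its component of multidegree \<open>x\<^sub>W\<close>.\<close>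

lemma not_koszul_acyclic_if_obstruction:
  fixes c :: "nat set \<Rightarrow> 'k::field"
  assumes L: "\<And>l. l \<in> L \<Longrightarrow> distinct l \<and> set l \<subseteq> {1..n}"
    and ob: "koszul_obstruction n d L W p c"
  shows "card W \<noteq> d + p \<and> \<not> koszul_acyclic n (multiples n (mon_of ` L)) p (int (card W)) TYPE('k)"
proof
  show "card W \<noteq> d + p" using ob by (simp add: koszul_obstruction_def)
  have Wn: "W \<subseteq> {1..n}" and c: "koszul_chain L W p c" and closed: "\<And>F. finite F \<Longrightarrow> bdry {1..n} c F = 0"
    and nob: "\<not> (\<exists>h. koszul_chain L W (Suc p) h \<and> (\<forall>F. bdry {1..n} h F = c F))"
    using ob by (simp_all add: koszul_obstruction_def)
  have finW: "finite W" using Wn by (rule finite_subset) simp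
  let ?U = "mon_of ` L"
  have mult: "sqfree S \<in> multiples n ?U \<longleftrightarrow> (\<exists>l\<in>L. set l \<subseteq> S)" if "S \<subseteq> {1..n}" for S
  proof -
    have "finite S" using that by (rule finite_subset) simp
    then show ?thesis using sqfree_monomials[OF that] L by (auto simp: multiples_def mon_of_sqfree mdvd_sqfree)
  qed
  have diff: "sqfree W - sqfree F = sqfree (W - F)" if "F \<subseteq> W" for F
    using finW that by (intro poly_mapping_eqI) (auto simp: lookup_minus lookup_sqfree finite_subset)
  show "\<not> koszul_acyclic n (multiples n ?U) p (int (card W)) TYPE('k)"
  proof
    assume ac: "koszul_acyclic n (multiples n ?U) p (int (card W)) TYPE('k)"
    define x where "x G b = (if b = 0 \<and> G \<subseteq> W then Poly_Mapping.single (sqfree (W - G)) (c G) else 0)" for G and b :: nat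
    have cW: "G \<subseteq> W \<and> card G = p \<and> (\<exists>l\<in>L. set l \<subseteq> W - G)" if "c G \<noteq> 0" for G
      using c that by (simp add: koszul_chain_def)
    have "x \<in> arrays (cells n p) {0} (multiples n ?U) (\<lambda>b. int (card W) - int p)"
    proof (rule arraysI)
      fix G b
      have "Poly_Mapping.keys (x G b) \<subseteq> multiples n ?U \<and> homogeneous (int (card W) - int p) (x G b) \<and>
        G \<in> cells n p \<and> b \<in> {0}" if "x G b \<noteq> 0"
      proof -
        have G: "b = 0" "c G \<noteq> 0" using that by (auto simp: x_def split: if_splits)
        have GW: "G \<subseteq> W" "card G = p" and l: "\<exists>l\<in>L. set l \<subseteq> W - G" using cW[OF G(2)] by blast+
        have "int (mon_deg (sqfree (W - G))) = int (card W) - int p"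
          using GW finW card_mono[OF finW GW(1)] finite_subset[OF GW(1) finW] by (simp add: mon_deg_sqfree card_Diff_subset)
        moreover have "sqfree (W - G) \<in> multiples n ?U" using l Wn by (subst mult) auto
        ultimately show ?thesis using G GW subset_trans[OF GW(1) Wn] by (simp add: x_def homogeneous_def cells_def)
      qed
      then show "Poly_Mapping.keys (x G b) \<subseteq> multiples n ?U" "homogeneous (int (card W) - int p) (x G b)"
        "x G b \<noteq> 0 \<Longrightarrow> G \<in> cells n p \<and> b \<in> {0}"
        by (cases "x G b = 0"; simp)+
    qed
    moreover have cmpx: "mcomp (sqfree G) M (x G 0) = (if M = sqfree W then c G else 0)" if "finite G" for G M
    proof (cases "G \<subseteq> W")
      case True
      have le: "mdvd (sqfree G) (sqfree W)" using sqfree_mono[OF finW True] .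
      have "M - sqfree G = sqfree (W - G) \<longleftrightarrow> M = sqfree W" if "mdvd (sqfree G) M"
        using that le diff[OF True] by (metis mdvd_minus_add)
      then show ?thesis using True le by (auto simp: mcomp_def x_def lookup_single when_def diff)
    next
      case False
      then have "c G = 0" using cW by blast
      then show ?thesis using False by (simp add: x_def)
    qed
    moreover have "hmap n p 0 x = 0"
    proof (cases p)
      case (Suc p')
      have "koszul {1..n} (\<lambda>G. x G b) G = 0" if G: "G \<subseteq> {1..n}" for G b
      proof (cases "b = 0")
        case True
        have fin: "finite G" using G by (rule finite_subset) simp
        show ?thesis
        proof (rule mcomp_eqI[of "sqfree G"])
          fix M
          have "mcomp (sqfree G) M (koszul {1..n} (\<lambda>G. x G b) G) = bdry {1..n} (\<lambda>G. mcomp (sqfree G) M (x G b)) G"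
            by (rule mcomp_koszul[OF fin])
          also have "\<dots> = (if M = sqfree W then bdry {1..n} c G else 0)"
            using cmpx fin True by (auto simp: bdry_def intro!: sum.cong)
          also have "\<dots> = 0" using closed[OF fin] by simp
          finally show "mcomp (sqfree G) M (koszul {1..n} (\<lambda>G. x G b) G) = mcomp (sqfree G) M 0" by simp
        qed
      next
        case False
        then show ?thesis by (simp add: x_def)
      qed
      then show ?thesis using Suc by (auto simp: fun_eq_iff dkoszul_def)
    qed simp
    ultimately obtain y where y: "y \<in> arrays (cells n (Suc p)) {0} (multiples n ?U) (\<lambda>b. int (card W) - int (Suc p))"
      "dkoszul n y = x" using ac unfolding koszul_acyclic_def by blast
    define h where "h G = mcomp (sqfree G) (sqfree W) (y G 0)" for G
    have hs: "G \<subseteq> {1..n} \<and> card G = Suc p \<and> G \<subseteq> W \<and> (\<exists>l\<in>L. set l \<subseteq> W - G)" if nz: "h G \<noteq> 0" for G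
    proof -
      have "y G 0 \<noteq> 0" using nz by (auto simp: h_def)
      then have G: "G \<subseteq> {1..n}" "card G = Suc p" "Poly_Mapping.keys (y G 0) \<subseteq> multiples n ?U"
        using arraysD(1,3)[OF y(1)] unfolding cells_def by blast+
      have fin: "finite G" using G(1) by (rule finite_subset) simp
      have m: "mdvd (sqfree G) (sqfree W)" "sqfree W - sqfree G \<in> Poly_Mapping.keys (y G 0)"
        using nz by (auto simp: h_def mcomp_def in_keys_iff split: if_splits)
      have GW: "G \<subseteq> W" using m(1) fin finW by (simp add: mdvd_sqfree)
      have "sqfree (W - G) \<in> multiples n ?U" using m(2) G(3) diff[OF GW] by auto
      then have "\<exists>l\<in>L. set l \<subseteq> W - G" using mult[of "W - G"] Wn by blast
      then show ?thesis using G GW by blast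
    qed
    have "koszul_chain L W (Suc p) h" using hs by (simp add: koszul_chain_def)
    moreover have "bdry {1..n} h F = c F" for F
    proof (cases "F \<subseteq> {1..n}")
      case True
      have fin: "finite F" using True by (rule finite_subset) simp
      have "bdry {1..n} h F = mcomp (sqfree F) (sqfree W) (koszul {1..n} (\<lambda>G. y G 0) F)"
        unfolding mcomp_koszul[OF fin] h_def[abs_def] ..
      also have "koszul {1..n} (\<lambda>G. y G 0) F = dkoszul n y F 0" using True by (simp add: dkoszul_def)
      also have "\<dots> = x F 0" by (simp only: y(2))
      finally show ?thesis using cmpx[OF fin] by simp
    next
      case False
      then have "h (insert s F) = 0" for s using hs by blast
      moreover have "c F = 0" using cW False Wn by blast
      ultimately show ?thesis by (simp add: bdry_def)
    qed
    ultimately show False using nob by blast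
  qed
qed

section \<open>Lists and monomials\<close>

lemma spread_lists_distinct:
  assumes "t \<ge> 1" "l \<in> spread_lists n d t"
  shows "distinct l" "sorted_wrt (<) l" "length l = d" "set l \<subseteq> {1..n}"
  using assms spread_strict[OF assms(1), of l] by (auto simp: spread_lists_def strict_sorted_iff)

lemma mon_of_inj:
  assumes "sorted_wrt (<) a" "sorted_wrt (<) b" "mon_of a = mon_of b"
  shows "a = b"
proof -
  have "distinct a" "distinct b" using assms strict_sorted_iff by blast+
  then have "sqfree (set a) = sqfree (set b)" using assms(3) by (simp add: mon_of_sqfree)
  then have "set a = set b" by (metis keys_sqfree List.finite_set)
  then show ?thesis using assms(1,2) strict_sorted_equal by blast
qed

lemma list_less_iff_nth:
  fixes a b :: "nat list"
  assumes "length a = length b"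
  shows "(\<exists>s<length a. (\<forall>r<s. a ! r = b ! r) \<and> a ! s < b ! s) \<longleftrightarrow> a < b"
  using assms
proof (induction a b rule: list_induct2)
  case (Cons x a y b)
  have "(\<exists>s<length (x # a). (\<forall>r<s. (x # a) ! r = (y # b) ! r) \<and> (x # a) ! s < (y # b) ! s)
    \<longleftrightarrow> x < y \<or> x = y \<and> (\<exists>s<length a. (\<forall>r<s. a ! r = b ! r) \<and> a ! s < b ! s)" (is "?L \<longleftrightarrow> ?R")
  proof
    assume ?L
    then obtain s where s: "s < length (x # a)" "\<forall>r<s. (x # a) ! r = (y # b) ! r" "(x # a) ! s < (y # b) ! s" by blast
    show ?R
    proof (cases s)
      case 0
      then show ?thesis using s by simp
    next
      case (Suc s')
      then have "x = y" using s(2) by force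
      moreover have "\<forall>r<s'. a ! r = b ! r" using s(2) Suc by force
      ultimately show ?thesis using s(1,3) Suc by auto
    qed
  next
    assume ?R
    then show ?L
    proof
      assume "x < y"
      then show ?thesis by (intro exI[of _ 0]) simp
    next
      assume "x = y \<and> (\<exists>s<length a. (\<forall>r<s. a ! r = b ! r) \<and> a ! s < b ! s)"
      then obtain s where s: "x = y" "s < length a" "\<forall>r<s. a ! r = b ! r" "a ! s < b ! s" by blast
      then show ?thesis by (intro exI[of _ "Suc s"]) (auto simp: nth_Cons split: nat.splits)
    qed
  qed
  then show ?case using Cons.IH by simp
qed simp

lemma slex_ge_iff:
  assumes "t \<ge> 1" "a \<in> spread_lists n d t" "b \<in> spread_lists n d t"
  shows "slex_ge (mon_of a) (mon_of b) \<longleftrightarrow> a \<le> b"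
proof -
  note a = spread_lists_distinct[OF assms(1,2)] and b = spread_lists_distinct[OF assms(1,3)]
  have "slex_gt (mon_of a) (mon_of b) \<longleftrightarrow> (\<exists>s<length a. (\<forall>r<s. a ! r = b ! r) \<and> a ! s < b ! s)"
  proof
    assume "slex_gt (mon_of a) (mon_of b)"
    then obtain xs ys where *: "sorted_wrt (<) xs" "sorted_wrt (<) ys" "mon_of a = mon_of xs" "mon_of b = mon_of ys"
      "\<exists>s<length xs. (\<forall>r<s. xs ! r = ys ! r) \<and> xs ! s < ys ! s" unfolding slex_gt_def by blast
    have "xs = a" using mon_of_inj[OF *(1) a(2)] *(3) by simp
    moreover have "ys = b" using mon_of_inj[OF *(2) b(2)] *(4) by simp
    ultimately show "\<exists>s<length a. (\<forall>r<s. a ! r = b ! r) \<and> a ! s < b ! s" using *(5) by simp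
  next
    assume "\<exists>s<length a. (\<forall>r<s. a ! r = b ! r) \<and> a ! s < b ! s"
    then show "slex_gt (mon_of a) (mon_of b)"
      unfolding slex_gt_def using a(2,3) b(2,3) by (intro exI[of _ a] exI[of _ b]) simp
  qed
  also have "\<dots> \<longleftrightarrow> a < b" using a(3) b(3) by (intro list_less_iff_nth) simp
  finally have "slex_ge (mon_of a) (mon_of b) \<longleftrightarrow> mon_of a = mon_of b \<or> a < b" by (simp add: slex_ge_def)
  also have "mon_of a = mon_of b \<longleftrightarrow> a = b" using mon_of_inj a(2) b(2) by blast
  finally show ?thesis by auto
qed

lemma spread_iff_nth:
  assumes "t \<ge> 1"
  shows "spread t l \<longleftrightarrow> sorted l \<and> (\<forall>j. Suc j < length l \<longrightarrow> l ! Suc j - l ! j \<ge> t)"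
proof -
  have "spread t l \<longleftrightarrow> (\<forall>j. Suc j < length l \<longrightarrow> l ! j + t \<le> l ! Suc j)"
    unfolding spread_def by (rule sorted_wrt_iff_nth_Suc_transp) (auto intro: transpI)
  also have "\<dots> \<longleftrightarrow> (\<forall>j. Suc j < length l \<longrightarrow> l ! j \<le> l ! Suc j) \<and> (\<forall>j. Suc j < length l \<longrightarrow> l ! Suc j - l ! j \<ge> t)"
    using assms by (auto simp: le_diff_conv2)
  also have "(\<forall>j. Suc j < length l \<longrightarrow> l ! j \<le> l ! Suc j) \<longleftrightarrow> sorted l"
    by (simp add: sorted_iff_nth_Suc)
  finally show ?thesis .
qed

lemma tspread_monomials_eq:
  assumes "t \<ge> 1"
  shows "tspread_monomials n d t = mon_of ` spread_lists n d t"
  unfolding tspread_monomials_def spread_lists_def using spread_iff_nth[OF assms] by auto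

lemma lexseg_eq:
  assumes "t \<ge> 1" "a \<in> spread_lists n d t" "b \<in> spread_lists n d t"
  shows "lexseg n d t (mon_of a) (mon_of b) = mon_of ` seg n d t a b"
  unfolding lexseg_def seg_def tspread_monomials_eq[OF assms(1)]
  using slex_ge_iff[OF assms(1)] assms(2,3) by auto

lemma lq_set_list:
  assumes "lq_set S"
  shows "\<exists>ls. distinct ls \<and> set ls = S \<and> (\<forall>k<length ls. exchangeable (set (take k ls)) (ls ! k))"
  using assms
proof (induction S rule: lq_set.induct)
  case (lq_set_insert S a)
  then obtain ls where ls: "distinct ls" "set ls = S" "\<forall>k<length ls. exchangeable (set (take k ls)) (ls ! k)" by blast
  have "exchangeable (set (take k (ls @ [a]))) ((ls @ [a]) ! k)" if "k < length (ls @ [a])" for k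
  proof (cases "k < length ls")
    case True
    then show ?thesis using ls(3) by (simp add: nth_append)
  next
    case False
    then have "k = length ls" using that by simp
    then show ?thesis using ls(2) lq_set_insert.hyps(3) by simp
  qed
  then show ?case using ls lq_set_insert.hyps(2) by (intro exI[of _ "ls @ [a]"]) auto
qed simp

lemma mdvd_mon_of_iff:
  assumes "distinct b" "distinct a"
  shows "mdvd (mon_of b) (q + mon_of a) \<longleftrightarrow> set b - set a \<subseteq> Poly_Mapping.keys q"
  using assms by (auto simp: mon_of_sqfree mdvd_def lookup_sqfree lookup_add in_keys_iff subset_iff)

text \<open>The exchange property at each position is exactly the condition that the colon ideal is generated by
  variables. The generators are minimal because they all have the same degree.\<close>

theorem linear_quotients_if_lq_set:
  assumes t: "t \<ge> 1" and S: "S \<subseteq> spread_lists n d t" and lq: "lq_set S"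
  shows "linear_quotients n (monomial_ideal n (mon_of ` S) :: 'k::field mpoly set)"
proof -
  obtain ls where ls: "distinct ls" "set ls = S" "\<And>k. k < length ls \<Longrightarrow> exchangeable (set (take k ls)) (ls ! k)"
    using lq_set_list[OF lq] by blast
  have Sl: "distinct l" "sorted_wrt (<) l" "length l = d" "set l \<subseteq> {1..n}" if "l \<in> S" for l
    using spread_lists_distinct[OF t] S that by blast+
  have Sm: "mon_of l \<in> monomials n" if "l \<in> S" for l
    using Sl[OF that] by (simp add: mon_of_sqfree sqfree_monomials)
  have inj: "inj_on mon_of S" by (rule inj_onI) (rule mon_of_inj[OF Sl(2) Sl(2)])
  have deg: "mon_deg (mon_of l) = d" if "l \<in> S" for l
    using Sl[OF that] by (simp add: mon_of_sqfree mon_deg_sqfree distinct_card)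
  define us where "us = map mon_of ls"
  have set_us: "set us = mon_of ` S" using ls(2) by (simp add: us_def)
  have "distinct us" unfolding us_def using ls(1,2) inj by (simp add: distinct_map)
  moreover have "minimal_monomial_generators n (set us) (monomial_ideal n (mon_of ` S) :: 'k mpoly set)"
    unfolding minimal_monomial_generators_def set_us
  proof (intro conjI allI impI)
    show sub: "mon_of ` S \<subseteq> monomials n" using Sm by blast
    fix G' assume G': "G' \<subset> mon_of ` S"
    then obtain l where l: "l \<in> S" "mon_of l \<notin> G'" by blast
    show "monomial_ideal n G' \<noteq> (monomial_ideal n (mon_of ` S) :: 'k mpoly set)"
    proof
      assume eq: "monomial_ideal n G' = (monomial_ideal n (mon_of ` S) :: 'k mpoly set)"
      have G'm: "G' \<subseteq> monomials n" using G' sub by blast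
      have "(mono_poly (mon_of l) :: 'k mpoly) \<in> monomial_ideal n (mon_of ` S)"
        using l(1) Sm mono_poly_mem[OF sub] mdvd_refl by blast
      then have "(mono_poly (mon_of l) :: 'k mpoly) \<in> monomial_ideal n G'" by (simp only: eq)
      then obtain g where g: "g \<in> G'" "mdvd g (mon_of l)" using mono_poly_mem[OF G'm] by blast
      then obtain l' where l': "l' \<in> S" "g = mon_of l'" using G' by blast
      have "mon_deg (mon_of l - g) = 0" using mon_deg_minus[OF g(2)] deg[OF l(1)] deg[OF l'(1)] l'(2) by simp
      then have "mon_of l = g" using mdvd_add_minus[OF g(2)] by (simp add: mon_deg_zero_iff)
      then show False using g(1) l(2) by simp
    qed
  qed simp
  moreover have "\<exists>V\<subseteq>{1..n}. colon n (monomial_ideal n (set (take k us)) :: 'k mpoly set) (mono_poly (us ! k))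
                        = genideal (polyring n) (var ` V)" if k: "k < length us" for k
  proof -
    define a where "a = ls ! k"
    define B where "B = set (take k ls)"
    have kl: "k < length ls" using k by (simp add: us_def)
    have aS: "a \<in> S" using kl ls(2) by (auto simp: a_def)
    have BS: "B \<subseteq> S" using ls(2) set_take_subset unfolding B_def by fast
    have usk: "us ! k = mon_of a" "set (take k us) = mon_of ` B"
      using kl by (simp_all add: us_def a_def B_def take_map)
    have Bm: "mon_of ` B \<subseteq> monomials n" using BS Sm by blast
    define V where "V = {j. \<exists>l\<in>B. set l - set a = {j}}"
    have Vn: "V \<subseteq> {1..n}"
    proof
      fix j assume "j \<in> V"
      then obtain l where "l \<in> B" "set l - set a = {j}" by (auto simp: V_def)
      then have "j \<in> set l" "l \<in> S" using BS by blast+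
      then show "j \<in> {1..n}" using Sl(4) by blast
    qed
    have key: "q + mon_of a \<in> multiples n (mon_of ` B) \<longleftrightarrow> (\<exists>x\<in>V. x \<in> Poly_Mapping.keys q)" if q: "q \<in> monomials n" for q
    proof
      assume "q + mon_of a \<in> multiples n (mon_of ` B)"
      then obtain b where b: "b \<in> B" "mdvd (mon_of b) (q + mon_of a)" by (auto simp: multiples_def)
      then have sub: "set b - set a \<subseteq> Poly_Mapping.keys q" using mdvd_mon_of_iff Sl(1) aS BS by blast
      have "\<exists>j\<in>set b - set a. \<exists>z\<in>B. set z - set a = {j}"
        using ls(3)[OF kl] b(1) unfolding exchangeable_def a_def B_def by (rule bspec)
      then obtain j z where jz: "j \<in> set b - set a" "z \<in> B" "set z - set a = {j}" by (elim bexE)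
      have "j \<in> V" unfolding V_def using jz(2,3) by (intro CollectI bexI)
      then show "\<exists>x\<in>V. x \<in> Poly_Mapping.keys q" using jz(1) sub by blast
    next
      assume "\<exists>x\<in>V. x \<in> Poly_Mapping.keys q"
      then obtain x l where x: "x \<in> Poly_Mapping.keys q" "l \<in> B" "set l - set a = {x}" by (auto simp: V_def)
      have "set l - set a \<subseteq> Poly_Mapping.keys q" unfolding x(3) using x(1) by simp
      then have "mdvd (mon_of l) (q + mon_of a)" using mdvd_mon_of_iff[of l a q] Sl(1) aS x(2) BS by blast
      moreover have "q + mon_of a \<in> monomials n" using q Sm[OF aS] by simp
      ultimately show "q + mon_of a \<in> multiples n (mon_of ` B)" using x(2) by (auto simp: multiples_def)
    qed
    have "{q \<in> monomials n. q + mon_of a \<in> multiples n (mon_of ` B)} = {q \<in> monomials n. \<exists>x\<in>V. x \<in> Poly_Mapping.keys q}"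
      using key by blast
    then have "colon n (monomial_ideal n (mon_of ` B) :: 'k mpoly set) (mono_poly (mon_of a)) = genideal (polyring n) (var ` V)"
      using colon_monomial_ideal_mem[OF Bm Sm[OF aS]] var_ideal_mem[OF Vn] by blast
    then show ?thesis using Vn usk by metis
  qed
  ultimately show ?thesis unfolding linear_quotients_def by blast
qed

text \<open>Both properties are equivalent to the linearity condition on the ends of the segment.\<close>

theorem lexsegment_linear_quotients_iff:
  fixes I :: "'k::field mpoly set"
  assumes t: "t \<ge> 1" and I: "tspread_lexsegment_ideal n d t I"
  shows "linear_quotients n I \<longleftrightarrow> has_linear_resolution n d I"
proof -
  obtain u v where uv: "u \<in> spread_lists n d t" "v \<in> spread_lists n d t" "slex_ge (mon_of u) (mon_of v)"
    "I = monomial_ideal n (lexseg n d t (mon_of u) (mon_of v))"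
    using I unfolding tspread_lexsegment_ideal_def tspread_monomials_eq[OF t] by blast
  have le: "u \<le> v" using uv(3) slex_ge_iff[OF t uv(1,2)] by simp
  define S where "S = seg n d t u v"
  have Isub: "I = monomial_ideal n (mon_of ` S)" using uv(4) lexseg_eq[OF t uv(1,2)] by (simp add: S_def)
  have S: "S \<subseteq> spread_lists n d t" by (auto simp: S_def seg_def)
  have Sl: "distinct l \<and> set l \<subseteq> {1..n}" if "l \<in> S" for l using spread_lists_distinct[OF t] S that by blast
  have U: "finite (mon_of ` S)" "mon_of ` S \<noteq> {}" "mon_of ` S \<subseteq> monomials n"
  proof -
    show "finite (mon_of ` S)" by (simp add: S_def finite_seg)
    have "u \<in> S" using uv(1) le by (simp add: S_def seg_def)
    then show "mon_of ` S \<noteq> {}" by blast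
    show "mon_of ` S \<subseteq> monomials n" using Sl by (auto simp: mon_of_sqfree sqfree_monomials)
  qed
  have deg: "mon_deg g = d" if "g \<in> mon_of ` S" for g
    using that S spread_lists_distinct[OF t] by (auto simp: mon_of_sqfree mon_deg_sqfree distinct_card subset_iff)
  show ?thesis
  proof
    assume "linear_quotients n I"
    then show "has_linear_resolution n d I"
      unfolding Isub by (intro linear_resolution_if_linear_quotients[OF U deg])
  next
    assume lr: "has_linear_resolution n d I"
    have "linearity_cond n t u v"
    proof (rule ccontr)
      assume "\<not> linearity_cond n t u v"
      from obstruction_if_not_linearity_cond[OF t uv(1,2) le this, where 'k = 'k]
      obtain W q and x :: "nat set \<Rightarrow> 'k" where "koszul_obstruction n d S W q x" unfolding S_def by blast
      from not_koszul_acyclic_if_obstruction[OF Sl this]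
      have ob: "card W \<noteq> d + q" "\<not> koszul_acyclic n (multiples n (mon_of ` S)) q (int (card W)) TYPE('k)" by blast+
      have "int (card W) - int q \<noteq> int d" using ob(1) by linarith
      then have "koszul_acyclic n (multiples n (mon_of ` S)) q (int q + (int (card W) - int q)) TYPE('k)"
        using lr unfolding Isub linear_resolution_iff_koszul[OF U] by blast
      then show False using ob(2) by simp
    qed
    then have "lq_set S" unfolding S_def by (rule lq_set_seg[OF t uv(1,2) le])
    then show "linear_quotients n I" unfolding Isub by (rule linear_quotients_if_lq_set[OF t S])
  qed
qed

theorem theorem3p2:
  fixes n d t :: nat and I :: "'k::field mpoly set"
  assumes "n \<ge> 1" and "d \<ge> 1" and "t \<ge> 1"
    and "n \<ge> 1 + (d - 1) * t"
    and "incompletely_tspread_lexsegment n d t I"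
  shows "linear_quotients n I \<longleftrightarrow> has_linear_resolution n d I"
  using assms(3,5) lexsegment_linear_quotients_iff
  unfolding incompletely_tspread_lexsegment_def by blast

end
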